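(* Let $S$ be a log-linearly slowly decreasing function of local bounded variation on $[0,\infty)$ whose Laplace transform converges on $\Re e\, s>1$. Let $U(s)=\Re e\,\mathcal{L}\{\mathrm{d}S;s\}$, where $\mathcal{L}\{\mathrm{d}S;s\}=\int_{0^-}^{\infty}e^{-sx}\,\mathrm{d}S(x)$ for $\Re e\, s>1$. Suppose that $U$ has $L^{1}_{loc}$-boundary behavior on $1+i(\mathbb{R}\setminus\{0\})$, and that there is some $\lambda>0$ such that one of the following three conditions holds: (B.1) there is $c\geq 0$ such that $U(\sigma+it)\geq -c$ for all $t\in(-\lambda,\lambda)$ and $\sigma\in(1,2]$; (B.2) $\sup_{1<\sigma<2}\int_{-\lambda}^{\lambda}|U(\sigma+it)|\,\mathrm{d}t<\infty$; (B.3) there are $g\in L^{1}(-\lambda,\lambda)$ and $k\in\mathbb{N}$ such that $U(\sigma+it)\geq g(t)$ for a.e. $t\in(-\lambda,\lambda)$ and all $\sigma\in(1,2]$, and $U(\sigma+it)=O((\sigma-1)^{-k})$ for $t\in(-\lambda,\lambda)$ and $\sigma\in(1,2]$. Then $S(x)\sim a e^{x}$ as $x\to\infty$, where $a=\lim_{\sigma\to1^{+}}(\sigma-1)U(\sigma)$.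
   Context: A function $S$ is called log-linearly slowly decreasing (at $\infty$) if for each $\varepsilon>0$ there are $h,x_0>0$ such that $\frac{S(y)-S(x)}{e^{x}}\geq-\varepsilon$ for all $x\leq y\leq x+h$ and $x\geq x_0$. Functions of local bounded variation are normalized to be right continuous. A harmonic function $U$ on $\Re e\, s>1$ has $L^{1}_{loc}$-boundary behavior on $1+i(\mathbb{R}\setminus\{0\})$ if there is $f\in L^{1}_{loc}(\mathbb{R}\setminus\{0\})$ such that for every bounded closed interval $I\subset\mathbb{R}\setminus\{0\}$ one has $\lim_{\sigma\to1^{+}}\int_I|U(\sigma+it)-f(t)|\,\mathrm{d}t=0$. *)

theory Defs
  imports "HOL-Analysis.Analysis"
begin

definition bv_on :: "(real \<Rightarrow> real) \<Rightarrow> real \<Rightarrow> real \<Rightarrow> bool" where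
  "bv_on S a b \<longleftrightarrow> (\<exists>M. \<forall>(n::nat) (p::nat \<Rightarrow> real).
      p 0 = a \<and> p n = b \<and> (\<forall>i<n. p i \<le> p (Suc i)) \<longrightarrow>
      (\<Sum>i<n. \<bar>S (p (Suc i)) - S (p i)\<bar>) \<le> M)"

definition local_bv_nonneg :: "(real \<Rightarrow> real) \<Rightarrow> bool" where
  "local_bv_nonneg S \<longleftrightarrow> (\<forall>b\<ge>0. bv_on S 0 b)"

definition log_linearly_slowly_decreasing :: "(real \<Rightarrow> real) \<Rightarrow> bool" where
  "log_linearly_slowly_decreasing S \<longleftrightarrow>
     (\<forall>\<epsilon>>0. \<exists>h>0. \<exists>x0>0. \<forall>x y. x0 \<le> x \<and> x \<le> y \<and> y \<le> x + h \<longrightarrow>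
        (S y - S x) / exp x \<ge> - \<epsilon>)"

text \<open>Extension by 0 to the negative axis (so that the integral from 0^- picks up the jump S(0)).\<close>
definition ext0 :: "(real \<Rightarrow> real) \<Rightarrow> real \<Rightarrow> real" where
  "ext0 S x = (if x < 0 then 0 else S x)"

text \<open>Lebesgue--Stieltjes integral over [0^-,T] of f with respect to dS, S right continuous of
  local bounded variation: via a Jordan decomposition of ext0 S into right continuous
  nondecreasing functions (the result does not depend on the decomposition).\<close>
definition LS_integral :: "(real \<Rightarrow> real) \<Rightarrow> (real \<Rightarrow> complex) \<Rightarrow> real \<Rightarrow> complex" where
  "LS_integral S f T =
     (let (F, G) = (SOME (F, G). mono F \<and> mono G \<and>
                      (\<forall>x. continuous (at_right x) F) \<and> (\<forall>x. continuous (at_right x) G) \<and>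
                      (\<forall>x. ext0 S x = F x - G x))
      in (LINT x:{0..T}|interval_measure F. f x) - (LINT x:{0..T}|interval_measure G. f x))"

definition laplace_converges :: "(real \<Rightarrow> real) \<Rightarrow> complex \<Rightarrow> bool" where
  "laplace_converges S s \<longleftrightarrow>
     (\<exists>L. ((\<lambda>T. LS_integral S (\<lambda>x. exp (- s * complex_of_real x)) T) \<longlongrightarrow> L) at_top)"

definition laplace_dS :: "(real \<Rightarrow> real) \<Rightarrow> complex \<Rightarrow> complex" where
  "laplace_dS S s = Lim at_top (\<lambda>T. LS_integral S (\<lambda>x. exp (- s * complex_of_real x)) T)"

end

theory Submission
  imports Defs "HOL-Complex_Analysis.Complex_Analysis" "HOL-Real_Asymp.Real_Asymp"
begin

text \<open>For x \<ge> 0 put T(x) = S(x) e^(-x). Since S is real, U(\<sigma> + it) is the cosine transform of e^(-\<sigma>x) dS(x),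
  so pairing U with a real even test function needs no information on the imaginary part of the transform.

  Away from 0 the boundary values of U are an integrable function f. Near 0, a lower bound for U and
  harmonicity bound the L^1 norms of U(\<sigma> + i\<cdot>): for a weight p vanishing to second order at both ends and convex
  near 0, A(\<sigma>) = \<integral> p(t) U(\<sigma> + it) dt satisfies A'' = - \<integral> p'' U \<le> C. Hence along some sequence \<sigma> \<rightarrow> 1 the measures
  U(\<sigma> + it) dt converge to f(t) dt plus a point mass c at 0.

  Let D(x) be the increment of \<integral> e^(-w) dS(w) over a window around x. Slow decrease bounds D from below,
  and testing against Fejer kernels shows that Fejer means of D converge, by the Riemann-Lebesgue lemma,
  to a multiple of c. As D is bounded below, its local means are bounded. D = Z + Z' for the moving
  integral Z of T, so Z and hence T are bounded, and the Fejer means of Z converge. Slow decrease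
  turns this into convergence of T, and an Abelian argument identifies the limit.\<close>

section \<open>Jordan decomposition\<close>

text \<open>Window increments are used because the Laplace transform of S itself is L{dS;s}/s, whose
  real part also involves the imaginary part of L{dS;s}. A centred window multiplies L{dS;s} by a
  real factor, so its increments are governed by U alone. Fejer kernels fit for two reasons: they
  are nonnegative, so a lower bound for D turns a bounded mean into bounded local mass, and they are
  cosine transforms of compactly supported tents, so only a bounded segment of the boundary enters.
  The same identity is used twice. For \<sigma> > 1 all integrals converge absolutely, but at
  \<sigma> = 1 nothing is known at first, and only Fatou's lemma, applied to D plus a constant,
  reaches the line. Once T is known to be bounded, dominated convergence gives the identity on the
  line itself, with the point mass c. A sequence \<sigma> -> 1 is enough there, since the side
  carrying D converges along any sequence. All three conditions are reduced to one statement, a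
  uniform L^1 bound for U(\<sigma> + it) in t near 0: (B.2) is such a bound, while (B.1) and (B.3)
  provide an integrable minorant.\<close>

lemma mono_right_limit:
  fixes F :: "real \<Rightarrow> real"
  assumes F: "mono F"
  defines "H \<equiv> \<lambda>x. Inf (F ` {x<..})"
  shows "(F \<longlongrightarrow> H x) (at_right x)" "mono H" "continuous (at_right x) H"
proof -
  have bdd: "bdd_below (F ` {x<..})" for x
    by (rule bdd_belowI2[of _ "F x"]) (auto intro: monoD[OF F])
  show "(F \<longlongrightarrow> H x) (at_right x)"
    using Lim_right_bound[of UNIV x F "F x"] monoD[OF F] by (auto simp: H_def)
  show "mono H"
    unfolding H_def by (intro monoI cInf_superset_mono bdd) auto
  have H_le: "H x \<le> F y" if "x < y" for x y
    unfolding H_def using that by (intro cInf_lower bdd) auto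
  show "continuous (at_right x) H"
    unfolding continuous_within
  proof (rule order_tendstoI)
    fix a assume a: "a < H x"
    have "a < H y" if "x < y" for y
      using a monoD[OF \<open>mono H\<close>, of x y] that by simp
    then show "\<forall>\<^sub>F y in at_right x. a < H y"
      using eventually_at_right_less[of x] by (auto elim: eventually_mono)
  next
    fix a assume a: "H x < a"
    then obtain d where d: "d > x" "F d < a"
      unfolding H_def using cInf_lessD[of "F ` {x<..}" a] by auto
    have "\<forall>\<^sub>F y in at_right x. y \<in> {x<..<d}"
      using d by (intro eventually_at_rightI[of x d]) auto
    then show "\<forall>\<^sub>F y in at_right x. H y < a"
      proof eventually_elim
      case (elim y)
      then show ?case using H_le[of y d] d by simp
    qed
  qed
qed

definition var_sums :: "(real \<Rightarrow> real) \<Rightarrow> real \<Rightarrow> real set" where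
  "var_sums S x = {v. \<exists>(n::nat) p. p 0 = 0 \<and> p n = x \<and> (\<forall>i<n. p i \<le> p (Suc i)) \<and>
     v = (\<Sum>i<n. \<bar>S (p (Suc i)) - S (p i)\<bar>)}"

text \<open>The variation function is never shown to be right continuous. Instead both monotone
  components are replaced by their right limits; the difference stays \<open>ext0 S\<close> because
  \<open>ext0 S\<close> is right continuous.\<close>

lemma jordan_decomposition:
  assumes bv: "local_bv_nonneg S" and rc: "\<forall>x\<ge>0. continuous (at_right x) S"
  shows "\<exists>F G. mono F \<and> mono G \<and> (\<forall>x. continuous (at_right x) F) \<and>
           (\<forall>x. continuous (at_right x) G) \<and> (\<forall>x. ext0 S x = F x - G x)"
proof -
  define V where "V x = Sup (var_sums S x)" for x
  have bdd: "bdd_above (var_sums S x)" if "x \<ge> 0" for x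
  proof -
    have "bv_on S 0 x" using bv that by (simp add: local_bv_nonneg_def)
    then obtain M where M: "\<forall>(n::nat) p. p 0 = 0 \<and> p n = x \<and> (\<forall>i<n. p i \<le> p (Suc i)) \<longrightarrow>
        (\<Sum>i<n. \<bar>S (p (Suc i)) - S (p i)\<bar>) \<le> M"
      unfolding bv_on_def ..
    show ?thesis
      unfolding var_sums_def by (rule bdd_aboveI[of _ M]) (use M in blast)
  qed
  have ne: "\<bar>S x - S 0\<bar> \<in> var_sums S x" if "x \<ge> 0" for x
    unfolding var_sums_def using that
    by (intro CollectI exI[of _ "1::nat"] exI[of _ "\<lambda>i. if i = 0 then 0 else x"]) auto
  have V_ge: "\<bar>S x - S 0\<bar> \<le> V x" if "x \<ge> 0" for x
    unfolding V_def using ne bdd that by (intro cSup_upper)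
  have step: "V x + \<bar>S y - S x\<bar> \<le> V y" if xy: "0 \<le> x" "x \<le> y" for x y
  proof -
    have "V x \<le> V y - \<bar>S y - S x\<bar>"
      unfolding V_def[of x]
    proof (rule cSup_least)
      show "var_sums S x \<noteq> {}" using ne xy by auto
      fix v assume "v \<in> var_sums S x"
      then obtain n :: nat and p where p: "p 0 = 0" "p n = x" "\<forall>i<n. p i \<le> p (Suc i)"
        and v: "v = (\<Sum>i<n. \<bar>S (p (Suc i)) - S (p i)\<bar>)"
        unfolding var_sums_def by auto
      define q where "q = p(Suc n := y)"
      have "v + \<bar>S y - S x\<bar> = (\<Sum>i<Suc n. \<bar>S (q (Suc i)) - S (q i)\<bar>)"
        using p by (simp add: v q_def)
      moreover have "q 0 = 0" "q (Suc n) = y" "\<forall>i<Suc n. q i \<le> q (Suc i)"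
        using p xy by (auto simp: q_def less_Suc_eq)
      ultimately have "v + \<bar>S y - S x\<bar> \<in> var_sums S y"
        unfolding var_sums_def by blast
      then have "v + \<bar>S y - S x\<bar> \<le> V y"
        unfolding V_def using bdd xy by (intro cSup_upper) auto
      then show "v \<le> V y - \<bar>S y - S x\<bar>" by simp
    qed
    then show ?thesis by simp
  qed
  \<comment> \<open>Partitions of [0, x] do not see the jump of \<open>ext0 S\<close> at 0; the
    summand \<open>\<bar>S 0\<bar>\<close> accounts for it.\<close>
  define F where "F x = (if x < 0 then 0 else V x + \<bar>S 0\<bar>)" for x
  define G where "G x = F x - ext0 S x" for x
  have F: "mono F"
  proof (rule monoI)
    fix x y :: real assume "x \<le> y"
    then show "F x \<le> F y"
      using step[of x y] V_ge[of y] by (auto simp: F_def not_less)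
  qed
  have G: "mono G"
  proof (rule monoI)
    fix x y :: real assume "x \<le> y"
    then show "G x \<le> G y"
      using step[of x y] V_ge[of y] by (auto simp: G_def F_def ext0_def not_less)
  qed
  note lF = mono_right_limit[OF F] and lG = mono_right_limit[OF G]
  have "ext0 S x = Inf (F ` {x<..}) - Inf (G ` {x<..})" for x
  proof (rule tendsto_unique[of "at_right x"])
    show "((\<lambda>x. F x - G x) \<longlongrightarrow> Inf (F ` {x<..}) - Inf (G ` {x<..})) (at_right x)"
      by (intro tendsto_diff lF lG)
    have "(ext0 S \<longlongrightarrow> ext0 S x) (at_right x)"
    proof (cases "x < 0")
      case True
      then have "\<forall>\<^sub>F y in at_right x. ext0 S y = ext0 S x"
        by (intro eventually_at_rightI[of x 0]) (auto simp: ext0_def)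
      then show ?thesis by (rule tendsto_eventually)
    next
      case False
      then have "(S \<longlongrightarrow> ext0 S x) (at_right x)"
        using rc by (auto simp: ext0_def continuous_within)
      then show ?thesis
        by (rule Lim_transform_eventually)
          (use False in \<open>auto simp: ext0_def eventually_at_filter intro!: always_eventually\<close>)
    qed
    then show "((\<lambda>x. F x - G x) \<longlongrightarrow> ext0 S x) (at_right x)"
      by (simp add: G_def)
  qed simp
  with lF(2,3) lG(2,3) show ?thesis
    by (intro exI[of _ "\<lambda>x. Inf (F ` {x<..})"] exI[of _ "\<lambda>x. Inf (G ` {x<..})"] conjI allI)
qed

section \<open>Laplace-Stieltjes transforms\<close>

text \<open>Keeping the factor \<open>s\<close> on the left avoids a division and so a case s =
  0.\<close>

lemma LBINT_exp_Icc:
  fixes s :: complex and x T :: real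
  assumes "x \<le> T"
  shows "s * (LBINT u. indicator {x..T} u *\<^sub>R exp (- s * complex_of_real u))
          = exp (- s * of_real x) - exp (- s * of_real T)"
proof -
  have "(LBINT u. indicator {x..T} u *\<^sub>R (s * exp (- s * complex_of_real u)))
      = (- exp (- s * of_real T)) - (- exp (- s * of_real x))"
  proof (rule integral_FTC_Icc[OF assms])
    fix u
    have "((\<lambda>z. - exp (- s * z)) has_field_derivative s * exp (- s * of_real u)) (at (of_real u))"
      by (auto intro!: derivative_eq_intros)
    from has_vector_derivative_real_field[OF this]
    show "((\<lambda>u. - exp (- s * complex_of_real u)) has_vector_derivative s * exp (- s * of_real u))
      (at u within {x..T})"
      by (rule has_vector_derivative_at_within)
  qed (intro continuous_intros)
  moreover have "s * (LBINT u. indicator {x..T} u *\<^sub>R exp (- s * complex_of_real u)) =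
      (LBINT u. indicator {x..T} u *\<^sub>R (s * exp (- s * complex_of_real u)))"
    unfolding integral_mult_right_zero[symmetric]
    by (intro Bochner_Integration.integral_cong) auto
  ultimately show ?thesis by simp
qed

text \<open>On [0, T] the integrand is exp(-sT) plus s times the integral of exp(-su) over u from x
  to T. Fubini then exchanges u with the Stieltjes variable x. The closed interval keeps the atom at
  0.\<close>

lemma stieltjes_exp_by_parts:
  fixes s :: complex
  assumes F: "mono F" "\<And>x. continuous (at_right x) F" and T: "0 \<le> T"
  defines "M \<equiv> interval_measure F"
  shows "(LINT x:{0..T}|M. exp (- s * of_real x)) =
     exp (- s * of_real T) * of_real (measure M {0..T}) +
     s * (LBINT u. indicator {0..T} u *\<^sub>R (exp (- s * of_real u) * of_real (measure M {0..u})))"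
    and "emeasure M {0..T} < \<infinity>"
proof -
  interpret M: sigma_finite_measure M
    unfolding M_def by (rule sigma_finite_interval_measure) (use F in \<open>auto dest: monoD\<close>)
  interpret pair_sigma_finite M lborel ..
  have [measurable_cong, simp]: "sets M = sets borel" by (simp add: M_def)
  have "emeasure M {0..T} \<le> emeasure M {-1<..T}"
    using T by (intro emeasure_mono) auto
  also have "\<dots> < \<infinity>"
    unfolding M_def by (subst emeasure_interval_measure_Ioc) (use F T in \<open>auto dest: monoD\<close>)
  finally show fin: "emeasure M {0..T} < \<infinity>" .
  let ?f = "\<lambda>x u. indicator {0..T} x *\<^sub>R (indicator {x..T} u *\<^sub>R exp (- s * complex_of_real u))"
  have int: "integrable (M \<Otimes>\<^sub>M lborel) (case_prod ?f)"
  proof (rule integrableI_bounded_set[where A="{0..T} \<times> {0..T}" and B="exp (\<bar>Re s\<bar> * T)"])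
    show "case_prod ?f \<in> borel_measurable (M \<Otimes>\<^sub>M lborel)"
      by (measurable; simp add: atLeastAtMost_def atLeast_def atMost_def) measurable
    show "emeasure (M \<Otimes>\<^sub>M lborel) ({0..T} \<times> {0..T}) < \<infinity>"
      using fin T by (subst lborel.emeasure_pair_measure_Times) (auto simp: ennreal_mult_less_top)
    have "- (Re s * u) \<le> \<bar>Re s\<bar> * T" if "0 \<le> u" "u \<le> T" for u
      using that abs_ge_minus_self[of "Re s * u"] mult_left_mono[of u T "\<bar>Re s\<bar>"] by (auto simp: abs_mult)
    then have "norm (case_prod ?f z) \<le> exp (\<bar>Re s\<bar> * T)" for z
      by (cases z) (simp split: split_indicator)
    then show "AE z in M \<Otimes>\<^sub>M lborel. z \<in> {0..T} \<times> {0..T} \<longrightarrow> norm (case_prod ?f z) \<le> exp (\<bar>Re s\<bar> * T)"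
      by blast
    have "case_prod ?f z = 0" if "z \<notin> {0..T} \<times> {0..T}" for z
      using that by (cases z) (auto split: split_indicator)
    then show "AE z in M \<Otimes>\<^sub>M lborel. z \<notin> {0..T} \<times> {0..T} \<longrightarrow> case_prod ?f z = 0"
      by blast
  qed simp
  have fi: "integrable M (\<lambda>x. indicator {0..T} x *\<^sub>R exp (- s * of_real T))"
    using fin by (intro integrable_scaleR_left integrable_real_indicator) auto
  have "(LINT x:{0..T}|M. exp (- s * of_real x)) =
     (\<integral>x. indicator {0..T} x *\<^sub>R exp (- s * of_real T) + s * (LBINT u. ?f x u) \<partial>M)"
    unfolding set_lebesgue_integral_def
  proof (intro Bochner_Integration.integral_cong refl)
    fix x
    show "indicator {0..T} x *\<^sub>R exp (- s * of_real x) =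
      indicator {0..T} x *\<^sub>R exp (- s * of_real T) + s * (LBINT u. ?f x u)"
      using LBINT_exp_Icc[of x T s] by (cases "x \<in> {0..T}") (simp_all add: algebra_simps)
  qed
  also have "\<dots> = (\<integral>x. indicator {0..T} x *\<^sub>R exp (- s * of_real T) \<partial>M) + s * (\<integral>x. (LBINT u. ?f x u) \<partial>M)"
    using fi integrable_fst[OF int] by (subst Bochner_Integration.integral_add) auto
  also have "(\<integral>x. indicator {0..T} x *\<^sub>R exp (- s * of_real T) \<partial>M) =
     exp (- s * of_real T) * of_real (measure M {0..T})"
    using fin by (simp add: scaleR_conv_of_real mult.commute)
  also have "(\<integral>x. (LBINT u. ?f x u) \<partial>M) = (LBINT u. (\<integral>x. ?f x u \<partial>M))"
    using Fubini_integral[OF int] by simp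
  also have "\<dots> = (LBINT u. indicator {0..T} u *\<^sub>R (exp (- s * of_real u) * of_real (measure M {0..u})))"
  proof (intro Bochner_Integration.integral_cong refl)
    fix u
    have "(\<integral>x. ?f x u \<partial>M) = (\<integral>x. indicator {0..u} x *\<^sub>R (indicator {0..T} u *\<^sub>R exp (- s * of_real u)) \<partial>M)"
      by (intro Bochner_Integration.integral_cong refl) (auto simp: indicator_def)
    also have "\<dots> = measure M {0..u} *\<^sub>R (indicator {0..T} u *\<^sub>R exp (- s * of_real u))"
    proof (cases "u \<le> T")
      case True
      then have "emeasure M {0..u} \<le> emeasure M {0..T}" by (intro emeasure_mono) auto
      then have "emeasure M {0..u} < \<infinity>" using fin by (rule le_less_trans)
      then show ?thesis by simp
    qed auto
    finally show "(\<integral>x. ?f x u \<partial>M) = indicator {0..T} u *\<^sub>R (exp (- s * of_real u) * of_real (measure M {0..u}))"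
      by (simp add: scaleR_conv_of_real mult_ac)
  qed
  finally show "(LINT x:{0..T}|M. exp (- s * of_real x)) =
     exp (- s * of_real T) * of_real (measure M {0..T}) +
     s * (LBINT u. indicator {0..T} u *\<^sub>R (exp (- s * of_real u) * of_real (measure M {0..u})))" .
qed

text \<open>The atom at 0 forces an approximation of [0, u] by half-open intervals starting at
  -1/(n+1). There \<open>ext0 S\<close> vanishes, so F and G agree at the left endpoints and these
  values cancel.\<close>

lemma measure_interval_measure_Icc_diff:
  assumes F: "mono F" "\<And>x. continuous (at_right x) F"
    and G: "mono G" "\<And>x. continuous (at_right x) G"
    and eq: "\<And>x. ext0 S x = F x - G x" and u: "0 \<le> u"
  shows "measure (interval_measure F) {0..u} - measure (interval_measure G) {0..u} = S u"
proof -
  have lim: "(\<lambda>n. H u - H (- 1 / real (Suc n))) \<longlonglongrightarrow> measure (interval_measure H) {0..u}"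
    if H: "mono H" "\<And>x. continuous (at_right x) H" for H :: "real \<Rightarrow> real"
  proof -
    let ?A = "\<lambda>n. {- 1 / real (Suc n)<..u}"
    have neg: "- 1 / real (Suc n) \<le> u" for n
      using u by (intro order.trans[OF _ u]) (simp add: field_simps)
    have "(\<lambda>n. measure (interval_measure H) (?A n)) \<longlonglongrightarrow> measure (interval_measure H) (\<Inter>n. ?A n)"
    proof (rule Lim_measure_decseq)
      show "range ?A \<subseteq> sets (interval_measure H)" by auto
      show "decseq ?A"
        unfolding decseq_def
      proof (intro allI impI)
        fix m n :: nat assume "m \<le> n"
        then have "- 1 / real (Suc m) \<le> - 1 / real (Suc n)"
          by (simp add: field_simps)
        then show "?A n \<subseteq> ?A m" by auto
      qed
      show "emeasure (interval_measure H) (?A n) \<noteq> \<infinity>" for n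
        by (subst emeasure_interval_measure_Ioc) (use H neg in \<open>auto dest: monoD\<close>)
    qed
    moreover have "(\<Inter>n. ?A n) = {0..u}"
    proof (intro subset_antisym subsetI)
      fix x assume x: "x \<in> (\<Inter>n. ?A n)"
      have "x \<ge> 0"
      proof (rule ccontr)
        assume "\<not> x \<ge> 0"
        then obtain n where "inverse (real (Suc n)) < - x"
          using reals_Archimedean[of "- x"] by auto
        with x have "- 1 / real (Suc n) < x" "x < - inverse (real (Suc n))" by auto
        then show False by (simp add: inverse_eq_divide)
      qed
      with x show "x \<in> {0..u}" by auto
    next
      fix x assume "x \<in> {0..u}"
      then have "- 1 / real (Suc n) < x" for n
        using less_le_trans[of "- 1 / real (Suc n)" 0 x] by (simp add: divide_less_0_iff)
      then show "x \<in> (\<Inter>n. ?A n)" using \<open>x \<in> {0..u}\<close> by auto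
    qed
    moreover have "measure (interval_measure H) (?A n) = H u - H (- 1 / real (Suc n))" for n
      by (subst measure_interval_measure_Ioc) (use H neg in \<open>auto dest: monoD\<close>)
    ultimately show ?thesis by simp
  qed
  have "(\<lambda>n. (F u - F (- 1 / real (Suc n))) - (G u - G (- 1 / real (Suc n)))) = (\<lambda>n. S u)"
  proof
    fix n
    have "F (- 1 / real (Suc n)) = G (- 1 / real (Suc n))"
      using eq[of "- 1 / real (Suc n)"] by (simp add: ext0_def divide_less_0_iff)
    then show "(F u - F (- 1 / real (Suc n))) - (G u - G (- 1 / real (Suc n))) = S u"
      using eq[of u] u by (simp add: ext0_def)
  qed
  with tendsto_diff[OF lim[OF F] lim[OF G]]
  have "(\<lambda>n. S u) \<longlonglongrightarrow> measure (interval_measure F) {0..u} - measure (interval_measure G) {0..u}"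
    by metis
  then show ?thesis by (simp add: LIMSEQ_const_iff)
qed

text \<open>The definition selects a Jordan decomposition by choice. Partial integration expresses
  each part through the measures of [0, u], whose difference is \<open>S u\<close> for every
  admissible decomposition, so the choice disappears.\<close>

lemma LS_integral_exp:
  fixes s :: complex
  assumes bv: "local_bv_nonneg S" and rc: "\<forall>x\<ge>0. continuous (at_right x) S" and T: "0 \<le> T"
  shows "LS_integral S (\<lambda>x. exp (- s * complex_of_real x)) T =
     exp (- s * of_real T) * of_real (S T) +
     s * (LBINT u. indicator {0..T} u *\<^sub>R (exp (- s * of_real u) * of_real (S u)))"
proof -
  let ?P = "\<lambda>(F, G). mono F \<and> mono G \<and> (\<forall>x. continuous (at_right x) F) \<and>
     (\<forall>x. continuous (at_right x) G) \<and> (\<forall>x. ext0 S x = F x - G x)"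
  obtain F G where FG: "(SOME p. ?P p) = (F, G)" by (cases "SOME p. ?P p")
  have "\<exists>p. ?P p" using jordan_decomposition[OF bv rc] by auto
  from someI_ex[OF this] have F: "mono F" "\<And>x. continuous (at_right x) F"
    and G: "mono G" "\<And>x. continuous (at_right x) G" and eq: "\<And>x. ext0 S x = F x - G x"
    unfolding FG by auto
  let ?mF = "\<lambda>u. measure (interval_measure F) {0..u}" and ?mG = "\<lambda>u. measure (interval_measure G) {0..u}"
  have diff: "?mF u - ?mG u = S u" if "u \<ge> 0" for u
    by (rule measure_interval_measure_Icc_diff[OF F G eq that])
  have int: "integrable lborel (\<lambda>u. indicator {0..T} u *\<^sub>R
       (exp (- s * of_real u) * complex_of_real (measure (interval_measure H) {0..u})))"
    if H: "mono H" "\<And>x. continuous (at_right x) H" for H :: "real \<Rightarrow> real"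
  proof -
    let ?M = "interval_measure H"
    have fin: "emeasure ?M {0..T} < \<infinity>" by (rule stieltjes_exp_by_parts(2)[OF H T])
    have mono: "measure ?M {0..u} \<le> measure ?M {0..v}" if "u \<le> v" "v \<le> T" for u v
    proof (rule measure_mono_fmeasurable)
      have "emeasure ?M {0..v} \<le> emeasure ?M {0..T}" using that by (intro emeasure_mono) auto
      also note fin
      finally show "{0..v} \<in> fmeasurable ?M" by (intro fmeasurableI) auto
    qed (use that in auto)
    \<comment> \<open>Truncation at T makes the function monotone on the whole line from finiteness
      on [0, T] alone; monotonicity is what gives measurability.\<close>
    have "mono (\<lambda>u. measure ?M {0..min u T})"
      by (intro monoI mono) auto
    from borel_measurable_mono[OF this]
    have [measurable]: "(\<lambda>u. measure ?M {0..min u T}) \<in> borel_measurable borel" .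
    have bnd: "norm (exp (- s * of_real u)) \<le> exp (\<bar>Re s\<bar> * T)" if "0 \<le> u" "u \<le> T" for u
      using that abs_ge_minus_self[of "Re s * u"] mult_left_mono[of u T "\<bar>Re s\<bar>"] by (auto simp: abs_mult)
    have "integrable lborel (\<lambda>u. indicator {0..T} u *\<^sub>R
       (exp (- s * of_real u) * complex_of_real (measure ?M {0..min u T})))"
    proof (rule integrableI_bounded_set_indicator[where B="exp (\<bar>Re s\<bar> * T) * measure ?M {0..T}"])
      show "AE u in lborel. u \<in> {0..T} \<longrightarrow> norm (exp (- s * of_real u) * complex_of_real (measure ?M {0..min u T}))
          \<le> exp (\<bar>Re s\<bar> * T) * measure ?M {0..T}"
        unfolding norm_mult using bnd mono by (intro AE_I2 impI mult_mono) auto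
    qed (use T in auto)
    then show ?thesis
      by (rule Bochner_Integration.integrable_cong[THEN iffD1, rotated -1])
        (auto simp: indicator_def min_def)
  qed
  let ?I = "\<lambda>m::real \<Rightarrow> real. LBINT u. indicator {0..T} u *\<^sub>R (exp (- s * of_real u) * complex_of_real (m u))"
  have "?I ?mF - ?I ?mG = ?I S"
    unfolding Bochner_Integration.integral_diff[OF int[OF F] int[OF G], symmetric]
    by (intro Bochner_Integration.integral_cong refl)
      (simp add: diff[symmetric] algebra_simps split: split_indicator)
  moreover have "LS_integral S (\<lambda>x. exp (- s * complex_of_real x)) T =
     (exp (- s * of_real T) * of_real (?mF T) + s * ?I ?mF) - (exp (- s * of_real T) * of_real (?mG T) + s * ?I ?mG)"
    unfolding LS_integral_def FG Let_def prod.case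
    using stieltjes_exp_by_parts(1)[OF F T, of s] stieltjes_exp_by_parts(1)[OF G T, of s] by simp
  ultimately show ?thesis
    using T by (simp add: diff[symmetric] algebra_simps)
qed

lemma ext0_measurable_bounded:
  assumes bv: "local_bv_nonneg S" and rc: "\<forall>x\<ge>0. continuous (at_right x) S"
  shows "ext0 S \<in> borel_measurable borel" "\<exists>B. \<forall>x\<le>b. \<bar>ext0 S x\<bar> \<le> B"
proof -
  from jordan_decomposition[OF bv rc] obtain F G where F: "mono F" and G: "mono G"
    and eq: "\<And>x. ext0 S x = F x - G x" by blast
  have "ext0 S = (\<lambda>x. F x - G x)" using eq by auto
  then show "ext0 S \<in> borel_measurable borel"
    using borel_measurable_mono[OF F] borel_measurable_mono[OF G] by simp
  have "\<bar>ext0 S x\<bar> \<le> \<bar>F 0\<bar> + \<bar>F b\<bar> + \<bar>G 0\<bar> + \<bar>G b\<bar>" if "x \<le> b" for x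
  proof (cases "x < 0")
    case False
    then show ?thesis
      using eq[of x] monoD[OF F, of 0 x] monoD[OF F, of x b] monoD[OF G, of 0 x] monoD[OF G, of x b] that
      by auto
  qed (auto simp: ext0_def)
  then show "\<exists>B. \<forall>x\<le>b. \<bar>ext0 S x\<bar> \<le> B" by blast
qed

section \<open>Fubini for bounded kernels\<close>

lemma exp_decay_integral:
  fixes a :: real assumes a: "a > 0"
  shows "integrable lborel (\<lambda>u. indicator {0..} u * exp (- a * u))"
    and "(LBINT u. indicator {0..} u * exp (- a * u)) = 1 / a"
proof -
  have "((\<lambda>u. - exp (- a * u) / a) \<longlongrightarrow> 0) at_top"
    using a by real_asymp
  then have "(\<integral>\<^sup>+u. ennreal (exp (- a * u)) * indicator {0..} u \<partial>lborel) = 0 - (- exp (- a * 0) / a)"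
    using a by (intro nn_integral_FTC_atLeast) (auto intro!: derivative_eq_intros)
  also have "(\<integral>\<^sup>+u. ennreal (exp (- a * u)) * indicator {0..} u \<partial>lborel) =
    (\<integral>\<^sup>+u. ennreal (indicator {0..} u * exp (- a * u)) \<partial>lborel)"
    by (intro nn_integral_cong) (auto split: split_indicator)
  finally have "has_bochner_integral lborel (\<lambda>u. indicator {0..} u * exp (- a * u)) (1 / a)"
    using a by (intro has_bochner_integral_nn_integral) auto
  then show "integrable lborel (\<lambda>u. indicator {0..} u * exp (- a * u))"
    and "(LBINT u. indicator {0..} u * exp (- a * u)) = 1 / a"
    by (auto simp: has_bochner_integral_iff)
qed

lemma integrable_pair_kernel:
  fixes f g :: "real \<Rightarrow> real" and K :: "real \<times> real \<Rightarrow> real"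
  assumes f: "integrable lborel f" and g: "integrable lborel g"
    and K[measurable]: "K \<in> borel_measurable (borel \<Otimes>\<^sub>M borel)" and B: "\<And>z. \<bar>K z\<bar> \<le> B"
  shows "integrable (lborel \<Otimes>\<^sub>M lborel) (\<lambda>(x, y). f x * g y * K (x, y))"
proof -
  note [measurable] = borel_measurable_integrable[OF f, simplified] borel_measurable_integrable[OF g, simplified]
  have "integrable (lborel \<Otimes>\<^sub>M lborel) (\<lambda>(x, y). f x * g y * B)"
  proof (rule lborel_pair.Fubini_integrable)
    show "integrable lborel (\<lambda>x. LBINT y. norm (case (x, y) of (x, y) \<Rightarrow> f x * g y * B))"
      using f by (simp add: abs_mult mult.assoc)
    show "AE x in lborel. integrable lborel (\<lambda>y. case (x, y) of (x, y) \<Rightarrow> f x * g y * B)"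
      using g by simp
  qed simp
  then show ?thesis
  proof (rule Bochner_Integration.integrable_bound)
    have "norm (f x * g y * K (x, y)) \<le> norm (f x * g y * B)" for x y
      using B[of "(x, y)"] by (auto simp: abs_mult intro!: mult_left_mono)
    then show "AE z in lborel \<Otimes>\<^sub>M lborel. norm (case z of (x, y) \<Rightarrow> f x * g y * K (x, y))
        \<le> norm (case z of (x, y) \<Rightarrow> f x * g y * B)"
      by (intro AE_I2) auto
  qed simp
qed

lemma fubini_kernel:
  fixes f g :: "real \<Rightarrow> real" and K :: "real \<times> real \<Rightarrow> real"
  assumes f: "integrable lborel f" and g: "integrable lborel g"
    and K: "K \<in> borel_measurable (borel \<Otimes>\<^sub>M borel)" and B: "\<And>z. \<bar>K z\<bar> \<le> B"
  shows "(LBINT x. f x * (LBINT y. g y * K (x, y))) = (LBINT y. g y * (LBINT x. f x * K (x, y)))"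
    and "integrable lborel (\<lambda>x. f x * (LBINT y. g y * K (x, y)))"
proof -
  note int = integrable_pair_kernel[OF assms]
  show "(LBINT x. f x * (LBINT y. g y * K (x, y))) = (LBINT y. g y * (LBINT x. f x * K (x, y)))"
    using lborel_pair.Fubini_integral[OF int]
    unfolding integral_mult_right_zero[symmetric] by (simp only: mult_ac)
  show "integrable lborel (\<lambda>x. f x * (LBINT y. g y * K (x, y)))"
    using lborel_pair.integrable_fst[OF int] by (simp add: mult.assoc)
qed

text \<open>Here one factor depends on y - x, so joint integrability rests on translation invariance
  of the L^1 norm of \<open>h\<close>.\<close>

lemma fubini_conv:
  fixes f h :: "real \<Rightarrow> real" and K :: "real \<times> real \<Rightarrow> real"
  assumes f: "integrable lborel f" and h: "integrable lborel h"
    and K[measurable]: "K \<in> borel_measurable (borel \<Otimes>\<^sub>M borel)" and B: "\<And>z. \<bar>K z\<bar> \<le> B"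
  shows "(LBINT x. f x * (LBINT y. h (y - x) * K (x, y))) = (LBINT y. (LBINT x. f x * h (y - x) * K (x, y)))"
    and "integrable lborel (\<lambda>y. LBINT x. f x * h (y - x) * K (x, y))"
proof -
  note [measurable] = borel_measurable_integrable[OF f, simplified] borel_measurable_integrable[OF h, simplified]
  have h': "integrable lborel (\<lambda>y. h (y - x))" for x
    using lborel_integrable_real_affine[OF h, of 1 "-x"] by simp
  have hn: "(LBINT y. \<bar>h (y - x)\<bar>) = (LBINT y. \<bar>h y\<bar>)" for x
    using lborel_integral_real_affine[of 1 "\<lambda>y. \<bar>h y\<bar>" "-x"] by simp
  have "integrable (lborel \<Otimes>\<^sub>M lborel) (\<lambda>(x, y). f x * h (y - x) * B)"
  proof (rule lborel_pair.Fubini_integrable)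
    show "integrable lborel (\<lambda>x. LBINT y. norm (case (x, y) of (x, y) \<Rightarrow> f x * h (y - x) * B))"
      using f by (simp add: abs_mult mult.assoc hn)
    show "AE x in lborel. integrable lborel (\<lambda>y. case (x, y) of (x, y) \<Rightarrow> f x * h (y - x) * B)"
      using h' by simp
  qed simp
  then have int: "integrable (lborel \<Otimes>\<^sub>M lborel) (\<lambda>(x, y). f x * h (y - x) * K (x, y))"
  proof (rule Bochner_Integration.integrable_bound)
    have "norm (f x * h (y - x) * K (x, y)) \<le> norm (f x * h (y - x) * B)" for x y
      using B[of "(x, y)"] by (auto simp: abs_mult intro!: mult_left_mono)
    then show "AE z in lborel \<Otimes>\<^sub>M lborel. norm (case z of (x, y) \<Rightarrow> f x * h (y - x) * K (x, y))
        \<le> norm (case z of (x, y) \<Rightarrow> f x * h (y - x) * B)"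
      by (intro AE_I2) auto
  qed simp
  show "(LBINT x. f x * (LBINT y. h (y - x) * K (x, y))) = (LBINT y. (LBINT x. f x * h (y - x) * K (x, y)))"
    using lborel_pair.Fubini_integral[OF int] by (simp add: mult.assoc)
  show "integrable lborel (\<lambda>y. LBINT x. f x * h (y - x) * K (x, y))"
    using lborel_pair.integrable_snd[OF int] by simp
qed

lemma integrable_continuous_Icc:
  fixes f :: "real \<Rightarrow> real"
  assumes "continuous_on {a..b} f"
  shows "integrable lborel (\<lambda>u. indicator {a..b} u * f u)"
  using borel_integrable_compact[OF compact_Icc assms] by simp

lemma measurable_moving_integral:
  fixes T u v :: "real \<Rightarrow> real"
  assumes [measurable]: "T \<in> borel_measurable borel" "u \<in> borel_measurable borel" "v \<in> borel_measurable borel"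
  shows "(\<lambda>x. LBINT w. indicator {u x..v x} w * T w) \<in> borel_measurable borel"
proof -
  have "(\<lambda>x. LBINT w. of_bool (u x \<le> w \<and> w \<le> v x) * T w) \<in> borel_measurable borel"
    by measurable
  moreover have "indicator {u x..v x} w = (of_bool (u x \<le> w \<and> w \<le> v x) :: real)" for x w
    by (simp add: indicator_def)
  ultimately show ?thesis by simp
qed

text \<open>With J the primitive of T, this is the integrated form of (e^(kx) J)' = e^(kx) (T + k
  J). As T is merely measurable, J need not be differentiable everywhere, so Fubini replaces the
  fundamental theorem.\<close>

lemma exp_primitive:
  fixes T :: "real \<Rightarrow> real"
  assumes T: "integrable lborel (\<lambda>w. indicator {0..x} w * T w)"
  shows "exp (k * x) * (LBINT w. indicator {0..x} w * T w) =
    (LBINT u. indicator {0..x} u * (exp (k * u) * (T u + k * (LBINT w. indicator {0..u} w * T w))))"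
    (is "_ = ?R")
proof -
  let ?f = "\<lambda>w. indicator {0..x} w * T w" and ?g = "\<lambda>u. indicator {0..x} u * (k * exp (k * u))"
  let ?K = "\<lambda>(u::real, w). of_bool (w \<le> u) :: real"
  have g: "integrable lborel ?g"
    by (intro integrable_continuous_Icc continuous_intros)
  have K[measurable]: "?K \<in> borel_measurable (borel \<Otimes>\<^sub>M borel)" by measurable
  have K1: "\<bar>?K z\<bar> \<le> 1" for z by (auto split: prod.splits)
  have ge: "integrable lborel (\<lambda>u. ?f u * exp (k * u))"
  proof (rule Bochner_Integration.integrable_bound[OF integrable_mult_left[OF T, of "exp (\<bar>k\<bar> * x)"]])
    show "(\<lambda>u. ?f u * exp (k * u)) \<in> borel_measurable lborel"
      using borel_measurable_integrable[OF T] by simp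
    have "k * u \<le> \<bar>k\<bar> * x" if "0 \<le> u" "u \<le> x" for u
      using that abs_ge_self[of "k * u"] mult_left_mono[of u x "\<bar>k\<bar>"] by (auto simp: abs_mult)
    then have "norm (?f u * exp (k * u)) \<le> norm (?f u * exp (\<bar>k\<bar> * x))" for u
      by (auto simp: abs_mult indicator_def intro!: mult_left_mono)
    then show "AE u in lborel. norm (?f u * exp (k * u)) \<le> norm (?f u * exp (\<bar>k\<bar> * x))"
      by (intro AE_I2)
  qed
  have inner: "(LBINT u. ?g u * ?K (u, w)) = exp (k * x) - exp (k * w)" if w: "0 \<le> w" "w \<le> x" for w
  proof -
    have "(LBINT u. ?g u * ?K (u, w)) = (LBINT u. indicator {w..x} u *\<^sub>R (k * exp (k * u)))"
      using w by (intro Bochner_Integration.integral_cong) (auto simp: indicator_def)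
    also have "\<dots> = exp (k * x) - exp (k * w)"
      using w by (intro integral_FTC_Icc)
        (auto intro!: derivative_eq_intros continuous_intros simp flip: has_real_derivative_iff_has_vector_derivative)
    finally show ?thesis .
  qed
  have "?R = (LBINT u. ?f u * exp (k * u) + ?g u * (LBINT w. ?f w * ?K (u, w)))"
  proof (intro Bochner_Integration.integral_cong refl)
    fix u
    have "(LBINT w. indicator {0..u} w * T w) = (LBINT w. ?f w * ?K (u, w))" if "u \<le> x"
      using that by (intro Bochner_Integration.integral_cong) (auto simp: indicator_def)
    then show "indicator {0..x} u * (exp (k * u) * (T u + k * (LBINT w. indicator {0..u} w * T w)))
      = ?f u * exp (k * u) + ?g u * (LBINT w. ?f w * ?K (u, w))"
      by (auto simp: indicator_def algebra_simps)
  qed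
  also have "\<dots> = (LBINT u. ?f u * exp (k * u)) + (LBINT u. ?g u * (LBINT w. ?f w * ?K (u, w)))"
    using fubini_kernel(2)[OF g T K K1] ge by (intro Bochner_Integration.integral_add) auto
  also have "(LBINT u. ?g u * (LBINT w. ?f w * ?K (u, w))) =
      (LBINT w. ?f w * (LBINT u. ?g u * ?K (u, w)))"
    by (rule fubini_kernel(1)[OF g T K K1])
  also have "\<dots> = (LBINT w. ?f w * exp (k * x) - ?f w * exp (k * w))"
  proof (intro Bochner_Integration.integral_cong refl)
    fix w
    show "?f w * (LBINT u. ?g u * ?K (u, w)) = ?f w * exp (k * x) - ?f w * exp (k * w)"
    proof (cases "w \<in> {0..x}")
      case True
      then have "(LBINT u. ?g u * ?K (u, w)) = exp (k * x) - exp (k * w)"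
        by (intro inner) auto
      then show ?thesis by (simp only: right_diff_distrib)
    qed auto
  qed
  also have "\<dots> = (LBINT w. ?f w * exp (k * x)) - (LBINT w. ?f w * exp (k * w))"
    using T ge by (intro Bochner_Integration.integral_diff) auto
  finally show ?thesis by simp
qed

section \<open>Transforms of functions of exponential order one\<close>

lemma power_div_fact_le_exp:
  fixes y :: real assumes "y \<ge> 0"
  shows "y ^ k / fact k \<le> exp y"
proof -
  have "(\<Sum>n\<in>{k}. y ^ n /\<^sub>R fact n) \<le> (\<Sum>n. y ^ n /\<^sub>R fact n)"
    using assms by (intro sum_le_suminf summable_exp_generic) auto
  then show ?thesis by (simp add: exp_def divide_inverse mult.commute)
qed

text \<open>The constant in the growth bound may depend on \<sigma> and blow up as \<sigma> tends to
  1: convergence of the transform for Re s > 1 gives no bound of order e^x.\<close>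

locale exp_order_one =
  fixes E :: "real \<Rightarrow> real"
  assumes meas[measurable]: "E \<in> borel_measurable borel"
    and neg: "x < 0 \<Longrightarrow> E x = 0"
    and growth: "\<sigma> > 1 \<Longrightarrow> \<exists>C. \<forall>x. \<bar>E x\<bar> \<le> C * exp (\<sigma> * x)"
begin

lemma integrable_moment:
  assumes "\<sigma> > 1"
  shows "integrable lborel (\<lambda>x. x ^ k * exp (- \<sigma> * x) * E x)"
proof -
  \<comment> \<open>The gap \<sigma> - 1 is split in three: growth is taken at rate 1 + \<delta> =
    \<sigma> - 2\<delta>, the power of x costs another \<delta>, and a decay of rate \<delta> is
    left.\<close>
  define \<delta> where "\<delta> = (\<sigma> - 1) / 3"
  have \<delta>: "\<delta> > 0" "\<sigma> - 2 * \<delta> > 1" using assms by (auto simp: \<delta>_def field_simps)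
  from growth[OF \<delta>(2)] obtain C where C: "\<And>x. \<bar>E x\<bar> \<le> C * exp ((\<sigma> - 2 * \<delta>) * x)" by blast
  show ?thesis
  proof (rule Bochner_Integration.integrable_bound)
    show "integrable lborel (\<lambda>x. fact k / \<delta> ^ k * C * (indicator {0..} x * exp (- \<delta> * x)))"
      by (intro integrable_mult_right exp_decay_integral \<delta>)
    show "AE x in lborel. norm (x ^ k * exp (- \<sigma> * x) * E x) \<le>
       norm (fact k / \<delta> ^ k * C * (indicator {0..} x * exp (- \<delta> * x)))"
    proof (intro AE_I2)
      fix x
      show "norm (x ^ k * exp (- \<sigma> * x) * E x) \<le>
       norm (fact k / \<delta> ^ k * C * (indicator {0..} x * exp (- \<delta> * x)))"
      proof (cases "x < 0")
        case False
        have "(\<delta> * x) ^ k / fact k \<le> exp (\<delta> * x)"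
          using \<delta> False by (intro power_div_fact_le_exp) auto
        then have "x ^ k \<le> fact k / \<delta> ^ k * exp (\<delta> * x)"
          using \<delta> by (simp add: power_mult_distrib field_simps)
        then have "\<bar>x ^ k\<bar> * exp (- \<sigma> * x) * \<bar>E x\<bar> \<le>
            (fact k / \<delta> ^ k * exp (\<delta> * x)) * exp (- \<sigma> * x) * (C * exp ((\<sigma> - 2 * \<delta>) * x))"
          using C[of x] False \<delta> by (intro mult_mono) auto
        also have "\<dots> = fact k / \<delta> ^ k * C * (exp (\<delta> * x) * exp (- \<sigma> * x) * exp ((\<sigma> - 2 * \<delta>) * x))"
          by (simp only: mult_ac)
        also have "exp (\<delta> * x) * exp (- \<sigma> * x) * exp ((\<sigma> - 2 * \<delta>) * x) = exp (- \<delta> * x)"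
          unfolding exp_add[symmetric] by (simp add: algebra_simps)
        finally show ?thesis
          using False \<delta> abs_ge_zero[of "E 0"] C[of 0] by (simp add: abs_mult power_abs)
      qed (simp add: neg)
    qed
  qed simp
qed

lemma integrable_moment_complex:
  assumes "Re s > 1"
  shows "integrable lborel (\<lambda>x. of_real (x ^ k * E x) * exp (- s * complex_of_real x))"
proof (rule Bochner_Integration.integrable_bound[OF integrable_moment[OF assms, of k]])
  show "AE x in lborel. norm (of_real (x ^ k * E x) * exp (- s * complex_of_real x))
     \<le> norm (x ^ k * exp (- Re s * x) * E x)"
    by (intro AE_I2) (simp add: norm_mult norm_power abs_mult power_abs mult_ac)
qed simp

definition Lap :: "complex \<Rightarrow> complex" where
  "Lap s = (LBINT x. of_real (E x) * exp (- s * complex_of_real x))"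

text \<open>This is Re L{dS; \<sigma> + it} written as one real integral: the cosine transform of
  e^(-\<sigma>x) dS(x) after an integration by parts.\<close>

definition Uh :: "real \<Rightarrow> real \<Rightarrow> real" where
  "Uh \<sigma> t = (LBINT x. exp (- \<sigma> * x) * E x * (\<sigma> * cos (t * x) + t * sin (t * x)))"

lemma Re_Lap:
  assumes "\<sigma> > 1"
  shows "Re (Complex \<sigma> t * Lap (Complex \<sigma> t)) = Uh \<sigma> t"
proof -
  let ?s = "Complex \<sigma> t"
  have int: "integrable lborel (\<lambda>x. ?s * (of_real (E x) * exp (- ?s * complex_of_real x)))"
    using integrable_moment_complex[of ?s 0] assms by (intro integrable_mult_right) auto
  have "Re (?s * Lap ?s) = Re (LBINT x. ?s * (of_real (E x) * exp (- ?s * complex_of_real x)))"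
    by (simp add: Lap_def)
  also have "\<dots> = (LBINT x. Re (?s * (of_real (E x) * exp (- ?s * complex_of_real x))))"
    by (rule integral_Re[OF int, symmetric])
  also have "\<dots> = Uh \<sigma> t"
    unfolding Uh_def by (intro Bochner_Integration.integral_cong refl) (simp add: Re_exp Im_exp algebra_simps)
  finally show ?thesis .
qed

end

text \<open>Put T = e^(-\<sigma>x) E and let J be its primitive. By parts the truncated transform is
  R = T + \<sigma>J, and convergence makes R bounded. Since J' = T, this is the linear equation J' +
  \<sigma>J = R; solving it bounds J, and then T = R - \<sigma>J.\<close>

lemma laplace_growth:
  assumes bv: "local_bv_nonneg S" and rc: "\<forall>x\<ge>0. continuous (at_right x) S"
    and conv: "laplace_converges S (of_real \<sigma>)" and \<sigma>: "\<sigma> > 0"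
  shows "\<exists>C. \<forall>x. \<bar>ext0 S x\<bar> \<le> C * exp (\<sigma> * x)"
proof -
  define E where "E = ext0 S"
  have [measurable]: "E \<in> borel_measurable borel"
    unfolding E_def by (rule ext0_measurable_bounded[OF bv rc])
  have bdd: "\<exists>B\<ge>0. \<forall>x\<le>b. \<bar>E x\<bar> \<le> B" for b
    using ext0_measurable_bounded(2)[OF bv rc, of b] unfolding E_def
    by (meson abs_ge_zero order.trans order_refl)
  define T where "T x = exp (- \<sigma> * x) * E x" for x
  have [measurable]: "T \<in> borel_measurable borel" unfolding T_def by measurable
  have TE: "\<bar>T x\<bar> \<le> \<bar>E x\<bar>" for x
  proof (cases "x < 0")
    case False
    then show ?thesis using \<sigma> by (auto simp: T_def abs_mult intro: mult_left_le_one_le)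
  qed (auto simp: T_def E_def ext0_def)
  have intT: "integrable lborel (\<lambda>w. indicator {0..x} w * T w)" for x
  proof -
    obtain B where B: "\<And>y. y \<le> x \<Longrightarrow> \<bar>E y\<bar> \<le> B" using bdd[of x] by blast
    have "integrable lborel (\<lambda>w. indicator {0..x} w *\<^sub>R T w)"
    proof (rule integrableI_bounded_set_indicator[where B=B])
      show "AE w in lborel. w \<in> {0..x} \<longrightarrow> norm (T w) \<le> B"
        using order_trans[OF TE B] by (intro AE_I2) auto
    qed (auto simp: emeasure_lborel_Icc_eq)
    then show ?thesis by simp
  qed
  define J where "J x = (LBINT w. indicator {0..x} w * T w)" for x
  have [measurable]: "J \<in> borel_measurable borel"
    unfolding J_def by (intro measurable_moving_integral) auto
  define R where "R x = T x + \<sigma> * J x" for x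
  have [measurable]: "R \<in> borel_measurable borel" unfolding R_def by measurable
  have LS: "LS_integral S (\<lambda>x. exp (- of_real \<sigma> * complex_of_real x)) x = of_real (R x)" if "x \<ge> 0" for x
  proof -
    have "(LBINT u. indicator {0..x} u *\<^sub>R (exp (- of_real \<sigma> * of_real u) * complex_of_real (S u))) =
      (LBINT u. complex_of_real (indicator {0..x} u * T u))"
      by (intro Bochner_Integration.integral_cong refl)
        (auto simp: indicator_def T_def E_def ext0_def exp_of_real simp flip: of_real_mult of_real_minus)
    also have "\<dots> = of_real (J x)" unfolding J_def by (rule integral_complex_of_real)
    finally have *: "(LBINT u. indicator {0..x} u *\<^sub>R (exp (- of_real \<sigma> * of_real u) * complex_of_real (S u))) = of_real (J x)" .
    have "exp (- of_real \<sigma> * of_real x) * complex_of_real (S x) = of_real (T x)"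
      using that by (auto simp: T_def E_def ext0_def exp_of_real simp flip: of_real_mult of_real_minus)
    with * show ?thesis unfolding LS_integral_exp[OF bv rc that] R_def by simp
  qed
  obtain L where L: "((\<lambda>T. LS_integral S (\<lambda>x. exp (- of_real \<sigma> * complex_of_real x)) T) \<longlongrightarrow> L) at_top"
    using conv unfolding laplace_converges_def by blast
  have "\<forall>\<^sub>F x in at_top. norm (LS_integral S (\<lambda>x. exp (- of_real \<sigma> * complex_of_real x)) x) < norm L + 1"
    using tendsto_norm[OF L] by (rule order_tendstoD) simp
  then obtain x0 where x0: "x0 \<ge> 0" "\<And>x. x \<ge> x0 \<Longrightarrow> \<bar>R x\<bar> \<le> norm L + 1"
  proof -
    assume *: "\<And>x0. 0 \<le> x0 \<Longrightarrow> (\<And>x. x0 \<le> x \<Longrightarrow> \<bar>R x\<bar> \<le> cmod L + 1) \<Longrightarrow> thesis"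
      and ev: "\<forall>\<^sub>F x in at_top. norm (LS_integral S (\<lambda>x. exp (- of_real \<sigma> * complex_of_real x)) x) < norm L + 1"
    from ev obtain N where N: "\<And>x. x \<ge> N \<Longrightarrow> norm (LS_integral S (\<lambda>x. exp (- of_real \<sigma> * complex_of_real x)) x) < norm L + 1"
      unfolding eventually_at_top_linorder by blast
    have "\<bar>R x\<bar> \<le> norm L + 1" if "x \<ge> max N 0" for x
      using N[of x] that LS[of x] by simp
    then show thesis by (intro *[of "max N 0"]) auto
  qed
  obtain B where B: "B \<ge> 0" "\<And>y. y \<le> x0 \<Longrightarrow> \<bar>E y\<bar> \<le> B" using bdd[of x0] by blast
  define C where "C = norm L + 1 + B + \<sigma> * (x0 * B)"
  have C: "\<bar>R x\<bar> \<le> C" if "x \<ge> 0" for x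
  proof (cases "x \<ge> x0")
    case True
    moreover have "0 \<le> B + \<sigma> * (x0 * B)" using x0(1) \<sigma> B(1) by simp
    ultimately show ?thesis using x0(2)[of x] by (simp add: C_def)
  next
    case False
    have "\<bar>J x\<bar> \<le> (LBINT w. \<bar>indicator {0..x} w * T w\<bar>)"
      unfolding J_def by (rule integral_abs_bound)
    also have "\<dots> \<le> (LBINT w. indicator {0..x0} w * B)"
    proof (rule integral_mono)
      show "integrable lborel (\<lambda>w. \<bar>indicator {0..x} w * T w\<bar>)" using intT by simp
      show "integrable lborel (\<lambda>w. indicator {0..x0} w * B)"
        using x0 by (intro integrable_mult_left integrable_real_indicator) auto
      show "\<bar>indicator {0..x} w * T w\<bar> \<le> indicator {0..x0} w * B" for w
        using B(2)[of w] B(1) TE[of w] False by (auto simp: indicator_def)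
    qed
    also have "\<dots> = x0 * B" using x0 by simp
    finally have "\<sigma> * \<bar>J x\<bar> \<le> \<sigma> * (x0 * B)" using \<sigma> by (intro mult_left_mono) auto
    moreover have "\<bar>T x\<bar> \<le> B" using TE[of x] B(2)[of x] False by auto
    moreover have "\<bar>R x\<bar> \<le> \<bar>T x\<bar> + \<sigma> * \<bar>J x\<bar>"
      unfolding R_def using \<sigma> abs_triangle_ineq[of "T x" "\<sigma> * J x"] by (simp add: abs_mult)
    ultimately show ?thesis unfolding C_def by (smt (verit) norm_ge_zero)
  qed
  \<comment> \<open>Variation of constants: e^(\<sigma>x) J(x) is the integral of e^(\<sigma>u)
    R(u), at most C (e^(\<sigma>x) - 1) / \<sigma> in absolute value.\<close>
  have J: "\<sigma> * \<bar>J x\<bar> \<le> C" if x: "x \<ge> 0" for x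
  proof -
    have "exp (\<sigma> * x) * J x = (LBINT u. indicator {0..x} u * (exp (\<sigma> * u) * R u))"
      unfolding J_def R_def by (rule exp_primitive[OF intT])
    also have "\<bar>\<dots>\<bar> \<le> (LBINT u. indicator {0..x} u * (exp (\<sigma> * u) * C))"
    proof (rule integral_abs_bound_integral)
      have "integrable lborel (\<lambda>u. indicator {0..x} u *\<^sub>R (exp (\<sigma> * u) * R u))"
      proof (rule integrableI_bounded_set_indicator[where B="exp (\<sigma> * x) * C"])
        show "AE u in lborel. u \<in> {0..x} \<longrightarrow> norm (exp (\<sigma> * u) * R u) \<le> exp (\<sigma> * x) * C"
          using C \<sigma> by (intro AE_I2) (auto simp: abs_mult intro!: mult_mono)
      qed (auto simp: emeasure_lborel_Icc_eq)
      then show "integrable lborel (\<lambda>u. indicator {0..x} u * (exp (\<sigma> * u) * R u))" by simp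
      show "integrable lborel (\<lambda>u. indicator {0..x} u * (exp (\<sigma> * u) * C))"
        by (intro integrable_continuous_Icc continuous_intros)
    qed (use C in \<open>auto simp: indicator_def abs_mult\<close>)
    also have "\<dots> = C / \<sigma> * (exp (\<sigma> * x) - 1)"
    proof -
      have "(LBINT u. indicator {0..x} u *\<^sub>R (exp (\<sigma> * u) * C)) = exp (\<sigma> * x) * C / \<sigma> - exp (\<sigma> * 0) * C / \<sigma>"
        using x \<sigma> by (intro integral_FTC_Icc)
          (auto intro!: derivative_eq_intros continuous_intros simp flip: has_real_derivative_iff_has_vector_derivative)
      then show ?thesis by (simp add: diff_divide_distrib right_diff_distrib)
    qed
    also have "\<dots> \<le> C / \<sigma> * exp (\<sigma> * x)"
      using \<sigma> C[of 0] by (intro mult_left_mono) auto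
    finally show ?thesis using \<sigma> by (simp add: abs_mult field_simps)
  qed
  have "\<bar>E x\<bar> \<le> 2 * C * exp (\<sigma> * x)" for x
  proof (cases "x < 0")
    case True
    then show ?thesis using C[of 0] by (auto simp: E_def ext0_def)
  next
    case False
    have "\<bar>T x\<bar> \<le> \<bar>R x\<bar> + \<sigma> * \<bar>J x\<bar>"
      unfolding R_def using \<sigma> abs_triangle_ineq4[of "T x + \<sigma> * J x" "\<sigma> * J x"] by (simp add: abs_mult)
    then have "\<bar>T x\<bar> \<le> 2 * C" using C[of x] J[of x] False by auto
    then have "exp (\<sigma> * x) * \<bar>T x\<bar> \<le> exp (\<sigma> * x) * (2 * C)" by (intro mult_left_mono) auto
    then show ?thesis by (simp add: T_def abs_mult exp_minus field_simps)
  qed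
  then show ?thesis unfolding E_def by blast
qed

lemma exp_order_one_ext0:
  assumes bv: "local_bv_nonneg S" and rc: "\<forall>x\<ge>0. continuous (at_right x) S"
    and conv: "\<forall>s. Re s > 1 \<longrightarrow> laplace_converges S s"
  shows "exp_order_one (ext0 S)"
proof
  show "ext0 S \<in> borel_measurable borel" by (rule ext0_measurable_bounded[OF bv rc])
  show "\<exists>C. \<forall>x. \<bar>ext0 S x\<bar> \<le> C * exp (\<sigma> * x)" if "\<sigma> > 1" for \<sigma>
    using laplace_growth[OF bv rc, of \<sigma>] conv that by auto
qed (auto simp: ext0_def)

lemma laplace_dS_eq:
  assumes bv: "local_bv_nonneg S" and rc: "\<forall>x\<ge>0. continuous (at_right x) S"
    and conv: "\<forall>s. Re s > 1 \<longrightarrow> laplace_converges S s" and s: "Re s > 1"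
  shows "laplace_dS S s = s * exp_order_one.Lap (ext0 S) s"
proof -
  interpret exp_order_one "ext0 S" by (rule exp_order_one_ext0[OF bv rc conv])
  let ?f = "\<lambda>u. of_real (ext0 S u) * exp (- s * complex_of_real u)"
  have int: "integrable lborel ?f"
    using integrable_moment_complex[OF s, of 0] by simp
  \<comment> \<open>A growth rate strictly below Re s makes the boundary term of the partial
    integration decay.\<close>
  obtain \<sigma> where \<sigma>: "1 < \<sigma>" "\<sigma> < Re s" using s dense by blast
  then obtain C where C: "\<And>x. \<bar>ext0 S x\<bar> \<le> C * exp (\<sigma> * x)" using growth by blast
  have "((\<lambda>T. exp (- s * of_real T) * of_real (ext0 S T)) \<longlongrightarrow> 0) at_top"
  proof (rule Lim_null_comparison)
    have "norm (exp (- s * of_real T) * of_real (ext0 S T)) \<le> C * exp (- (Re s - \<sigma>) * T)" for T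
    proof -
      have "norm (exp (- s * of_real T) * of_real (ext0 S T)) \<le> exp (- Re s * T) * (C * exp (\<sigma> * T))"
        unfolding norm_mult using C[of T] by (intro mult_mono) auto
      also have "\<dots> = C * exp (- (Re s - \<sigma>) * T)" by (simp add: algebra_simps flip: exp_add)
      finally show ?thesis .
    qed
    then show "\<forall>\<^sub>F T in at_top. norm (exp (- s * of_real T) * of_real (ext0 S T)) \<le> C * exp (- (Re s - \<sigma>) * T)"
      by (intro always_eventually allI)
    show "((\<lambda>T. C * exp (- (Re s - \<sigma>) * T)) \<longlongrightarrow> 0) at_top"
      using \<sigma> by real_asymp
  qed
  moreover have "((\<lambda>T. LBINT u. indicator {..T} u *\<^sub>R ?f u) \<longlongrightarrow> Lap s) at_top"
    unfolding Lap_def by (rule tendsto_integral_at_top[OF _ int]) simp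
  ultimately have "((\<lambda>T. exp (- s * of_real T) * of_real (ext0 S T) + s * (LBINT u. indicator {..T} u *\<^sub>R ?f u))
      \<longlongrightarrow> 0 + s * Lap s) at_top"
    by (intro tendsto_intros)
  moreover have "\<forall>\<^sub>F T in at_top. exp (- s * of_real T) * of_real (ext0 S T) + s * (LBINT u. indicator {..T} u *\<^sub>R ?f u)
      = LS_integral S (\<lambda>x. exp (- s * complex_of_real x)) T"
    using eventually_ge_at_top[of 0]
  proof eventually_elim
    case (elim T)
    have "(LBINT u. indicator {..T} u *\<^sub>R ?f u) =
       (LBINT u. indicator {0..T} u *\<^sub>R (exp (- s * of_real u) * complex_of_real (S u)))"
      by (intro Bochner_Integration.integral_cong refl) (auto simp: indicator_def ext0_def)
    then show ?case
      using elim unfolding LS_integral_exp[OF bv rc elim] by (simp add: ext0_def)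
  qed
  ultimately have "((\<lambda>T. LS_integral S (\<lambda>x. exp (- s * complex_of_real x)) T) \<longlongrightarrow> s * Lap s) at_top"
    using Lim_transform_eventually by fastforce
  then show ?thesis unfolding laplace_dS_def by (intro tendsto_Lim) auto
qed

section \<open>Derivatives of vertical averages\<close>

lemma LBINT_eq_integral_Icc:
  fixes h :: "real \<Rightarrow> real"
  assumes "continuous_on {a..b} h"
  shows "(LBINT u. indicator {a..b} u * h u) = integral {a..b} h"
proof -
  have "set_integrable lborel {a..b} h"
    using integrable_continuous_Icc[OF assms] by (simp add: set_integrable_def)
  from set_borel_integral_eq_integral(2)[OF this] show ?thesis
    by (simp add: set_lebesgue_integral_def)
qed

text \<open>A one-sided bound suffices because the argument moves left from \<sigma>1: a'' \<le> C
  keeps a' above a constant -D, so a can rise by at most D (\<sigma>1 - 1) on the way to 1.\<close>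

lemma bounded_of_second_derivative_le:
  fixes a :: "real \<Rightarrow> real"
  assumes a: "\<And>\<sigma>. \<sigma> > 1 \<Longrightarrow> (a has_real_derivative a' \<sigma>) (at \<sigma>)"
    and a': "\<And>\<sigma>. \<sigma> > 1 \<Longrightarrow> (a' has_real_derivative a'' \<sigma>) (at \<sigma>)"
    and le: "\<And>\<sigma>. 1 < \<sigma> \<Longrightarrow> \<sigma> \<le> \<sigma>1 \<Longrightarrow> a'' \<sigma> \<le> C"
  shows "\<exists>K. \<forall>\<sigma>. 1 < \<sigma> \<and> \<sigma> \<le> \<sigma>1 \<longrightarrow> a \<sigma> \<le> K"
proof -
  define D where "D = \<bar>a' \<sigma>1\<bar> + \<bar>C\<bar> * (\<sigma>1 - 1)"
  have low: "a' \<sigma> \<ge> - D" if \<sigma>: "1 < \<sigma>" "\<sigma> \<le> \<sigma>1" for \<sigma>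
  proof (cases "\<sigma> = \<sigma>1")
    case True
    have "0 \<le> \<bar>C\<bar> * (\<sigma>1 - 1)" using \<sigma> by simp
    with True show ?thesis
      using abs_ge_minus_self[of "a' \<sigma>1"] by (simp add: D_def)
  next
    case False
    then obtain \<xi> where \<xi>: "\<sigma> < \<xi>" "\<xi> < \<sigma>1" "a' \<sigma>1 - a' \<sigma> = (\<sigma>1 - \<sigma>) * a'' \<xi>"
      using MVT2[of \<sigma> \<sigma>1 a' a''] a' \<sigma> by auto
    have "(\<sigma>1 - \<sigma>) * a'' \<xi> \<le> (\<sigma>1 - \<sigma>) * \<bar>C\<bar>"
      using le[of \<xi>] \<xi> \<sigma> by (intro mult_left_mono) auto
    also have "\<dots> \<le> (\<sigma>1 - 1) * \<bar>C\<bar>" using \<sigma> by (intro mult_right_mono) auto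
    finally show ?thesis using \<xi>(3) by (simp add: D_def mult.commute)
  qed
  have "a \<sigma> \<le> a \<sigma>1 + D * (\<sigma>1 - 1)" if \<sigma>: "1 < \<sigma>" "\<sigma> \<le> \<sigma>1" for \<sigma>
  proof (cases "\<sigma> = \<sigma>1")
    case True
    then show ?thesis using \<sigma> by (simp add: D_def)
  next
    case False
    then obtain \<xi> where \<xi>: "\<sigma> < \<xi>" "\<xi> < \<sigma>1" "a \<sigma>1 - a \<sigma> = (\<sigma>1 - \<sigma>) * a' \<xi>"
      using MVT2[of \<sigma> \<sigma>1 a a'] a \<sigma> by auto
    have "(\<sigma>1 - \<sigma>) * (- D) \<le> (\<sigma>1 - \<sigma>) * a' \<xi>"
      using low[of \<xi>] \<xi> \<sigma> by (intro mult_left_mono) auto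
    moreover have "(\<sigma>1 - \<sigma>) * D \<le> (\<sigma>1 - 1) * D"
      using \<sigma> by (intro mult_right_mono) (auto simp: D_def)
    ultimately show ?thesis using \<xi>(3) by (simp add: mult.commute)
  qed
  then show ?thesis by blast
qed

text \<open>Differentiation in the real direction is traded, through the Cauchy-Riemann equations and an
  integration by parts, for differentiation of the weight.\<close>

lemma vertical_integral_has_derivative:
  fixes f :: "complex \<Rightarrow> complex" and p p' :: "real \<Rightarrow> real"
  assumes f: "f holomorphic_on {s. Re s > 1}" and \<mu>: "\<mu> > 0" and \<sigma>: "\<sigma> > 1"
    and p: "\<And>t. (p has_real_derivative p' t) (at t)" and p': "continuous_on UNIV p'"
    and ends: "p \<mu> = 0" "p (-\<mu>) = 0"
  shows "((\<lambda>\<sigma>. integral {-\<mu>..\<mu>} (\<lambda>t. of_real (p t) * f (Complex \<sigma> t))) has_vector_derivative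
     \<i> * integral {-\<mu>..\<mu>} (\<lambda>t. of_real (p' t) * f (Complex \<sigma> t))) (at \<sigma>)"
proof -
  let ?H = "{s. Re s > 1}"
  have oH: "open ?H" by (rule open_halfspace_Re_gt)
  have df: "(f has_field_derivative deriv f (Complex \<sigma> t)) (at (Complex \<sigma> t))" if "\<sigma> > 1" for \<sigma> t
    using holomorphic_derivI[OF f oH, of "Complex \<sigma> t"] that by simp
  have cf: "continuous_on ?H f" by (rule holomorphic_on_imp_continuous_on[OF f])
  have cdf: "continuous_on ?H (deriv f)"
    by (rule holomorphic_on_imp_continuous_on[OF holomorphic_deriv[OF f oH]])
  have cp: "continuous_on A p" for A
    using p by (meson DERIV_isCont continuous_at_imp_continuous_on)
  have cp': "continuous_on A p'" for A using p' continuous_on_subset by blast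
  have cont: "continuous_on ({1<..} \<times> cbox (-\<mu>) \<mu>) (\<lambda>(\<sigma>, t). of_real (p t) * deriv f (Complex \<sigma> t))"
    unfolding split_beta' Complex_eq
    by (intro continuous_on_mult continuous_on_of_real continuous_on_compose2[OF cp]
       continuous_on_compose2[OF cdf] continuous_intros) auto
  have cv: "continuous_on {-\<mu>..\<mu>} (\<lambda>t. of_real (q t) * h (Complex \<sigma> t))"
    if "continuous_on {-\<mu>..\<mu>} q" "continuous_on ?H h" "\<sigma> > 1" for q :: "real \<Rightarrow> real" and h :: "complex \<Rightarrow> complex" and \<sigma>
    unfolding Complex_eq
    by (intro continuous_on_mult continuous_on_of_real that(1)
       continuous_on_compose2[OF that(2)] continuous_intros) (use that in auto)
  have int: "(\<lambda>t. of_real (q t) * h (Complex \<sigma> t)) integrable_on {-\<mu>..\<mu>}"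
    if "continuous_on {-\<mu>..\<mu>} q" "continuous_on ?H h" "\<sigma> > 1" for q :: "real \<Rightarrow> real" and h :: "complex \<Rightarrow> complex" and \<sigma>
    by (intro integrable_continuous_interval cv that)
  have "((\<lambda>\<sigma>. integral (cbox (-\<mu>) \<mu>) (\<lambda>t. of_real (p t) * f (Complex \<sigma> t))) has_vector_derivative
     integral (cbox (-\<mu>) \<mu>) (\<lambda>t. of_real (p t) * deriv f (Complex \<sigma> t))) (at \<sigma> within {1<..})"
  proof (rule leibniz_rule_vector_derivative[OF _ _ cont])
    fix \<sigma> t :: real assume \<sigma>: "\<sigma> \<in> {1<..}"
    have "((\<lambda>\<sigma>. of_real \<sigma> + \<i> * of_real t) has_vector_derivative 1) (at \<sigma> within {1<..})"
      by (auto intro!: derivative_eq_intros)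
    then have "((\<lambda>\<sigma>. Complex \<sigma> t) has_vector_derivative 1) (at \<sigma> within {1<..})"
      by (simp add: Complex_eq)
    from field_vector_diff_chain_within[OF this DERIV_subset[OF df subset_UNIV]] \<sigma>
    have "((\<lambda>\<sigma>. f (Complex \<sigma> t)) has_vector_derivative deriv f (Complex \<sigma> t)) (at \<sigma> within {1<..})"
      by (simp add: o_def)
    then show "((\<lambda>\<sigma>. of_real (p t) * f (Complex \<sigma> t)) has_vector_derivative
       of_real (p t) * deriv f (Complex \<sigma> t)) (at \<sigma> within {1<..})"
      by (rule has_vector_derivative_mult_right)
  next
    show "(\<lambda>t. of_real (p t) * f (Complex \<sigma> t)) integrable_on cbox (-\<mu>) \<mu>" if "\<sigma> \<in> {1<..}" for \<sigma>
      using int[OF cp cf] that by simp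
  qed (use \<sigma> in auto)
  moreover have "(at \<sigma> within {1<..}) = at \<sigma>"
    using \<sigma> by (intro at_within_open) auto
  moreover have "integral {-\<mu>..\<mu>} (\<lambda>t. of_real (p t) * deriv f (Complex \<sigma> t)) =
     \<i> * integral {-\<mu>..\<mu>} (\<lambda>t. of_real (p' t) * f (Complex \<sigma> t))"
  proof -
    have "((\<lambda>t. of_real (p' t) * f (Complex \<sigma> t) + \<i> * (of_real (p t) * deriv f (Complex \<sigma> t))) has_integral
       (of_real (p \<mu>) * f (Complex \<sigma> \<mu>) - of_real (p (-\<mu>)) * f (Complex \<sigma> (-\<mu>)))) {-\<mu>..\<mu>}"
    proof (rule fundamental_theorem_of_calculus)
      fix t
      have "((\<lambda>t. of_real \<sigma> + \<i> * of_real t) has_vector_derivative \<i>) (at t)"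
        by (auto intro!: derivative_eq_intros)
      then have "((\<lambda>t. Complex \<sigma> t) has_vector_derivative \<i>) (at t)"
        by (simp add: Complex_eq)
      from field_vector_diff_chain_at[OF this df[OF \<sigma>]]
      have 1: "((\<lambda>t. f (Complex \<sigma> t)) has_vector_derivative \<i> * deriv f (Complex \<sigma> t)) (at t)"
        by (simp add: o_def)
      have "((\<lambda>t. of_real (p t)) has_vector_derivative complex_of_real (p' t)) (at t)"
        using p[of t] by (intro has_vector_derivative_of_real) (simp flip: has_real_derivative_iff_has_vector_derivative)
      from has_vector_derivative_at_within[OF has_vector_derivative_mult[OF this 1]]
      show "((\<lambda>t. of_real (p t) * f (Complex \<sigma> t)) has_vector_derivative
        of_real (p' t) * f (Complex \<sigma> t) + \<i> * (of_real (p t) * deriv f (Complex \<sigma> t))) (at t within {-\<mu>..\<mu>})"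
        by (simp add: algebra_simps)
    qed (use \<mu> in auto)
    then have "0 = integral {-\<mu>..\<mu>} (\<lambda>t. of_real (p' t) * f (Complex \<sigma> t) + \<i> * (of_real (p t) * deriv f (Complex \<sigma> t)))"
      using ends by (simp add: integral_unique)
    also have "\<dots> = integral {-\<mu>..\<mu>} (\<lambda>t. of_real (p' t) * f (Complex \<sigma> t)) +
       \<i> * integral {-\<mu>..\<mu>} (\<lambda>t. of_real (p t) * deriv f (Complex \<sigma> t))"
      using int[OF cp' cf \<sigma>] int[OF cp cdf \<sigma>]
      by (subst Henstock_Kurzweil_Integration.integral_add) (auto intro: integrable_on_mult_right)
    \<comment> \<open>Since d/dt f(\<sigma> + it) = i f'(\<sigma> + it), the t-integration gives 0 =
      P + i Q with P the integral of p' f and Q that of p f'. Multiplication by i turns this into Q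
      = i P.\<close>
    finally have "\<i> * 0 = \<i> * (integral {-\<mu>..\<mu>} (\<lambda>t. of_real (p' t) * f (Complex \<sigma> t)) +
       \<i> * integral {-\<mu>..\<mu>} (\<lambda>t. of_real (p t) * deriv f (Complex \<sigma> t)))" by simp
    then show ?thesis by (simp add: algebra_simps flip: mult.assoc)
  qed
  ultimately show ?thesis by simp
qed

section \<open>Holomorphy of the transform and continuity of its real part on vertical lines\<close>

context exp_order_one
begin

text \<open>The first-order Taylor remainder of the exponential is bounded by |h|^2 x^2
  e^(\<delta>x) for |h| \<le> \<delta>. With \<delta> half the distance to the line Re s = 1, the
  second moment at rate Re s - \<delta> is still finite and dominates.\<close>

lemma holomorphic_Lap: "Lap holomorphic_on {s. Re s > 1}"
  unfolding holomorphic_on_def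
proof (intro ballI)
  fix s assume "s \<in> {s. Re s > 1}"
  then have s: "Re s > 1" by simp
  define \<delta> where "\<delta> = (Re s - 1) / 2"
  have \<delta>: "\<delta> > 0" "Re s - \<delta> > 1" using s by (auto simp: \<delta>_def field_simps)
  define L1 where "L1 = (LBINT x. - (of_real (x ^ 1 * E x) * exp (- s * complex_of_real x)))"
  define K where "K = (LBINT x. \<bar>x ^ 2 * exp (- (Re s - \<delta>) * x) * E x\<bar>)"
  have est: "norm (Lap (s + h) - Lap s - h * L1) \<le> norm h ^ 2 * K" if h: "norm h \<le> \<delta>" for h
  proof -
    have hr: "\<bar>Re h\<bar> \<le> \<delta>" using h abs_Re_le_cmod[of h] by simp
    have sh: "Re (s + h) > 1" using hr \<delta> by simp
    let ?e = "\<lambda>s x. of_real (E x) * exp (- s * complex_of_real x)"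
    have i1: "integrable lborel (?e (s + h))" "integrable lborel (?e s)"
      using integrable_moment_complex[OF sh, of 0] integrable_moment_complex[OF s, of 0] by auto
    have i2: "integrable lborel (\<lambda>x. h * - (of_real (x ^ 1 * E x) * exp (- s * complex_of_real x)))"
      by (intro integrable_mult_right Bochner_Integration.integrable_minus integrable_moment_complex s)
    have "Lap (s + h) - Lap s - h * L1 = (LBINT x. ?e (s + h) x - ?e s x -
       h * - (of_real (x ^ 1 * E x) * exp (- s * complex_of_real x)))"
      unfolding Lap_def L1_def using i1 i2 by simp
    also have "norm \<dots> \<le> (LBINT x. norm h ^ 2 * \<bar>x ^ 2 * exp (- (Re s - \<delta>) * x) * E x\<bar>)"
    proof (rule Bochner_Integration.integral_norm_bound_integral)
      show "integrable lborel (\<lambda>x. norm h ^ 2 * \<bar>x ^ 2 * exp (- (Re s - \<delta>) * x) * E x\<bar>)"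
        by (intro integrable_mult_right integrable_abs integrable_moment \<delta>)
      fix x
      show "norm (?e (s + h) x - ?e s x - h * - (of_real (x ^ 1 * E x) * exp (- s * complex_of_real x)))
        \<le> norm h ^ 2 * \<bar>x ^ 2 * exp (- (Re s - \<delta>) * x) * E x\<bar>"
      proof (cases "x < 0")
        case False
        let ?z = "- h * complex_of_real x"
        have "?e (s + h) x - ?e s x - h * - (of_real (x ^ 1 * E x) * exp (- s * complex_of_real x))
          = of_real (E x) * exp (- s * of_real x) * (exp ?z - (\<Sum>k\<le>1. ?z ^ k / fact k))"
          by (simp add: algebra_simps exp_add[symmetric])
        also have "norm \<dots> = \<bar>E x\<bar> * exp (- Re s * x) * norm (exp ?z - (\<Sum>k\<le>1. ?z ^ k / fact k))"
          by (simp add: norm_mult)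
        also have "\<dots> \<le> \<bar>E x\<bar> * exp (- Re s * x) * (exp \<bar>Re ?z\<bar> * norm ?z ^ 2)"
          using Taylor_exp[of ?z 1] by (intro mult_left_mono) (auto simp: numeral_2_eq_2)
        also have "\<dots> \<le> \<bar>E x\<bar> * exp (- Re s * x) * (exp (\<delta> * x) * norm ?z ^ 2)"
        proof -
          have "\<bar>Re ?z\<bar> \<le> \<delta> * x" using hr False by (auto simp: abs_mult intro: mult_right_mono)
          then show ?thesis by (intro mult_left_mono mult_right_mono) auto
        qed
        also have "\<dots> = norm h ^ 2 * x ^ 2 * \<bar>E x\<bar> * (exp (- Re s * x) * exp (\<delta> * x))"
          by (simp add: norm_mult power_mult_distrib algebra_simps)
        also have "exp (- Re s * x) * exp (\<delta> * x) = exp (- (Re s - \<delta>) * x)"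
          by (simp add: algebra_simps flip: exp_add)
        finally show ?thesis by (simp add: abs_mult mult_ac)
      qed (simp add: neg)
    qed (use i1 i2 in auto)
    also have "\<dots> = norm h ^ 2 * K" unfolding K_def by simp
    finally show ?thesis .
  qed
  have "((\<lambda>h. (Lap (s + h) - Lap s) / h - L1) \<longlongrightarrow> 0) (at 0)"
  proof (rule Lim_null_comparison)
    have "norm ((Lap (s + h) - Lap s) / h - L1) \<le> norm h * K" if h: "h \<noteq> 0" "norm h < \<delta>" for h
    proof -
      have "(Lap (s + h) - Lap s) / h - L1 = (Lap (s + h) - Lap s - h * L1) / h"
        using h by (simp add: field_simps)
      also have "norm \<dots> \<le> norm h ^ 2 * K / norm h"
        unfolding norm_divide using est[of h] h by (intro divide_right_mono) auto
      also have "\<dots> = norm h * K" using h by (simp add: power2_eq_square)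
      finally show ?thesis .
    qed
    then show "\<forall>\<^sub>F h in at 0. norm ((Lap (s + h) - Lap s) / h - L1) \<le> norm h * K"
      unfolding eventually_at using \<delta>(1) by (intro exI[of _ \<delta>]) (auto simp: dist_norm)
    show "((\<lambda>h. norm h * K) \<longlongrightarrow> 0) (at 0)"
      by (auto intro!: tendsto_eq_intros)
  qed
  then have "(Lap has_field_derivative L1) (at s)"
    unfolding DERIV_def by (simp add: LIM_zero_iff)
  then show "Lap field_differentiable at s within {s. Re s > 1}"
    using field_differentiable_at_within field_differentiable_def by blast
qed

lemma holomorphic_s_Lap: "(\<lambda>s. s * Lap s) holomorphic_on {s. Re s > 1}"
  by (intro holomorphic_intros holomorphic_Lap)

lemma continuous_Uh: "\<sigma> > 1 \<Longrightarrow> continuous_on A (Uh \<sigma>)"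
proof -
  assume \<sigma>: "\<sigma> > 1"
  have "continuous_on A (\<lambda>t. Re ((\<lambda>s. s * Lap s) (of_real \<sigma> + \<i> * of_real t)))"
    by (intro continuous_on_Re continuous_on_compose2[OF holomorphic_on_imp_continuous_on[OF holomorphic_s_Lap]]
       continuous_intros) (use \<sigma> in auto)
  moreover have "(\<lambda>t. Re ((\<lambda>s. s * Lap s) (of_real \<sigma> + \<i> * of_real t))) = Uh \<sigma>"
    using Re_Lap[OF \<sigma>] by (simp only: Complex_eq)
  ultimately show "continuous_on A (Uh \<sigma>)" by metis
qed

end

section \<open>Boundary values of the real part\<close>

lemma Re_of_real_mult: "Re (of_real r * z) = r * Re z"
  by simp

locale boundary_L1 = exp_order_one +
  fixes f :: "real \<Rightarrow> real"
  assumes f_int: "a \<le> b \<Longrightarrow> {a..b} \<subseteq> - {0} \<Longrightarrow> integrable lborel (\<lambda>t. indicator {a..b} t * f t)"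
    and boundary: "a \<le> b \<Longrightarrow> {a..b} \<subseteq> - {0} \<Longrightarrow>
      ((\<lambda>\<sigma>. LBINT t. indicator {a..b} t * \<bar>Uh \<sigma> t - f t\<bar>) \<longlongrightarrow> 0) (at_right 1)"
begin

lemma integrable_Uh:
  assumes "\<sigma> > 1" "continuous_on {a..b} h"
  shows "integrable lborel (\<lambda>t. indicator {a..b} t * (h t * Uh \<sigma> t))"
  by (intro integrable_continuous_Icc continuous_on_mult continuous_Uh assms)

lemma integrable_abs_Uh: "\<sigma> > 1 \<Longrightarrow> integrable lborel (\<lambda>t. indicator {a..b} t * \<bar>Uh \<sigma> t\<bar>)"
  by (intro integrable_continuous_Icc continuous_intros continuous_Uh)

lemma Uh_measurable[measurable]: "\<sigma> > 1 \<Longrightarrow> Uh \<sigma> \<in> borel_measurable borel"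
  by (intro borel_measurable_continuous_onI continuous_Uh)

lemma integrable_diff_Uh:
  assumes "\<sigma> > 1" "a \<le> b" "{a..b} \<subseteq> - {0}"
  shows "integrable lborel (\<lambda>t. indicator {a..b} t * \<bar>Uh \<sigma> t - f t\<bar>)"
proof -
  have "integrable lborel (\<lambda>t. \<bar>indicator {a..b} t * (1 * Uh \<sigma> t) - indicator {a..b} t * f t\<bar>)"
    by (intro integrable_abs Bochner_Integration.integrable_diff integrable_Uh f_int assms) auto
  also have "(\<lambda>t. \<bar>indicator {a..b} t * (1 * Uh \<sigma> t) - indicator {a..b} t * f t\<bar>) =
     (\<lambda>t. indicator {a..b} t * \<bar>Uh \<sigma> t - f t\<bar>)"
    by (auto simp: indicator_def)
  finally show ?thesis .
qed

lemma L1_bounded_away: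
  assumes "a \<le> b" "{a..b} \<subseteq> - {0}"
  shows "\<exists>M. \<forall>\<^sub>F \<sigma> in at_right 1. (LBINT t. indicator {a..b} t * \<bar>Uh \<sigma> t\<bar>) \<le> M"
proof (intro exI)
  have int: "integrable lborel (\<lambda>t. indicator {a..b} t * \<bar>f t\<bar>)"
    using integrable_abs[OF f_int[OF assms]] by (simp add: abs_mult)
  have "\<forall>\<^sub>F \<sigma> in at_right 1. (LBINT t. indicator {a..b} t * \<bar>Uh \<sigma> t - f t\<bar>) < 1"
    using boundary[OF assms] by (rule order_tendstoD) simp
  then show "\<forall>\<^sub>F \<sigma> in at_right 1. (LBINT t. indicator {a..b} t * \<bar>Uh \<sigma> t\<bar>) \<le>
     1 + (LBINT t. indicator {a..b} t * \<bar>f t\<bar>)"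
    using eventually_at_right_less[of 1]
  proof eventually_elim
    case (elim \<sigma>)
    have "(LBINT t. indicator {a..b} t * \<bar>Uh \<sigma> t\<bar>) \<le>
       (LBINT t. indicator {a..b} t * \<bar>Uh \<sigma> t - f t\<bar> + indicator {a..b} t * \<bar>f t\<bar>)"
      using elim int assms
      by (intro integral_mono Bochner_Integration.integrable_add integrable_diff_Uh integrable_abs_Uh)
        (auto simp: indicator_def)
    also have "\<dots> = (LBINT t. indicator {a..b} t * \<bar>Uh \<sigma> t - f t\<bar>) + (LBINT t. indicator {a..b} t * \<bar>f t\<bar>)"
      using elim assms int by (intro Bochner_Integration.integral_add integrable_diff_Uh)
    finally show ?case using elim by simp
  qed
qed

text \<open>The weight p has a nonnegative second derivative near 0, where U is only known to be bounded
  below. So A = \<integral> p U satisfies A'' = - \<integral> p'' U \<le> C, which bounds A from above as \<sigma> decreases to 1.\<close>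

lemma L1_bounded_of_minorant:
  assumes lam: "lam > 0" and g: "integrable lborel (\<lambda>t. indicator {-lam<..<lam} t * g t)"
    and ge: "\<And>\<sigma>. 1 < \<sigma> \<Longrightarrow> \<sigma> \<le> 2 \<Longrightarrow> AE t in lborel. t \<in> {-lam<..<lam} \<longrightarrow> Uh \<sigma> t \<ge> g t"
  shows "\<exists>\<mu>>0. \<exists>M. \<forall>\<^sub>F \<sigma> in at_right 1. (LBINT t. indicator {-\<mu>..\<mu>} t * \<bar>Uh \<sigma> t\<bar>) \<le> M"
proof -
  define \<mu> where "\<mu> = lam / 2"
  have \<mu>: "\<mu> > 0" "\<mu> < lam" using lam by (auto simp: \<mu>_def)
  \<comment> \<open>With x = t / \<mu> this is (1 - x^2)^2 (1 + 3 x^2). The square gives double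
    zeros at both ends, so that two integrations by parts leave no boundary terms. The second factor
    must overcome the concavity of (1 - x^2)^2 at 0; with coefficient 3 the x^2-term is +1.\<close>
  define p where "p t = 1 + (t / \<mu>)\<^sup>2 - 5 * (t / \<mu>) ^ 4 + 3 * (t / \<mu>) ^ 6" for t
  define p' where "p' t = (2 * (t / \<mu>) - 20 * (t / \<mu>) ^ 3 + 18 * (t / \<mu>) ^ 5) / \<mu>" for t
  define p'' where "p'' t = (2 - 60 * (t / \<mu>) ^ 2 + 90 * (t / \<mu>) ^ 4) / \<mu>\<^sup>2" for t
  have scale: "((\<lambda>t. t / \<mu>) has_real_derivative 1 / \<mu>) (at t)" for t
    using \<mu> by (auto intro!: derivative_eq_intros)
  have "((\<lambda>x::real. 1 + x\<^sup>2 - 5 * x ^ 4 + 3 * x ^ 6) has_real_derivative 2 * x - 20 * x ^ 3 + 18 * x ^ 5) (at x)" for x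
    by (auto intro!: derivative_eq_intros)
  from DERIV_chain2[OF this scale] have dp: "(p has_real_derivative p' t) (at t)" for t
    unfolding p_def p'_def by simp
  have "((\<lambda>x::real. 2 * x - 20 * x ^ 3 + 18 * x ^ 5) has_real_derivative 2 - 60 * x\<^sup>2 + 90 * x ^ 4) (at x)" for x
    by (auto intro!: derivative_eq_intros)
  from DERIV_cdivide[OF DERIV_chain2[OF this scale], where c=\<mu>] have dp': "(p' has_real_derivative p'' t) (at t)" for t
    unfolding p'_def p''_def by (simp add: power2_eq_square)
  have cp: "continuous_on A p" "continuous_on A p'" "continuous_on A p''" for A
    unfolding p_def p'_def p''_def using \<mu> by (auto intro!: continuous_intros)
  have p_eq: "p t = (1 - (t / \<mu>)\<^sup>2)\<^sup>2 * (1 + 3 * (t / \<mu>)\<^sup>2)" for t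
    unfolding p_def by algebra
  have p_nonneg: "p t \<ge> 0" for t unfolding p_eq by simp
  have sq: "(t / \<mu>)\<^sup>2 \<le> c\<^sup>2" if "\<bar>t\<bar> \<le> c * \<mu>" "c \<ge> 0" for t c
    using that \<mu> abs_le_square_iff[of "t / \<mu>" c] by (simp add: field_simps)
  have p_half: "p t \<ge> 1 / 2" if "\<bar>t\<bar> \<le> \<mu> / 2" for t
  proof -
    have x: "(t / \<mu>)\<^sup>2 \<le> 1 / 4" using sq[of t "1/2"] that by (simp add: power2_eq_square)
    have "(t / \<mu>) ^ 4 = ((t / \<mu>)\<^sup>2)\<^sup>2" by simp
    also have "\<dots> \<le> (1 / 4)\<^sup>2" by (intro power_mono x) auto
    finally have "(t / \<mu>) ^ 4 \<le> 1 / 16" by (simp add: power2_eq_square)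
    moreover have "(t / \<mu>)\<^sup>2 \<ge> 0" "(t / \<mu>) ^ 6 \<ge> 0" by (auto simp: zero_le_even_power)
    ultimately show ?thesis unfolding p_def by linarith
  qed
  have p_le: "p t \<le> 4" if "\<bar>t\<bar> \<le> \<mu>" for t
  proof -
    have x: "(t / \<mu>)\<^sup>2 \<le> 1" using sq[of t 1] that by simp
    then have "(1 - (t / \<mu>)\<^sup>2)\<^sup>2 \<le> 1" by (simp add: power_le_one)
    then have "(1 - (t / \<mu>)\<^sup>2)\<^sup>2 * (1 + 3 * (t / \<mu>)\<^sup>2) \<le> 1 * 4" using x by (intro mult_mono) auto
    then show ?thesis unfolding p_eq by simp
  qed
  \<comment> \<open>At |x| \<le> 1/6 the negative term is at most 60/36 < 2.\<close>
  have p''_nonneg: "p'' t \<ge> 0" if "\<bar>t\<bar> \<le> \<mu> / 6" for t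
  proof -
    have x: "(t / \<mu>)\<^sup>2 \<le> 1 / 36" using sq[of t "1/6"] that by (simp add: power2_eq_square)
    moreover have "(t / \<mu>) ^ 4 \<ge> 0" by (simp add: zero_le_even_power)
    ultimately show ?thesis unfolding p''_def by (intro divide_nonneg_nonneg) auto
  qed
  \<comment> \<open>152 = 2 + 60 + 90, the sum of the absolute coefficients of
    \<open>p''\<close>.\<close>
  define Q where "Q = 152 / \<mu>\<^sup>2"
  have p''_abs: "\<bar>p'' t\<bar> \<le> Q" if "\<bar>t\<bar> \<le> \<mu>" for t
  proof -
    have x: "(t / \<mu>)\<^sup>2 \<le> 1" using sq[of t 1] that by simp
    have "(t / \<mu>) ^ 4 = ((t / \<mu>)\<^sup>2)\<^sup>2" by simp
    also have "\<dots> \<le> 1" by (rule power_le_one[OF zero_le_power2 x])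
    finally have "(t / \<mu>) ^ 4 \<le> 1" .
    moreover have "(t / \<mu>)\<^sup>2 \<ge> 0" "(t / \<mu>) ^ 4 \<ge> 0" by (auto simp: zero_le_even_power)
    ultimately have "\<bar>2 - 60 * (t / \<mu>) ^ 2 + 90 * (t / \<mu>) ^ 4\<bar> \<le> 152" using x by linarith
    then show ?thesis unfolding p''_def Q_def abs_divide by (simp add: divide_right_mono)
  qed
  have ends: "p \<mu> = 0" "p (-\<mu>) = 0" "p' \<mu> = 0" "p' (-\<mu>) = 0"
    using \<mu> by (auto simp: p_def p'_def power_divide)
  have gi: "integrable lborel (\<lambda>t. indicator {-\<mu>..\<mu>} t * \<bar>g t\<bar>)"
  proof (rule Bochner_Integration.integrable_bound[OF g])
    have "(\<lambda>t. indicator {-\<mu>..\<mu>} t * \<bar>indicator {-lam<..<lam} t * g t\<bar>) \<in> borel_measurable lborel"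
      using borel_measurable_integrable[OF g] by measurable
    also have "(\<lambda>t. indicator {-\<mu>..\<mu>} t * \<bar>indicator {-lam<..<lam} t * g t\<bar>) = (\<lambda>t. indicator {-\<mu>..\<mu>} t * \<bar>g t\<bar>)"
      using \<mu> by (auto simp: indicator_def fun_eq_iff)
    finally show "(\<lambda>t. indicator {-\<mu>..\<mu>} t * \<bar>g t\<bar>) \<in> borel_measurable lborel" .
    show "AE t in lborel. norm (indicator {-\<mu>..\<mu>} t * \<bar>g t\<bar>) \<le> norm (indicator {-lam<..<lam} t * g t)"
      using \<mu> by (intro AE_I2) (auto simp: indicator_def)
  qed
  define G where "G = (LBINT t. indicator {-\<mu>..\<mu>} t * \<bar>g t\<bar>)"
  let ?F = "\<lambda>s. s * Lap s"
  define A where "A \<sigma> = integral {-\<mu>..\<mu>} (\<lambda>t. of_real (p t) * ?F (Complex \<sigma> t))" for \<sigma>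
  define A1 where "A1 \<sigma> = \<i> * integral {-\<mu>..\<mu>} (\<lambda>t. of_real (p' t) * ?F (Complex \<sigma> t))" for \<sigma>
  define A2 where "A2 \<sigma> = - integral {-\<mu>..\<mu>} (\<lambda>t. of_real (p'' t) * ?F (Complex \<sigma> t))" for \<sigma>
  have A: "(A has_vector_derivative A1 \<sigma>) (at \<sigma>)" if "\<sigma> > 1" for \<sigma>
    unfolding A_def A1_def by (rule vertical_integral_has_derivative[OF holomorphic_s_Lap \<mu>(1) that dp cp(2) ends(1,2)])
  have A1: "(A1 has_vector_derivative A2 \<sigma>) (at \<sigma>)" if "\<sigma> > 1" for \<sigma>
    using has_vector_derivative_mult_right[OF
      vertical_integral_has_derivative[OF holomorphic_s_Lap \<mu>(1) that dp' cp(3) ends(3,4)], of \<i>]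
    unfolding A1_def A2_def by (simp flip: mult.assoc)
  have Re_int: "Re (integral {-\<mu>..\<mu>} (\<lambda>t. of_real (q t) * ?F (Complex \<sigma> t))) =
      (LBINT t. indicator {-\<mu>..\<mu>} t * (q t * Uh \<sigma> t))"
    if q: "continuous_on {-\<mu>..\<mu>} q" and \<sigma>: "\<sigma> > 1" for q \<sigma>
  proof -
    have "continuous_on {-\<mu>..\<mu>} (\<lambda>t. ?F (of_real \<sigma> + \<i> * of_real t))"
      by (intro continuous_on_compose2[OF holomorphic_on_imp_continuous_on[OF holomorphic_s_Lap]] continuous_intros)
        (use \<sigma> in auto)
    then have "(\<lambda>t. of_real (q t) * ?F (Complex \<sigma> t)) integrable_on {-\<mu>..\<mu>}"
      unfolding Complex_eq
      by (intro integrable_continuous_interval continuous_on_mult[OF continuous_on_of_real[OF q]])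
    from integral_linear[OF this bounded_linear_Re]
    have "Re (integral {-\<mu>..\<mu>} (\<lambda>t. of_real (q t) * ?F (Complex \<sigma> t))) =
       integral {-\<mu>..\<mu>} (\<lambda>t. Re (of_real (q t) * ?F (Complex \<sigma> t)))"
      unfolding o_def by (rule sym)
    also have "\<dots> = integral {-\<mu>..\<mu>} (\<lambda>t. q t * Uh \<sigma> t)"
      using Re_Lap[OF \<sigma>] by (simp only: Re_of_real_mult)
    also have "\<dots> = (LBINT t. indicator {-\<mu>..\<mu>} t * (q t * Uh \<sigma> t))"
      by (intro LBINT_eq_integral_Icc[symmetric] continuous_on_mult continuous_Uh q \<sigma>)
    finally show ?thesis .
  qed
  \<comment> \<open>Where \<open>p''\<close> may be negative, no one-sided bound helps; there the
    L^1 boundary behaviour controls |U|.\<close>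
  have away: "{\<mu>/6..\<mu>} \<subseteq> - {0}" "{-\<mu>..-(\<mu>/6)} \<subseteq> - {0}" "\<mu>/6 \<le> \<mu>" "-\<mu> \<le> -(\<mu>/6)" using \<mu> by auto
  obtain M1 M2 where
    M1: "\<forall>\<^sub>F \<sigma> in at_right 1. (LBINT t. indicator {\<mu>/6..\<mu>} t * \<bar>Uh \<sigma> t\<bar>) \<le> M1" and
    M2: "\<forall>\<^sub>F \<sigma> in at_right 1. (LBINT t. indicator {-\<mu>..-(\<mu>/6)} t * \<bar>Uh \<sigma> t\<bar>) \<le> M2"
    using L1_bounded_away[OF away(3,1)] L1_bounded_away[OF away(4,2)] by blast
  have Q: "Q \<ge> 0" unfolding Q_def by simp
  have A2_le: "Re (A2 \<sigma>) \<le> Q * G + Q * M1 + Q * M2"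
    if 1: "(LBINT t. indicator {\<mu>/6..\<mu>} t * \<bar>Uh \<sigma> t\<bar>) \<le> M1"
      and 2: "(LBINT t. indicator {-\<mu>..-(\<mu>/6)} t * \<bar>Uh \<sigma> t\<bar>) \<le> M2" and \<sigma>: "1 < \<sigma>" "\<sigma> \<le> 2" for \<sigma>
  proof -
    let ?R = "\<lambda>t. Q * (indicator {-\<mu>..\<mu>} t * \<bar>g t\<bar>) + Q * (indicator {\<mu>/6..\<mu>} t * \<bar>Uh \<sigma> t\<bar>) +
       Q * (indicator {-\<mu>..-(\<mu>/6)} t * \<bar>Uh \<sigma> t\<bar>)"
    \<comment> \<open>For |t| \<le> \<mu>/6 the sign of \<open>p''\<close> lets the minorant act:
      -p'' U \<le> p'' |g| \<le> Q |g|. For the other t the bound Q |U| is covered by one of the two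
      outer intervals.\<close>
    have pt: "- (indicator {-\<mu>..\<mu>} t * (p'' t * Uh \<sigma> t)) \<le> ?R t"
      if "t \<in> {-lam<..<lam} \<longrightarrow> Uh \<sigma> t \<ge> g t" for t
    proof (cases "t \<in> {-\<mu>..\<mu>}")
      case t: True
      show ?thesis
      proof (cases "\<bar>t\<bar> \<le> \<mu> / 6")
        case True
        have "- \<bar>g t\<bar> \<le> Uh \<sigma> t" using that t \<mu> by auto
        then have "p'' t * (- \<bar>g t\<bar>) \<le> p'' t * Uh \<sigma> t"
          by (intro mult_left_mono p''_nonneg True)
        moreover have "p'' t * \<bar>g t\<bar> \<le> Q * \<bar>g t\<bar>"
          using p''_abs[of t] t by (intro mult_right_mono) (auto simp: abs_le_iff)
        moreover have "0 \<le> Q * (indicator {\<mu>/6..\<mu>} t * \<bar>Uh \<sigma> t\<bar>) + Q * (indicator {-\<mu>..-(\<mu>/6)} t * \<bar>Uh \<sigma> t\<bar>)"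
          using Q by simp
        ultimately show ?thesis using t by simp
      next
        case False
        have "- (p'' t * Uh \<sigma> t) \<le> \<bar>p'' t\<bar> * \<bar>Uh \<sigma> t\<bar>"
          by (metis abs_ge_minus_self abs_mult)
        also have "\<dots> \<le> Q * \<bar>Uh \<sigma> t\<bar>"
          using p''_abs[of t] t by (intro mult_right_mono) auto
        also have "\<dots> \<le> ?R t"
          using False t Q by (auto simp: indicator_def)
        finally show ?thesis using t by simp
      qed
    qed (use Q in auto)
    have "Re (A2 \<sigma>) = (LBINT t. - (indicator {-\<mu>..\<mu>} t * (p'' t * Uh \<sigma> t)))"
      unfolding A2_def using Re_int[OF cp(3) \<sigma>(1)] by simp
    also have "\<dots> \<le> (LBINT t. ?R t)"
    proof (rule integral_mono_AE)
      show "integrable lborel (\<lambda>t. - (indicator {-\<mu>..\<mu>} t * (p'' t * Uh \<sigma> t)))"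
        by (intro Bochner_Integration.integrable_minus integrable_Uh cp \<sigma>)
      show "integrable lborel ?R"
        by (intro Bochner_Integration.integrable_add integrable_mult_right gi integrable_abs_Uh \<sigma>)
      show "AE t in lborel. - (indicator {-\<mu>..\<mu>} t * (p'' t * Uh \<sigma> t)) \<le> ?R t"
        using ge[OF \<sigma>] by eventually_elim (rule pt)
    qed
    also have "\<dots> = Q * G + Q * (LBINT t. indicator {\<mu>/6..\<mu>} t * \<bar>Uh \<sigma> t\<bar>) +
        Q * (LBINT t. indicator {-\<mu>..-(\<mu>/6)} t * \<bar>Uh \<sigma> t\<bar>)"
      unfolding G_def using gi integrable_abs_Uh[OF \<sigma>(1)] by simp
    also have "\<dots> \<le> Q * G + Q * M1 + Q * M2"
      using 1 2 Q by (intro add_mono mult_left_mono) auto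
    finally show ?thesis .
  qed
  have "\<forall>\<^sub>F \<sigma> in at_right 1. Re (A2 \<sigma>) \<le> Q * G + Q * M1 + Q * M2"
    using M1 M2 eventually_at_right_real[of 1 "2::real", simplified]
    by eventually_elim (rule A2_le, auto)
  then obtain b where b: "b > 1" "\<And>\<sigma>. 1 < \<sigma> \<Longrightarrow> \<sigma> < b \<Longrightarrow> Re (A2 \<sigma>) \<le> Q * G + Q * M1 + Q * M2"
    unfolding eventually_at_right_field by blast
  define \<sigma>1 where "\<sigma>1 = min 2 ((1 + b) / 2)"
  have \<sigma>1: "1 < \<sigma>1" "\<sigma>1 < b" "\<sigma>1 \<le> 2" using b(1) by (auto simp: \<sigma>1_def min_def)
  have "\<exists>K. \<forall>\<sigma>. 1 < \<sigma> \<and> \<sigma> \<le> \<sigma>1 \<longrightarrow> Re (A \<sigma>) \<le> K"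
  proof (rule bounded_of_second_derivative_le)
    show "((\<lambda>\<sigma>. Re (A \<sigma>)) has_real_derivative Re (A1 \<sigma>)) (at \<sigma>)" if "\<sigma> > 1" for \<sigma>
      unfolding has_real_derivative_iff_has_vector_derivative
      by (rule bounded_linear.has_vector_derivative[OF bounded_linear_Re A[OF that]])
    show "((\<lambda>\<sigma>. Re (A1 \<sigma>)) has_real_derivative Re (A2 \<sigma>)) (at \<sigma>)" if "\<sigma> > 1" for \<sigma>
      unfolding has_real_derivative_iff_has_vector_derivative
      by (rule bounded_linear.has_vector_derivative[OF bounded_linear_Re A1[OF that]])
    show "Re (A2 \<sigma>) \<le> Q * G + Q * M1 + Q * M2" if "1 < \<sigma>" "\<sigma> \<le> \<sigma>1" for \<sigma>
      using b(2)[of \<sigma>] that \<sigma>1 by simp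
  qed
  then obtain K where K: "\<And>\<sigma>. 1 < \<sigma> \<Longrightarrow> \<sigma> \<le> \<sigma>1 \<Longrightarrow> Re (A \<sigma>) \<le> K" by blast
  have bound: "(LBINT t. indicator {-(\<mu>/2)..\<mu>/2} t * \<bar>Uh \<sigma> t\<bar>) \<le> 2 * K + 9 * G"
    if \<sigma>: "1 < \<sigma>" "\<sigma> \<le> \<sigma>1" for \<sigma>
  proof -
    let ?R = "\<lambda>t. 2 * (indicator {-\<mu>..\<mu>} t * (p t * Uh \<sigma> t)) + 9 * (indicator {-\<mu>..\<mu>} t * \<bar>g t\<bar>)"
    \<comment> \<open>The upper bound for the integral of p U becomes an L^1 bound since U - g \<ge>
      0. On the half interval |U| \<le> (U - g) + |g| \<le> 2 p (U - g) + |g|, and everywhere p (U -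
      g) \<le> p U + 4 |g|; hence 9 = 2 * 4 + 1.\<close>
    have pt: "indicator {-(\<mu>/2)..\<mu>/2} t * \<bar>Uh \<sigma> t\<bar> \<le> ?R t"
      if "t \<in> {-lam<..<lam} \<longrightarrow> Uh \<sigma> t \<ge> g t" for t
    proof (cases "t \<in> {-\<mu>..\<mu>}")
      case t: True
      then have d: "0 \<le> Uh \<sigma> t - g t" using that \<mu> by auto
      have "p t * g t \<ge> p t * (- \<bar>g t\<bar>)" using p_nonneg by (intro mult_left_mono) auto
      moreover have "p t * \<bar>g t\<bar> \<le> 4 * \<bar>g t\<bar>" using p_le[of t] t by (intro mult_right_mono) auto
      ultimately have pg: "p t * (Uh \<sigma> t - g t) \<le> p t * Uh \<sigma> t + 4 * \<bar>g t\<bar>"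
        by (simp add: right_diff_distrib)
      have "indicator {-(\<mu>/2)..\<mu>/2} t * \<bar>Uh \<sigma> t\<bar> \<le> 2 * (p t * (Uh \<sigma> t - g t)) + \<bar>g t\<bar>"
      proof (cases "\<bar>t\<bar> \<le> \<mu> / 2")
        case True
        have "1 / 2 * (Uh \<sigma> t - g t) \<le> p t * (Uh \<sigma> t - g t)"
          using p_half[OF True] d by (intro mult_right_mono)
        moreover have "\<bar>Uh \<sigma> t\<bar> \<le> (Uh \<sigma> t - g t) + \<bar>g t\<bar>" using d by (auto simp: abs_if)
        moreover have "t \<in> {-(\<mu>/2)..\<mu>/2}" using True by (auto simp: abs_le_iff)
        ultimately show ?thesis by simp
      next
        case False
        then have "t \<notin> {-(\<mu>/2)..\<mu>/2}" by auto
        moreover have "0 \<le> p t * (Uh \<sigma> t - g t)" using d p_nonneg by simp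
        ultimately show ?thesis by simp
      qed
      with pg show ?thesis using t by simp
    qed (use \<mu> in auto)
    have "(LBINT t. indicator {-(\<mu>/2)..\<mu>/2} t * \<bar>Uh \<sigma> t\<bar>) \<le> (LBINT t. ?R t)"
    proof (rule integral_mono_AE)
      show "integrable lborel (\<lambda>t. indicator {-(\<mu>/2)..\<mu>/2} t * \<bar>Uh \<sigma> t\<bar>)"
        by (intro integrable_abs_Uh \<sigma>)
      show "integrable lborel ?R"
        by (intro Bochner_Integration.integrable_add integrable_mult_right gi integrable_Uh cp \<sigma>)
      have "\<sigma> \<le> 2" using \<sigma> \<sigma>1 by simp
      from ge[OF \<sigma>(1) this] show "AE t in lborel. indicator {-(\<mu>/2)..\<mu>/2} t * \<bar>Uh \<sigma> t\<bar> \<le> ?R t"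
        by eventually_elim (rule pt)
    qed
    also have "\<dots> = 2 * Re (A \<sigma>) + 9 * G"
      unfolding A_def Re_int[OF cp(1) \<sigma>(1)] G_def
      using gi integrable_Uh[OF \<sigma>(1) cp(1)] by simp
    also have "\<dots> \<le> 2 * K + 9 * G" using K[OF \<sigma>] by simp
    finally show ?thesis .
  qed
  have "\<forall>\<^sub>F \<sigma> in at_right 1. (LBINT t. indicator {-(\<mu>/2)..\<mu>/2} t * \<bar>Uh \<sigma> t\<bar>) \<le> 2 * K + 9 * G"
    using eventually_at_right_real[OF \<sigma>1(1)] by eventually_elim (rule bound, auto)
  then show ?thesis using \<mu> by (intro exI[of _ "\<mu> / 2"]) auto
qed

end

section \<open>The Riemann-Lebesgue lemma\<close>

text \<open>Cosines alone suffice, since the test integrals to be killed contain the factor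
  \<open>cos (t * y)\<close>. As a predicate it serves as the induction property both over Borel
  sets and over integrable functions.\<close>

definition RL :: "(real \<Rightarrow> real) \<Rightarrow> bool" where
  "RL f \<longleftrightarrow> ((\<lambda>y. LBINT t. f t * cos (y * t)) \<longlongrightarrow> 0) at_top"

lemma integrable_mult_cos:
  fixes f :: "real \<Rightarrow> real"
  assumes f: "integrable lborel f"
  shows "integrable lborel (\<lambda>t. f t * cos (y * t))"
proof (rule Bochner_Integration.integrable_bound[OF f])
  show "AE t in lborel. norm (f t * cos (y * t)) \<le> norm (f t)"
    by (intro AE_I2) (simp add: abs_mult mult_left_le)
  show "(\<lambda>t. f t * cos (y * t)) \<in> borel_measurable lborel"
    using borel_measurable_integrable[OF f] by measurable
qed

lemma RL_add:
  assumes "integrable lborel f" "RL f" "integrable lborel g" "RL g"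
  shows "RL (\<lambda>t. f t + g t)"
proof -
  have "(\<lambda>y. LBINT t. (f t + g t) * cos (y * t)) =
      (\<lambda>y. (LBINT t. f t * cos (y * t)) + (LBINT t. g t * cos (y * t)))"
    using integrable_mult_cos[OF assms(1)] integrable_mult_cos[OF assms(3)] by (simp add: distrib_right)
  then show ?thesis
    using tendsto_add[OF assms(2)[unfolded RL_def] assms(4)[unfolded RL_def]] by (simp add: RL_def)
qed

lemma RL_mult:
  assumes "RL f" shows "RL (\<lambda>t. c * f t)"
  using tendsto_mult_left[OF assms[unfolded RL_def], of c] by (simp add: RL_def mult.assoc)

text \<open>Cosines are bounded by 1, so the transforms of \<open>s i\<close> approximate that of
  \<open>f\<close> uniformly in y once the L^1 distance is small. The bound by twice |f| is the form
  in which \<open>integrable_induct\<close> supplies its approximants.\<close>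

lemma RL_limit:
  assumes f: "integrable lborel f" and s: "\<And>i. integrable lborel (s i)" "\<And>i. RL (s i)"
    and lim: "\<And>t. (\<lambda>i. s i t) \<longlonglongrightarrow> f t" and bnd: "\<And>i t. \<bar>s i t\<bar> \<le> 2 * \<bar>f t\<bar>"
  shows "RL f"
  unfolding RL_def
proof (rule tendstoI)
  fix e :: real assume e: "e > 0"
  have "(\<lambda>i. LBINT t. \<bar>f t - s i t\<bar>) \<longlonglongrightarrow> (\<integral>t. 0 \<partial>(lborel :: real measure))"
  proof (rule integral_dominated_convergence)
    show "(\<lambda>t. \<bar>f t - s i t\<bar>) \<in> borel_measurable lborel" for i
      using borel_measurable_integrable[OF f] borel_measurable_integrable[OF s(1)[of i]] by measurable
    show "integrable lborel (\<lambda>t. 3 * \<bar>f t\<bar>)" using f by simp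
    have "(\<lambda>i. \<bar>f t - s i t\<bar>) \<longlonglongrightarrow> \<bar>f t - f t\<bar>" for t
      by (intro tendsto_intros lim)
    then show "AE t in lborel. (\<lambda>i. \<bar>f t - s i t\<bar>) \<longlonglongrightarrow> 0" by (intro AE_I2) simp
    show "AE t in lborel. norm \<bar>f t - s i t\<bar> \<le> 3 * \<bar>f t\<bar>" for i
    proof (intro AE_I2)
      fix t
      show "norm \<bar>f t - s i t\<bar> \<le> 3 * \<bar>f t\<bar>"
        using abs_triangle_ineq4[of "f t" "s i t"] bnd[of i t] by simp
    qed
  qed simp
  then have "\<forall>\<^sub>F i in sequentially. (LBINT t. \<bar>f t - s i t\<bar>) < e / 2"
    using e by (intro order_tendstoD(2)[where a="e/2"]) auto
  then obtain i where i: "(LBINT t. \<bar>f t - s i t\<bar>) < e / 2"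
    using eventually_sequentially by auto
  have "\<forall>\<^sub>F y in at_top. dist (LBINT t. s i t * cos (y * t)) 0 < e / 2"
    using s(2)[of i] e unfolding RL_def by (intro tendstoD) auto
  then show "\<forall>\<^sub>F y in at_top. dist (LBINT t. f t * cos (y * t)) 0 < e"
  proof eventually_elim
    case (elim y)
    have "(LBINT t. f t * cos (y * t)) - (LBINT t. s i t * cos (y * t)) =
       (LBINT t. (f t - s i t) * cos (y * t))"
      using integrable_mult_cos[OF f] integrable_mult_cos[OF s(1)] by (simp add: left_diff_distrib)
    also have "\<bar>\<dots>\<bar> \<le> (LBINT t. \<bar>f t - s i t\<bar>)"
      using f s(1)[of i] integrable_mult_cos[of "\<lambda>t. f t - s i t"]
      by (intro Bochner_Integration.integral_abs_bound_integral) (auto simp: abs_mult mult_left_le)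
    finally show ?case using i elim by (simp add: dist_real_def)
  qed
qed

lemma RL_Icc: "RL (indicator {a..b})"
proof (cases "a \<le> b")
  case True
  have "(LBINT t. indicator {a..b} t * cos (y * t)) = (sin (y * b) - sin (y * a)) / y" if "y > 0" for y
  proof -
    have "(LBINT t. indicator {a..b} t *\<^sub>R cos (y * t)) = sin (y * b) / y - sin (y * a) / y"
      using True that by (intro integral_FTC_Icc)
        (auto intro!: derivative_eq_intros continuous_intros simp flip: has_real_derivative_iff_has_vector_derivative)
    then show ?thesis by (simp add: diff_divide_distrib)
  qed
  then have "\<forall>\<^sub>F y in at_top. (sin (y * b) - sin (y * a)) / y = (LBINT t. indicator {a..b} t * cos (y * t))"
    by (intro eventually_mono[OF eventually_gt_at_top[of "0::real"]]) auto
  moreover have "((\<lambda>y. (sin (y * b) - sin (y * a)) / y) \<longlongrightarrow> 0) at_top"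
  proof (rule Lim_null_comparison)
    have "norm ((sin (y * b) - sin (y * a)) / y) \<le> 2 / y" if "y > 0" for y
    proof -
      have "\<bar>sin (y * b) - sin (y * a)\<bar> \<le> 2"
        using sin_le_one[of "y * b"] sin_le_one[of "y * a"] sin_ge_minus_one[of "y * b"] sin_ge_minus_one[of "y * a"]
        unfolding abs_le_iff by linarith
      then show ?thesis using that by (simp add: divide_right_mono)
    qed
    then show "\<forall>\<^sub>F y in at_top. norm ((sin (y * b) - sin (y * a)) / y) \<le> 2 / y"
      by (intro eventually_mono[OF eventually_gt_at_top[of "0::real"]]) auto
    show "((\<lambda>y::real. 2 / y) \<longlongrightarrow> 0) at_top" by real_asymp
  qed
  ultimately show ?thesis unfolding RL_def by (rule Lim_transform_eventually[rotated])
next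
  case False
  then have "(indicator {a..b} :: real \<Rightarrow> real) = (\<lambda>t. 0)" by (auto simp: indicator_def)
  then show ?thesis by (simp add: RL_def)
qed

text \<open>A Dynkin argument over the generator of half-lines. Intersecting with [-n, n] turns
  half-lines into intervals, where the transform is explicit, and keeps complements of finite
  measure.\<close>

lemma RL_bounded_set:
  assumes "A \<in> sets borel"
  shows "RL (indicator (A \<inter> {-n..n}))"
proof -
  have int: "integrable lborel (indicator (B \<inter> {-n..n}) :: real \<Rightarrow> real)" if "B \<in> sets borel" for B
  proof -
    have "emeasure lborel (B \<inter> {-n..n}) \<le> emeasure lborel {-n..n}" using that by (intro emeasure_mono) auto
    also have "\<dots> < \<infinity>" by (simp add: emeasure_lborel_Icc_eq)
    finally show ?thesis using that by (intro integrable_real_indicator) auto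
  qed
  have gen: "sets borel = sigma_sets UNIV (range (\<lambda>a::real. {..a}))"
    unfolding borel_eq_atMost by (subst sets_measure_of) auto
  have "Int_stable (range (\<lambda>a::real. {..a}))"
    by (auto simp: Int_stable_def)
  moreover have "range (\<lambda>a::real. {..a}) \<subseteq> Pow UNIV" by simp
  moreover have "A \<in> sigma_sets UNIV (range (\<lambda>a::real. {..a}))" using assms gen by simp
  ultimately show ?thesis
  proof (induction rule: sigma_sets_induct_disjoint)
    case (basic A)
    then obtain a where "A = {..a}" by auto
    then have "A \<inter> {-n..n} = {-n..min a n}" by auto
    then show ?case using RL_Icc[of "-n" "min a n"] by simp
  next
    case empty
    show ?case by (simp add: RL_def)
  next
    case (compl A)
    have A: "A \<in> sets borel" using compl gen by simp
    have "(indicator ((UNIV - A) \<inter> {-n..n}) :: real \<Rightarrow> real) =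
       (\<lambda>t. indicator (UNIV \<inter> {-n..n}) t + (-1) * indicator (A \<inter> {-n..n}) t)"
      by (auto simp: indicator_def)
    moreover have "RL (\<lambda>t. indicator (UNIV \<inter> {-n..n}) t + (-1) * indicator (A \<inter> {-n..n}) t)"
      by (intro RL_add RL_mult int integrable_mult_right compl A) (use RL_Icc in auto)
    ultimately show ?case by simp
  next
    case (union A)
    have A: "A i \<in> sets borel" for i using union(2) gen by auto
    have fin: "RL (indicator ((\<Union>i<k. A i) \<inter> {-n..n}))" for k :: nat
    proof (induction k)
      case 0
      show ?case by (simp add: RL_def)
    next
      case (Suc k)
      have "A k \<inter> A i = {}" if "i < k" for i
        using union(1) that by (simp add: disjoint_family_on_def)
      then have "A k \<inter> (\<Union>i<k. A i) = {}" by blast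
      then have "(indicator ((\<Union>i<Suc k. A i) \<inter> {-n..n}) :: real \<Rightarrow> real) =
        (\<lambda>t. indicator ((\<Union>i<k. A i) \<inter> {-n..n}) t + indicator (A k \<inter> {-n..n}) t)"
        by (auto simp: indicator_def lessThan_Suc fun_eq_iff)
      moreover have "RL (\<lambda>t. indicator ((\<Union>i<k. A i) \<inter> {-n..n}) t + indicator (A k \<inter> {-n..n}) t)"
        by (intro RL_add Suc union int) (use A in auto)
      ultimately show ?case by simp
    qed
    show ?case
    proof (rule RL_limit)
      show "integrable lborel (indicator ((\<Union>i. A i) \<inter> {-n..n}) :: real \<Rightarrow> real)"
        by (intro int) (use A in auto)
      show "integrable lborel (indicator ((\<Union>i<k. A i) \<inter> {-n..n}) :: real \<Rightarrow> real)" for k :: nat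
        by (intro int) (use A in auto)
      show "RL (indicator ((\<Union>i<k. A i) \<inter> {-n..n}))" for k :: nat by (rule fin)
      show "(\<lambda>k. indicator ((\<Union>i<k. A i) \<inter> {-n..n}) t) \<longlonglongrightarrow> (indicator ((\<Union>i. A i) \<inter> {-n..n}) t :: real)" for t
      proof (cases "t \<in> (\<Union>i. A i) \<inter> {-n..n}")
        case True
        then obtain i where "t \<in> A i" by auto
        then have "\<forall>\<^sub>F k in sequentially. indicator ((\<Union>i<k. A i) \<inter> {-n..n}) t = (1 :: real)"
          using True by (intro eventually_mono[OF eventually_gt_at_top[of i]]) (auto intro!: indicator_simps(1))
        then show ?thesis using True by (simp add: tendsto_eventually)
      next
        case False
        then have "(\<lambda>k. indicator ((\<Union>i<k. A i) \<inter> {-n..n}) t) = (\<lambda>k. 0 :: real)"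
          by (auto simp: indicator_def fun_eq_iff)
        then show ?thesis using False by simp
      qed
      show "\<bar>indicator ((\<Union>i<k. A i) \<inter> {-n..n}) t\<bar> \<le> 2 * \<bar>indicator ((\<Union>i. A i) \<inter> {-n..n}) t :: real\<bar>" for k :: nat and t
        by (auto simp: indicator_def)
    qed
  qed
qed

lemma riemann_lebesgue_cos:
  fixes f :: "real \<Rightarrow> real"
  assumes "integrable lborel f"
  shows "((\<lambda>y. LBINT t. f t * cos (y * t)) \<longlongrightarrow> 0) at_top"
  unfolding RL_def[symmetric] using assms
proof (induction f rule: integrable_induct)
  case (base A c)
  have A[measurable]: "A \<in> sets borel" using base by simp
  have int: "integrable lborel (indicator A :: real \<Rightarrow> real)" using base by (intro integrable_real_indicator)
  have "RL (indicator A)"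
  proof (rule RL_limit[OF int])
    show "RL (indicator (A \<inter> {- real k..real k}))" for k by (rule RL_bounded_set[OF A])
    show "integrable lborel (indicator (A \<inter> {- real k..real k}) :: real \<Rightarrow> real)" for k
      by (rule Bochner_Integration.integrable_bound[OF int]) (auto simp: indicator_def)
    show "(\<lambda>k. indicator (A \<inter> {- real k..real k}) t) \<longlonglongrightarrow> (indicator A t :: real)" for t
    proof -
      obtain N :: nat where N: "\<bar>t\<bar> \<le> real N" using real_arch_simple by blast
      have "\<forall>\<^sub>F k in sequentially. indicator (A \<inter> {- real k..real k}) t = (indicator A t :: real)"
        using eventually_ge_at_top[of N]
      proof eventually_elim
        case (elim k)
        then have "\<bar>t\<bar> \<le> real k" using N by linarith
        then have "t \<in> {- real k..real k}" by (simp add: abs_le_iff)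
        then show ?case by (simp add: indicator_def)
      qed
      then show ?thesis by (rule tendsto_eventually)
    qed
  qed (auto simp: indicator_def)
  from RL_mult[OF this, of c] show ?case by (simp add: mult.commute)
next
  case (add f g)
  then show ?case by (intro RL_add)
next
  case (lim f s)
  then show ?case by (intro RL_limit[of f s]) auto
qed

section \<open>The boundary measure\<close>

text \<open>The integrability hypothesis says nothing about the single value \<open>f 0\<close>.
  Fixing it makes \<open>f\<close> on an interval around 0 a pointwise limit of its restrictions
  away from 0.\<close>

locale boundary_bounded = boundary_L1 +
  fixes \<mu> M :: real
  assumes \<mu>: "\<mu> > 0" and f_0: "f 0 = 0"
    and L1_near: "\<forall>\<^sub>F \<sigma> in at_right 1. (LBINT t. indicator {-\<mu>..\<mu>} t * \<bar>Uh \<sigma> t\<bar>) \<le> M"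
begin

lemma L1_bounded: "\<exists>M'. \<forall>\<^sub>F \<sigma> in at_right 1. (LBINT t. indicator {-\<Lambda>..\<Lambda>} t * \<bar>Uh \<sigma> t\<bar>) \<le> M'"
proof -
  define L where "L = max \<Lambda> \<mu>"
  have L: "L \<ge> \<mu>" "L \<ge> \<Lambda>" by (auto simp: L_def)
  obtain M1 M2 where
    M1: "\<forall>\<^sub>F \<sigma> in at_right 1. (LBINT t. indicator {\<mu>..L} t * \<bar>Uh \<sigma> t\<bar>) \<le> M1" and
    M2: "\<forall>\<^sub>F \<sigma> in at_right 1. (LBINT t. indicator {-L..-\<mu>} t * \<bar>Uh \<sigma> t\<bar>) \<le> M2"
    using L1_bounded_away[of \<mu> L] L1_bounded_away[of "-L" "-\<mu>"] L \<mu> by auto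
  have "\<forall>\<^sub>F \<sigma> in at_right 1. (LBINT t. indicator {-\<Lambda>..\<Lambda>} t * \<bar>Uh \<sigma> t\<bar>) \<le> M + M1 + M2"
    using L1_near M1 M2 eventually_at_right_less
  proof eventually_elim
    case (elim \<sigma>)
    have "(LBINT t. indicator {-\<Lambda>..\<Lambda>} t * \<bar>Uh \<sigma> t\<bar>) \<le> (LBINT t. indicator {-\<mu>..\<mu>} t * \<bar>Uh \<sigma> t\<bar> +
       indicator {\<mu>..L} t * \<bar>Uh \<sigma> t\<bar> + indicator {-L..-\<mu>} t * \<bar>Uh \<sigma> t\<bar>)"
      using L elim(4)
      by (intro integral_mono Bochner_Integration.integrable_add integrable_abs_Uh)
        (auto simp: indicator_def)
    also have "\<dots> = (LBINT t. indicator {-\<mu>..\<mu>} t * \<bar>Uh \<sigma> t\<bar>) +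
       (LBINT t. indicator {\<mu>..L} t * \<bar>Uh \<sigma> t\<bar>) + (LBINT t. indicator {-L..-\<mu>} t * \<bar>Uh \<sigma> t\<bar>)"
      using integrable_abs_Uh[OF elim(4)] by simp
    finally show ?case using elim by linarith
  qed
  then show ?thesis by blast
qed

text \<open>Integrability across 0 is not assumed. Away from (-\<delta>, \<delta>) the L^1 norm of
  \<open>f\<close> is at most a bound for that of U(\<sigma> + it) on the full interval, plus errors
  that do not depend on \<delta>; Fatou's lemma removes \<delta>.\<close>

lemma integrable_f: "integrable lborel (\<lambda>t. indicator {-\<Lambda>..\<Lambda>} t * f t)" (is "integrable _ ?h")
proof (cases "\<Lambda> > 0")
  case False
  then have "t = 0" if "t \<in> {-\<Lambda>..\<Lambda>}" for t using that by (simp add: not_less)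
  then have "?h = (\<lambda>t. 0)" using f_0 by (auto simp: indicator_def fun_eq_iff)
  then show ?thesis by simp
next
  case \<Lambda>: True
  define \<delta> where "\<delta> n = \<Lambda> / real (Suc n)" for n
  have \<delta>: "\<delta> n > 0" "\<delta> n \<le> \<Lambda>" for n using \<Lambda> by (auto simp: \<delta>_def field_simps)
  define g where "g n t = indicator {\<delta> n..\<Lambda>} t * f t + indicator {-\<Lambda>..-\<delta> n} t * f t" for n t
  have gi: "integrable lborel (g n)" for n
    unfolding g_def using \<delta>[of n] by (intro Bochner_Integration.integrable_add f_int) auto
  have ev: "\<forall>\<^sub>F n in sequentially. g n t = ?h t" for t
  proof (cases "t = 0")
    case True
    then show ?thesis using \<delta> f_0 by (auto simp: g_def)
  next
    case False
    have "\<delta> \<longlonglongrightarrow> 0" unfolding \<delta>_def by real_asymp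
    then have "\<forall>\<^sub>F n in sequentially. \<delta> n < \<bar>t\<bar>" using False by (intro order_tendstoD(2)) auto
    then show ?thesis
    proof eventually_elim
      case (elim n)
      then show ?case using \<delta>[of n] by (auto simp: g_def indicator_def abs_if split: if_splits)
    qed
  qed
  have meas: "?h \<in> borel_measurable lborel"
    by (rule borel_measurable_LIMSEQ_metric[of g, OF borel_measurable_integrable[OF gi]])
      (intro tendsto_eventually ev)
  obtain M' where M': "\<forall>\<^sub>F \<sigma> in at_right 1. (LBINT t. indicator {-\<Lambda>..\<Lambda>} t * \<bar>Uh \<sigma> t\<bar>) \<le> M'"
    using L1_bounded by blast
  \<comment> \<open>Each of the two sides of 0 contributes an approximation error below 1. The value
    of \<sigma> that achieves this depends on n, but the bound does not.\<close>
  have gb: "(LBINT t. \<bar>g n t\<bar>) \<le> M' + 2" for n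
  proof -
    let ?I = "{\<delta> n..\<Lambda>}" and ?J = "{-\<Lambda>..-\<delta> n}"
    have IJ: "\<delta> n \<le> \<Lambda>" "-\<Lambda> \<le> -\<delta> n" "?I \<subseteq> - {0}" "?J \<subseteq> - {0}" using \<delta>[of n] by auto
    have "\<forall>\<^sub>F \<sigma> in at_right 1. (LBINT t. indicator ?I t * \<bar>Uh \<sigma> t - f t\<bar>) < 1"
      using boundary[OF IJ(1,3)] by (rule order_tendstoD) simp
    moreover have "\<forall>\<^sub>F \<sigma> in at_right 1. (LBINT t. indicator ?J t * \<bar>Uh \<sigma> t - f t\<bar>) < 1"
      using boundary[OF IJ(2,4)] by (rule order_tendstoD) simp
    ultimately have "\<forall>\<^sub>F \<sigma> in at_right (1::real). (LBINT t. \<bar>g n t\<bar>) \<le> M' + (2::real)"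
      using M' eventually_at_right_less
    proof eventually_elim
      case (elim \<sigma>)
      have "(LBINT t. \<bar>g n t\<bar>) \<le> (LBINT t. indicator ?I t * \<bar>Uh \<sigma> t - f t\<bar> +
          indicator ?J t * \<bar>Uh \<sigma> t - f t\<bar> + indicator {-\<Lambda>..\<Lambda>} t * \<bar>Uh \<sigma> t\<bar>)"
        using \<delta>[of n] elim(4) IJ
        by (intro integral_mono Bochner_Integration.integrable_add integrable_abs_Uh integrable_diff_Uh integrable_abs gi)
          (auto simp: indicator_def g_def)
      also have "\<dots> = (LBINT t. indicator ?I t * \<bar>Uh \<sigma> t - f t\<bar>) +
          (LBINT t. indicator ?J t * \<bar>Uh \<sigma> t - f t\<bar>) + (LBINT t. indicator {-\<Lambda>..\<Lambda>} t * \<bar>Uh \<sigma> t\<bar>)"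
        using integrable_abs_Uh[OF elim(4)] integrable_diff_Uh[OF elim(4) IJ(1,3)]
          integrable_diff_Uh[OF elim(4) IJ(2,4)] by simp
      finally show ?case using elim by linarith
    qed
    then show ?thesis by simp
  qed
  have "(\<integral>\<^sup>+t. ennreal \<bar>?h t\<bar> \<partial>lborel) = (\<integral>\<^sup>+t. liminf (\<lambda>n. ennreal \<bar>g n t\<bar>) \<partial>lborel)"
  proof (intro nn_integral_cong)
    fix t
    have "(\<lambda>n. ennreal \<bar>g n t\<bar>) \<longlonglongrightarrow> ennreal \<bar>?h t\<bar>"
      using ev[of t] by (intro tendsto_eventually) (auto elim: eventually_mono)
    then show "ennreal \<bar>?h t\<bar> = liminf (\<lambda>n. ennreal \<bar>g n t\<bar>)"
      by (rule lim_imp_Liminf[OF sequentially_bot, symmetric])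
  qed
  also have "\<dots> \<le> liminf (\<lambda>n. \<integral>\<^sup>+t. ennreal \<bar>g n t\<bar> \<partial>lborel)"
    using borel_measurable_integrable[OF gi] by (intro nn_integral_liminf) simp
  also have "\<dots> \<le> ennreal (M' + 2)"
  proof -
    have "(\<integral>\<^sup>+t. ennreal \<bar>g n t\<bar> \<partial>lborel) \<le> ennreal (M' + 2)" for n
      using gi[of n] gb[of n] by (subst nn_integral_eq_integral) (auto intro: ennreal_leI)
    then show ?thesis by (intro Liminf_le) auto
  qed
  also have "\<dots> < \<infinity>" by simp
  finally show ?thesis using meas by (simp add: integrable_iff_bounded)
qed

lemma integrable_abs_f: "integrable lborel (\<lambda>t. indicator {-\<Lambda>..\<Lambda>} t * \<bar>f t\<bar>)"
  using integrable_abs[OF integrable_f] by (simp add: abs_mult)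

lemma integrable_weight:
  assumes \<psi>[measurable]: "\<psi> \<in> borel_measurable borel" and B: "\<And>t. \<bar>\<psi> t\<bar> \<le> B"
  shows "\<sigma> > 1 \<Longrightarrow> integrable lborel (\<lambda>t. indicator {-\<Lambda>..\<Lambda>} t * (\<psi> t * Uh \<sigma> t))"
    and "integrable lborel (\<lambda>t. indicator {-\<Lambda>..\<Lambda>} t * (\<psi> t * f t))"
proof -
  have gen: "integrable lborel (\<lambda>t. indicator {-\<Lambda>..\<Lambda>} t * (\<psi> t * h t))"
    if h: "integrable lborel (\<lambda>t. indicator {-\<Lambda>..\<Lambda>} t * h t)" for h
  proof (rule Bochner_Integration.integrable_bound)
    show "integrable lborel (\<lambda>t. B * (indicator {-\<Lambda>..\<Lambda>} t * h t))" using h by simp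
    have "(\<lambda>t. \<psi> t * (indicator {-\<Lambda>..\<Lambda>} t * h t)) \<in> borel_measurable lborel"
      using borel_measurable_integrable[OF h] by measurable
    then show "(\<lambda>t. indicator {-\<Lambda>..\<Lambda>} t * (\<psi> t * h t)) \<in> borel_measurable lborel"
      by (simp add: mult.left_commute)
    have "\<bar>\<psi> t\<bar> \<le> \<bar>B\<bar>" for t using B[of t] by auto
    then show "AE t in lborel. norm (indicator {-\<Lambda>..\<Lambda>} t * (\<psi> t * h t)) \<le> norm (B * (indicator {-\<Lambda>..\<Lambda>} t * h t))"
      by (intro AE_I2) (auto simp: abs_mult indicator_def intro!: mult_right_mono)
  qed
  show "\<sigma> > 1 \<Longrightarrow> integrable lborel (\<lambda>t. indicator {-\<Lambda>..\<Lambda>} t * (\<psi> t * Uh \<sigma> t))"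
    using gen integrable_Uh[of \<sigma> "-\<Lambda>" \<Lambda> "\<lambda>_. 1"] by simp
  show "integrable lborel (\<lambda>t. indicator {-\<Lambda>..\<Lambda>} t * (\<psi> t * f t))"
    by (rule gen[OF integrable_f])
qed

text \<open>A possible mass at 0 is invisible to a test function vanishing there: near 0 it is small
  against uniformly bounded L^1 norms, and elsewhere L^1 convergence applies.\<close>

lemma boundary_limit_vanishing:
  assumes \<psi>[measurable]: "\<psi> \<in> borel_measurable borel" and B: "\<And>t. \<bar>\<psi> t\<bar> \<le> B"
    and cont: "isCont \<psi> 0" and zero: "\<psi> 0 = 0" and \<Lambda>: "\<Lambda> > 0"
  shows "((\<lambda>\<sigma>. LBINT t. indicator {-\<Lambda>..\<Lambda>} t * (\<psi> t * Uh \<sigma> t)) \<longlongrightarrow>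
    (LBINT t. indicator {-\<Lambda>..\<Lambda>} t * (\<psi> t * f t))) (at_right 1)"
proof (rule tendstoI)
  fix e :: real assume e: "e > 0"
  obtain M' where M': "\<forall>\<^sub>F \<sigma> in at_right 1. (LBINT t. indicator {-\<Lambda>..\<Lambda>} t * \<bar>Uh \<sigma> t\<bar>) \<le> M'"
    using L1_bounded by blast
  define N where "N = (LBINT t. indicator {-\<Lambda>..\<Lambda>} t * \<bar>f t\<bar>)"
  have N: "N \<ge> 0" unfolding N_def by (intro integral_nonneg_AE AE_I2) (auto simp: indicator_def)
  \<comment> \<open>The part near 0 then costs at most e/4, and each of the two outer intervals less
    than e/4.\<close>
  define \<eta> where "\<eta> = e / (4 * (\<bar>M'\<bar> + N + 1))"
  have \<eta>: "\<eta> > 0" using e N by (auto simp: \<eta>_def)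
  have \<eta>_le: "\<eta> * (\<bar>M'\<bar> + N) \<le> e / 4"
    using e N by (simp add: \<eta>_def field_simps)
  have B0: "B \<ge> 0" using B[of 0] by auto
  obtain d where d: "d > 0" "\<And>t. \<bar>t\<bar> < d \<Longrightarrow> \<bar>\<psi> t\<bar> < \<eta>"
    using cont \<eta> zero unfolding continuous_at_eps_delta by (auto simp: dist_real_def)
  define \<delta> where "\<delta> = min (d / 2) \<Lambda>"
  have \<delta>: "0 < \<delta>" "\<delta> \<le> \<Lambda>" "\<delta> < d" using d \<Lambda> by (auto simp: \<delta>_def)
  let ?I = "{\<delta>..\<Lambda>}" and ?J = "{-\<Lambda>..-\<delta>}"
  have IJ: "\<delta> \<le> \<Lambda>" "-\<Lambda> \<le> -\<delta>" "?I \<subseteq> - {0}" "?J \<subseteq> - {0}" using \<delta> by auto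
  have small: "\<forall>\<^sub>F \<sigma> in at_right 1. B * (LBINT t. indicator K t * \<bar>Uh \<sigma> t - f t\<bar>) < e / 4"
    if "((\<lambda>\<sigma>. LBINT t. indicator K t * \<bar>Uh \<sigma> t - f t\<bar>) \<longlongrightarrow> 0) (at_right 1)" for K
    using tendsto_mult_left[OF that, of B] e by (intro order_tendstoD(2)) auto
  show "\<forall>\<^sub>F \<sigma> in at_right 1. dist (LBINT t. indicator {-\<Lambda>..\<Lambda>} t * (\<psi> t * Uh \<sigma> t))
     (LBINT t. indicator {-\<Lambda>..\<Lambda>} t * (\<psi> t * f t)) < e"
    using small[OF boundary[OF IJ(1,3)]] small[OF boundary[OF IJ(2,4)]] M' eventually_at_right_less
  proof eventually_elim
    case (elim \<sigma>)
    let ?R = "\<lambda>t. \<eta> * (indicator {-\<Lambda>..\<Lambda>} t * \<bar>Uh \<sigma> t\<bar>) + \<eta> * (indicator {-\<Lambda>..\<Lambda>} t * \<bar>f t\<bar>) +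
       B * (indicator ?I t * \<bar>Uh \<sigma> t - f t\<bar>) + B * (indicator ?J t * \<bar>Uh \<sigma> t - f t\<bar>)"
    note iw = integrable_weight[OF \<psi> B]
    have pt: "\<bar>indicator {-\<Lambda>..\<Lambda>} t * (\<psi> t * Uh \<sigma> t) - indicator {-\<Lambda>..\<Lambda>} t * (\<psi> t * f t)\<bar> \<le> ?R t" for t
    proof (cases "t \<in> {-\<Lambda>..\<Lambda>}")
      case t: True
      have eq: "\<bar>indicator {-\<Lambda>..\<Lambda>} t * (\<psi> t * Uh \<sigma> t) - indicator {-\<Lambda>..\<Lambda>} t * (\<psi> t * f t)\<bar> = \<bar>\<psi> t\<bar> * \<bar>Uh \<sigma> t - f t\<bar>"
        using t by (simp add: abs_mult flip: right_diff_distrib)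
      have nn: "0 \<le> B * (indicator ?I t * \<bar>Uh \<sigma> t - f t\<bar>)" "0 \<le> B * (indicator ?J t * \<bar>Uh \<sigma> t - f t\<bar>)"
        "0 \<le> \<eta> * (indicator {-\<Lambda>..\<Lambda>} t * \<bar>Uh \<sigma> t\<bar>)" "0 \<le> \<eta> * (indicator {-\<Lambda>..\<Lambda>} t * \<bar>f t\<bar>)"
        using B0 \<eta> by auto
      show ?thesis
      proof (cases "\<bar>t\<bar> < d")
        case True
        have "\<bar>\<psi> t\<bar> * \<bar>Uh \<sigma> t - f t\<bar> \<le> \<eta> * (\<bar>Uh \<sigma> t\<bar> + \<bar>f t\<bar>)"
          using d(2)[OF True] \<eta> by (intro mult_mono) auto
        also have "\<dots> \<le> ?R t" using nn t by (simp add: distrib_left)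
        finally show ?thesis unfolding eq .
      next
        case False
        then have "t \<in> ?I \<or> t \<in> ?J" using \<delta> t by (auto simp: abs_if split: if_splits)
        moreover have "\<bar>\<psi> t\<bar> * \<bar>Uh \<sigma> t - f t\<bar> \<le> B * \<bar>Uh \<sigma> t - f t\<bar>"
          using B[of t] by (intro mult_right_mono) auto
        ultimately show ?thesis unfolding eq using nn by (auto simp: indicator_simps)
      qed
    qed (use \<delta> in auto)
    have "\<bar>(LBINT t. indicator {-\<Lambda>..\<Lambda>} t * (\<psi> t * Uh \<sigma> t)) - (LBINT t. indicator {-\<Lambda>..\<Lambda>} t * (\<psi> t * f t))\<bar>
      = \<bar>LBINT t. indicator {-\<Lambda>..\<Lambda>} t * (\<psi> t * Uh \<sigma> t) - indicator {-\<Lambda>..\<Lambda>} t * (\<psi> t * f t)\<bar>"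
      using iw(1)[OF elim(4)] iw(2) by simp
    also have "\<dots> \<le> (LBINT t. ?R t)"
    proof (rule Bochner_Integration.integral_abs_bound_integral)
      show "integrable lborel ?R"
        using elim(4) IJ integrable_abs_f
        by (intro Bochner_Integration.integrable_add integrable_mult_right integrable_abs_Uh integrable_diff_Uh) auto
    qed (use iw(1)[OF elim(4)] iw(2) pt in auto)
    also have "\<dots> = \<eta> * (LBINT t. indicator {-\<Lambda>..\<Lambda>} t * \<bar>Uh \<sigma> t\<bar>) + \<eta> * N +
       B * (LBINT t. indicator ?I t * \<bar>Uh \<sigma> t - f t\<bar>) + B * (LBINT t. indicator ?J t * \<bar>Uh \<sigma> t - f t\<bar>)"
      unfolding N_def using integrable_abs_f integrable_abs_Uh[OF elim(4)]
         integrable_diff_Uh[OF elim(4) IJ(1,3)] integrable_diff_Uh[OF elim(4) IJ(2,4)] by simp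
    also have "\<eta> * (LBINT t. indicator {-\<Lambda>..\<Lambda>} t * \<bar>Uh \<sigma> t\<bar>) \<le> \<eta> * \<bar>M'\<bar>"
      using elim(3) \<eta> by (intro mult_left_mono) auto
    finally show ?case
      using elim(1,2) \<eta>_le e by (simp add: dist_real_def distrib_left)
  qed
qed

text \<open>Only the total mass near 0 may oscillate, so it suffices to make one test integral converge,
  along a subsequence. The surplus c is the mass of the limit measure at 0.\<close>

lemma boundary_measure:
  obtains \<sigma> :: "nat \<Rightarrow> real" and c :: real where
    "\<And>n. 1 < \<sigma> n" "\<And>n. \<sigma> n \<le> 2" "\<sigma> \<longlonglongrightarrow> 1"
    "\<And>\<Lambda> \<psi> B. \<Lambda> > 0 \<Longrightarrow> \<psi> \<in> borel_measurable borel \<Longrightarrow> (\<And>t. \<bar>\<psi> t\<bar> \<le> B) \<Longrightarrow> isCont \<psi> 0 \<Longrightarrow>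
       (\<lambda>n. LBINT t. indicator {-\<Lambda>..\<Lambda>} t * (\<psi> t * Uh (\<sigma> n) t)) \<longlonglongrightarrow>
         (LBINT t. indicator {-\<Lambda>..\<Lambda>} t * (\<psi> t * f t)) + c * \<psi> 0"
proof -
  define I where "I \<sigma> = (LBINT t. indicator {-\<mu>..\<mu>} t * (1 * Uh \<sigma> t))" for \<sigma>
  obtain b where b: "b > 1" "\<And>\<sigma>. 1 < \<sigma> \<Longrightarrow> \<sigma> < b \<Longrightarrow> (LBINT t. indicator {-\<mu>..\<mu>} t * \<bar>Uh \<sigma> t\<bar>) \<le> M"
    using L1_near unfolding eventually_at_right_field by blast
  \<comment> \<open>Below b the L^1 bound near 0 holds; up to 2 the later bounds for window
    increments are uniform in \<sigma>.\<close>
  obtain m where m: "1 < m" "m \<le> b" "m \<le> 2" using b(1) by (intro that[of "min b 2"]) auto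
  define s where "s n = 1 + (m - 1) / real (n + 2)" for n
  have s1: "1 < s n" for n using m(1) by (simp add: s_def)
  have s2: "s n < m" for n
  proof -
    have "(m - 1) / real (n + 2) < (m - 1) / 1" using m(1) by (intro divide_strict_left_mono) auto
    then show ?thesis by (simp add: s_def)
  qed
  have slim: "s \<longlonglongrightarrow> 1" unfolding s_def by real_asymp
  have "\<bar>I (s n)\<bar> \<le> M" for n
  proof -
    have "\<bar>I (s n)\<bar> \<le> (LBINT t. \<bar>indicator {-\<mu>..\<mu>} t * (1 * Uh (s n) t)\<bar>)"
      unfolding I_def by (rule integral_abs_bound)
    also have "\<dots> \<le> M" using b(2)[OF s1] s2[of n] m(2) by (simp add: abs_mult)
    finally show ?thesis .
  qed
  then have "bounded (range (\<lambda>n. I (s n)))" by (intro boundedI[of _ M]) auto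
  from bounded_imp_convergent_subsequence[OF this] obtain l r
    where r: "strict_mono r" and l: "(\<lambda>n. I (s (r n))) \<longlonglongrightarrow> l" by (auto simp: o_def)
  define \<sigma> where "\<sigma> n = s (r n)" for n
  define c where "c = l - (LBINT t. indicator {-\<mu>..\<mu>} t * (1 * f t))"
  have \<sigma>1: "1 < \<sigma> n" for n unfolding \<sigma>_def by (rule s1)
  have \<sigma>lim: "\<sigma> \<longlonglongrightarrow> 1" using LIMSEQ_subseq_LIMSEQ[OF slim r] by (simp add: o_def \<sigma>_def[abs_def])
  then have \<sigma>at: "filterlim \<sigma> (at_right 1) sequentially"
    using \<sigma>1 less_imp_neq[OF \<sigma>1] by (auto simp: filterlim_at intro!: always_eventually)
  show ?thesis
  proof
    show "1 < \<sigma> n" "\<sigma> n \<le> 2" for n using \<sigma>1[of n] s2[of "r n"] m(3) by (auto simp: \<sigma>_def)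
    show "\<sigma> \<longlonglongrightarrow> 1" by fact
    fix \<Lambda> :: real and \<psi> :: "real \<Rightarrow> real" and B :: real
    assume \<Lambda>: "\<Lambda> > 0" and \<psi>[measurable]: "\<psi> \<in> borel_measurable borel" and B: "\<And>t. \<bar>\<psi> t\<bar> \<le> B" and cont: "isCont \<psi> 0"
    define L where "L = max \<Lambda> \<mu>"
    have L: "L \<ge> \<mu>" "L \<ge> \<Lambda>" "L > 0" using \<mu> by (auto simp: L_def)
    \<comment> \<open>Subtracting \<psi>(0) times the reference window produces a test function that
      vanishes at 0 and is continuous there. The reference integral was made convergent by the
      subsequence, so every other test integral converges as well.\<close>
    define g where "g t = indicator {-\<Lambda>..\<Lambda>} t * \<psi> t - \<psi> 0 * indicator {-\<mu>..\<mu>} t" for t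
    have [measurable]: "g \<in> borel_measurable borel" unfolding g_def by measurable
    have gB: "\<bar>g t\<bar> \<le> B + B" for t
      unfolding g_def using B[of t] B[of 0]
      by (intro order.trans[OF abs_triangle_ineq4] add_mono) (auto simp: indicator_def)
    have g0: "g 0 = 0" using \<Lambda> \<mu> by (simp add: g_def)
    have gc: "isCont g 0"
    proof -
      have "\<forall>\<^sub>F t in nhds 0. t \<in> {- min \<Lambda> \<mu><..<min \<Lambda> \<mu>}"
        using \<Lambda> \<mu> by (intro eventually_nhds_in_open) auto
      then have "\<forall>\<^sub>F t in nhds 0. g t = \<psi> t - \<psi> 0"
        by eventually_elim (auto simp: g_def)
      moreover have "isCont (\<lambda>t. \<psi> t - \<psi> 0) 0" using cont by (intro continuous_intros)
      ultimately show ?thesis by (simp add: isCont_cong)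
    qed
    have eq: "(LBINT t. indicator {-L..L} t * (g t * h t)) =
       (LBINT t. indicator {-\<Lambda>..\<Lambda>} t * (\<psi> t * h t)) - \<psi> 0 * (LBINT t. indicator {-\<mu>..\<mu>} t * (1 * h t))"
      if "integrable lborel (\<lambda>t. indicator {-\<Lambda>..\<Lambda>} t * (\<psi> t * h t))"
        "integrable lborel (\<lambda>t. indicator {-\<mu>..\<mu>} t * (1 * h t))" for h
    proof -
      have "(LBINT t. indicator {-L..L} t * (g t * h t)) =
        (LBINT t. indicator {-\<Lambda>..\<Lambda>} t * (\<psi> t * h t) - \<psi> 0 * (indicator {-\<mu>..\<mu>} t * (1 * h t)))"
        using L by (intro Bochner_Integration.integral_cong) (auto simp: g_def indicator_def algebra_simps)
      then show ?thesis using that by simp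
    qed
    note iw = integrable_weight[OF \<psi> B]
    note iw1 = integrable_weight[of "\<lambda>_. 1" 1, simplified]
    have "(\<lambda>n. LBINT t. indicator {-L..L} t * (g t * Uh (\<sigma> n) t)) \<longlonglongrightarrow> (LBINT t. indicator {-L..L} t * (g t * f t))"
      by (rule filterlim_compose[OF boundary_limit_vanishing[OF _ gB gc g0 L(3)] \<sigma>at]) simp
    moreover have "(\<lambda>n. \<psi> 0 * I (\<sigma> n)) \<longlonglongrightarrow> \<psi> 0 * l"
      using l unfolding \<sigma>_def by (intro tendsto_intros)
    ultimately have "(\<lambda>n. (LBINT t. indicator {-L..L} t * (g t * Uh (\<sigma> n) t)) + \<psi> 0 * I (\<sigma> n)) \<longlonglongrightarrow>
       (LBINT t. indicator {-L..L} t * (g t * f t)) + \<psi> 0 * l" by (rule tendsto_add)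
    moreover have "(LBINT t. indicator {-L..L} t * (g t * Uh (\<sigma> n) t)) + \<psi> 0 * I (\<sigma> n) =
      (LBINT t. indicator {-\<Lambda>..\<Lambda>} t * (\<psi> t * Uh (\<sigma> n) t))" for n
      using eq[of "Uh (\<sigma> n)"] iw(1)[OF \<sigma>1] iw1(1)[OF \<sigma>1] by (simp add: I_def)
    moreover have "(LBINT t. indicator {-L..L} t * (g t * f t)) + \<psi> 0 * l =
      (LBINT t. indicator {-\<Lambda>..\<Lambda>} t * (\<psi> t * f t)) + c * \<psi> 0"
      using eq[of f] iw(2) iw1(2) by (simp add: c_def algebra_simps)
    ultimately show "(\<lambda>n. LBINT t. indicator {-\<Lambda>..\<Lambda>} t * (\<psi> t * Uh (\<sigma> n) t)) \<longlonglongrightarrow>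
         (LBINT t. indicator {-\<Lambda>..\<Lambda>} t * (\<psi> t * f t)) + c * \<psi> 0" by simp
  qed
qed

end

section \<open>The Fejer kernel\<close>

lemma LBINT_FTC:
  fixes F f :: "real \<Rightarrow> real"
  assumes "a \<le> b" and F: "\<And>t. (F has_real_derivative f t) (at t)" and cont: "continuous_on {a..b} f"
  shows "(LBINT t. indicator {a..b} t * f t) = F b - F a"
proof -
  have "(F has_vector_derivative f t) (at t within {a..b})" for t
    using F[of t] by (simp add: has_real_derivative_iff_has_vector_derivative has_vector_derivative_at_within)
  from integral_FTC_Icc[OF assms(1) this cont] show ?thesis by simp
qed

text \<open>This equals (sin(x/2) / (x/2))^2, normalised to be the cosine transform of the tent
  \<open>tri\<close>; the value at 0 is the limit.\<close>

definition fejer :: "real \<Rightarrow> real" where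
  "fejer x = (if x = 0 then 1 else 2 * (1 - cos x) / x\<^sup>2)"

definition tri :: "real \<Rightarrow> real" where
  "tri t = max 0 (1 - \<bar>t\<bar>)"

lemma fejer_measurable[measurable]: "fejer \<in> borel_measurable borel"
  unfolding fejer_def[abs_def] by measurable

lemma tri_measurable[measurable]: "tri \<in> borel_measurable borel"
  unfolding tri_def[abs_def] by measurable

lemma fejer_nonneg: "fejer x \<ge> 0"
  by (simp add: fejer_def)

lemma tri_bounds: "0 \<le> tri t" "tri t \<le> 1"
  by (auto simp: tri_def)

lemma continuous_on_tri: "continuous_on A tri"
  unfolding tri_def[abs_def] by (intro continuous_intros)

lemma LBINT_tri_cos: "(LBINT t. indicator {-1..1} t * (tri t * cos (t * x))) = fejer x"
proof -
  \<comment> \<open>\<open>F\<close> and \<open>G\<close> are primitives of (1 - t) cos(tx) and (1 +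
    t) cos(tx), the integrands on the two sides of the peak of the tent.\<close>
  define F where "F t = (if x = 0 then t - t\<^sup>2 / 2 else (1 - t) * sin (t * x) / x - cos (t * x) / x\<^sup>2)" for t
  define G where "G t = (if x = 0 then t + t\<^sup>2 / 2 else (1 + t) * sin (t * x) / x + cos (t * x) / x\<^sup>2)" for t
  have F: "(F has_real_derivative (1 - t) * cos (t * x)) (at t)" for t
    unfolding F_def[abs_def]
    by (cases "x = 0") (auto intro!: derivative_eq_intros simp: power2_eq_square field_simps)
  have G: "(G has_real_derivative (1 + t) * cos (t * x)) (at t)" for t
    unfolding G_def[abs_def]
    by (cases "x = 0") (auto intro!: derivative_eq_intros simp: power2_eq_square field_simps)
  have 1: "(LBINT t. indicator {0..1} t * ((1 - t) * cos (t * x))) = F 1 - F 0"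
    by (rule LBINT_FTC[OF _ F]) (auto intro!: continuous_intros)
  have 2: "(LBINT t. indicator {-1..0} t * ((1 + t) * cos (t * x))) = G 0 - G (-1)"
    by (rule LBINT_FTC[OF _ G]) (auto intro!: continuous_intros)
  have i1: "integrable lborel (\<lambda>t. indicator {0..1} t * ((1 - t) * cos (t * x)))"
    by (intro integrable_continuous_Icc continuous_intros)
  have i2: "integrable lborel (\<lambda>t. indicator {-1..0} t * ((1 + t) * cos (t * x)))"
    by (intro integrable_continuous_Icc continuous_intros)
  have "(LBINT t. indicator {-1..1} t * (tri t * cos (t * x))) =
    (LBINT t. indicator {0..1} t * ((1 - t) * cos (t * x)) + indicator {-1..0} t * ((1 + t) * cos (t * x)))"
  proof (rule integral_cong_AE)
    show "AE t in lborel. indicator {-1..1} t * (tri t * cos (t * x)) =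
      indicator {0..1} t * ((1 - t) * cos (t * x)) + indicator {-1..0} t * ((1 + t) * cos (t * x))"
      using AE_lborel_singleton[of "0::real"]
      by eventually_elim (auto simp: indicator_def tri_def)
  qed measurable
  also have "\<dots> = (F 1 - F 0) + (G 0 - G (-1))" using i1 i2 1 2 by simp
  also have "\<dots> = fejer x" by (auto simp: F_def G_def fejer_def diff_divide_distrib add_divide_distrib)
  finally show ?thesis .
qed

lemma LBINT_tri: "(LBINT t. indicator {-1..1} t * tri t) = 1"
  using LBINT_tri_cos[of 0] by (simp add: fejer_def)

lemma integrable_tri: "integrable lborel (\<lambda>t. indicator {-1..1} t * tri t)"
  by (intro integrable_continuous_Icc continuous_on_tri)

lemma integrable_tri_cos: "integrable lborel (\<lambda>t. indicator {-1..1} t * (tri t * cos (t * x)))"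
  by (intro integrable_continuous_Icc continuous_on_mult continuous_on_tri continuous_intros)

lemma fejer_le_1: "fejer x \<le> 1"
proof -
  have "fejer x \<le> (LBINT t. indicator {-1..1} t * tri t)"
    unfolding LBINT_tri_cos[symmetric]
    by (intro integral_mono integrable_tri integrable_tri_cos)
      (auto simp: indicator_def tri_bounds mult_left_le)
  then show ?thesis by (simp add: LBINT_tri)
qed

lemma cos_lower: "cos y \<ge> 1 - y\<^sup>2 / 2" for y :: real
proof -
  have "\<bar>sin (y / 2)\<bar> \<le> \<bar>y / 2\<bar>" by (rule abs_sin_x_le_abs_x)
  then have "(sin (y / 2))\<^sup>2 \<le> (y / 2)\<^sup>2" by (simp only: abs_le_square_iff)
  moreover have "cos y = 1 - 2 * (sin (y / 2))\<^sup>2"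
    using cos_double_sin[of "y / 2"] by simp
  ultimately show ?thesis by (simp add: power_divide)
qed

text \<open>\<open>fejer x\<close> averages cos(tx) against the probability density
  \<open>tri\<close>, and for |tx| \<le> 1 the cosine is at least 1 - 1/2.\<close>

lemma fejer_ge_half: "fejer x \<ge> 1 / 2" if "\<bar>x\<bar> \<le> 1"
proof -
  have "1 / 2 = (LBINT t. indicator {-1..1} t * tri t * (1 / 2))"
    by (simp add: LBINT_tri)
  also have "\<dots> \<le> fejer x"
    unfolding LBINT_tri_cos[symmetric]
  proof (intro integral_mono integrable_tri_cos integrable_mult_left integrable_tri)
    fix t
    show "indicator {-1..1} t * tri t * (1 / 2) \<le> indicator {-1..1} t * (tri t * cos (t * x))"
    proof (cases "t \<in> {-1..1}")
      case True
      then have "\<bar>t * x\<bar> \<le> 1 * 1" unfolding abs_mult using that by (intro mult_mono) auto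
      then have "(t * x)\<^sup>2 \<le> 1" by (simp add: abs_square_le_1)
      then have "1 / 2 \<le> cos (t * x)" using cos_lower[of "t * x"] by simp
      then have "tri t * (1 / 2) \<le> tri t * cos (t * x)" by (intro mult_left_mono tri_bounds)
      then show ?thesis using True by simp
    qed simp
  qed
  finally show ?thesis .
qed

text \<open>The two elementary bounds 1 and 4 / x^2 cross at x^2 = 4; the constant 5 makes the
  majorant pass through that point.\<close>

lemma fejer_le_inverse: "fejer x \<le> 5 / (1 + x\<^sup>2)"
proof (cases "x\<^sup>2 \<le> 4")
  case True
  have "fejer x \<le> 1" by (rule fejer_le_1)
  also have "1 \<le> 5 / (1 + x\<^sup>2)" using True by (simp add: add_pos_nonneg)
  finally show ?thesis .
next
  case False
  then have x: "x \<noteq> 0" by auto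
  have "fejer x \<le> 4 / x\<^sup>2"
  proof -
    have "2 * (1 - c) \<le> 4" if "- 1 \<le> c" for c :: real using that by simp
    from this[OF cos_ge_minus_one] have "2 * (1 - cos x) \<le> 4" .
    then show ?thesis using x by (simp only: fejer_def if_False) (intro divide_right_mono, auto)
  qed
  also have "\<dots> \<le> 5 / (1 + x\<^sup>2)"
  proof -
    have "0 < x\<^sup>2" "0 < 1 + x\<^sup>2" "4 * (1 + x\<^sup>2) \<le> 5 * x\<^sup>2" using False by auto
    then show ?thesis by (simp add: divide_simps mult.commute)
  qed
  finally show ?thesis .
qed

lemma integrable_inverse_square: "integrable lborel (\<lambda>x::real. 1 / (1 + x\<^sup>2))"
proof (rule integrableI_bounded)
  have half: "(\<integral>\<^sup>+x. ennreal (1 / (1 + x\<^sup>2)) * indicator {0..} x \<partial>lborel) = ennreal (pi / 2 - arctan 0)"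
    by (rule nn_integral_FTC_atLeast)
      (auto intro!: derivative_eq_intros tendsto_arctan_at_top simp: inverse_eq_divide)
  have half': "(\<integral>\<^sup>+x. ennreal (1 / (1 + x\<^sup>2)) * indicator {..0} x \<partial>lborel) =
     (\<integral>\<^sup>+x. ennreal (1 / (1 + x\<^sup>2)) * indicator {0..} x \<partial>lborel)"
    by (subst nn_integral_real_affine[where c="-1" and t=0])
      (auto intro!: nn_integral_cong simp: indicator_def)
  have "(\<integral>\<^sup>+x. ennreal (norm (1 / (1 + x\<^sup>2) :: real)) \<partial>lborel) \<le>
    (\<integral>\<^sup>+x. ennreal (1 / (1 + x\<^sup>2)) * indicator {0..} x + ennreal (1 / (1 + x\<^sup>2)) * indicator {..0::real} x \<partial>lborel)"
    by (intro nn_integral_mono) (auto simp: indicator_def)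
  also have "\<dots> = ennreal (pi / 2) + ennreal (pi / 2)"
    using half half' by (subst nn_integral_add) auto
  also have "\<dots> < \<infinity>" by simp
  finally show "(\<integral>\<^sup>+x. ennreal (norm (1 / (1 + x\<^sup>2) :: real)) \<partial>lborel) < \<infinity>" .
qed simp

lemma integrable_fejer: "integrable lborel fejer"
proof (rule Bochner_Integration.integrable_bound[OF integrable_mult_right[OF integrable_inverse_square, of 5]])
  show "AE x in lborel. norm (fejer x) \<le> norm (5 * (1 / (1 + x\<^sup>2)))"
    using fejer_le_inverse fejer_nonneg by (intro AE_I2) (simp add: add_pos_nonneg)
qed simp

text \<open>The value 2 pi is not needed: the limit is identified by an Abelian argument.\<close>

definition fejer_mass :: real where "fejer_mass = (LBINT x. fejer x)"

lemma fejer_mass_pos: "fejer_mass > 0"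
proof -
  have "1 / 2 = (LBINT x. indicator {-1..1} x * tri x * (1 / 2))" by (simp add: LBINT_tri)
  also have "\<dots> \<le> fejer_mass"
    unfolding fejer_mass_def
  proof (intro integral_mono integrable_fejer integrable_mult_left integrable_tri)
    fix x
    show "indicator {-1..1} x * tri x * (1 / 2) \<le> fejer x"
      using fejer_ge_half[of x] fejer_nonneg[of x] tri_bounds(2)[of x] by (auto simp: indicator_def abs_le_iff)
  qed
  finally show ?thesis by simp
qed

text \<open>Dilation keeps the mass \<open>fejer_mass\<close> while concentrating it at 0 as l
  grows. On the transform side it stretches the tent to [-l, l], so any fixed l involves only a
  bounded part of the boundary.\<close>

definition fej :: "real \<Rightarrow> real \<Rightarrow> real" where
  "fej l x = l * fejer (l * x)"

lemma fej_measurable[measurable]: "fej l \<in> borel_measurable borel"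
  unfolding fej_def[abs_def] by measurable

context
  fixes l :: real
  assumes l: "l > 0"
begin

lemma fej_nonneg: "fej l x \<ge> 0"
  using l by (simp add: fej_def fejer_nonneg)

lemma fej_le: "fej l x \<le> l"
  using l fejer_le_1[of "l * x"] by (simp add: fej_def mult_left_le)

lemma integrable_fej: "integrable lborel (fej l)"
  unfolding fej_def[abs_def]
  using lborel_integrable_real_affine[OF integrable_fejer, of l 0] l by simp

lemma integral_fej: "(LBINT x. fej l x) = fejer_mass"
  unfolding fej_def fejer_mass_def
  using lborel_integral_real_affine[of l fejer 0] l by simp

lemma integrable_fej_shift: "integrable lborel (\<lambda>x. fej l (x - y))" "integrable lborel (\<lambda>x. fej l (x + y))"
  using lborel_integrable_real_affine[OF integrable_fej, of 1 "-y"]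
    lborel_integrable_real_affine[OF integrable_fej, of 1 "y"] by (simp_all add: add.commute)

lemma integral_fej_shift: "(LBINT x. fej l (x - y)) = fejer_mass" "(LBINT x. fej l (x + y)) = fejer_mass"
  using lborel_integral_real_affine[of 1 "fej l" "-y"] lborel_integral_real_affine[of 1 "fej l" "y"]
  by (simp_all add: add.commute integral_fej)

lemma LBINT_tri_cos_scaled: "(LBINT t. indicator {-l..l} t * (tri (t / l) * cos (t * x))) = fej l x"
proof -
  have "(LBINT t. indicator {-l..l} t * (tri (t / l) * cos (t * x))) =
     l * (LBINT u. indicator {-l..l} (l * u) * (tri (l * u / l) * cos (l * u * x)))"
    using lborel_integral_real_affine[of l "\<lambda>t. indicator {-l..l} t * (tri (t / l) * cos (t * x))" 0] l by simp
  also have "(LBINT u. indicator {-l..l} (l * u) * (tri (l * u / l) * cos (l * u * x))) =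
     (LBINT u. indicator {-1..1} u * (tri u * cos (u * (l * x))))"
  proof (intro Bochner_Integration.integral_cong refl)
    fix u
    have "l * u \<in> {-l..l} \<longleftrightarrow> u \<in> {-1..1}"
      using l mult_le_cancel_left_pos[of l "-1" u] mult_le_cancel_left_pos[of l u 1] by simp
    then show "indicator {-l..l} (l * u) * (tri (l * u / l) * cos (l * u * x)) =
      indicator {-1..1} u * (tri u * cos (u * (l * x)))"
      using l by (simp add: indicator_def mult_ac)
  qed
  also have "l * \<dots> = fej l x" by (simp add: LBINT_tri_cos fej_def)
  finally show ?thesis .
qed

lemma fej_lower: "fej l x \<ge> l / 2" if "\<bar>x\<bar> \<le> 1 / l"
proof -
  have "\<bar>l * x\<bar> \<le> 1" using that l by (simp add: abs_mult field_simps)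
  then show ?thesis using fejer_ge_half[of "l * x"] l by (simp add: fej_def)
qed

end

text \<open>Rescaling turns this into the tail of the fixed integrable function \<open>fejer\<close>
  beyond l r.\<close>

lemma fej_tail:
  assumes r: "r > 0"
  shows "((\<lambda>l. LBINT x. indicator (- {-r..r}) x * fej l x) \<longlongrightarrow> 0) at_top"
proof -
  have "((\<lambda>l. LBINT u. indicator (- {- (l * r)..l * r}) u * fejer u) \<longlongrightarrow> (\<integral>u. 0 \<partial>(lborel :: real measure))) at_top"
  proof (rule integral_dominated_convergence_at_top)
    show "integrable lborel fejer" by (rule integrable_fejer)
    show "\<forall>\<^sub>F l in at_top. AE u in lborel. norm (indicator (- {- (l * r)..l * r}) u * fejer u) \<le> fejer u"
      using fejer_nonneg by (intro always_eventually allI AE_I2) (auto simp: indicator_def)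
    have "((\<lambda>l. indicator (- {- (l * r)..l * r}) u * fejer u) \<longlongrightarrow> 0) at_top" for u
    proof (rule tendsto_eventually)
      show "\<forall>\<^sub>F l in at_top. indicator (- {- (l * r)..l * r}) u * fejer u = 0"
        using eventually_ge_at_top[of "\<bar>u\<bar> / r"]
      proof eventually_elim
        case (elim l)
        then have "\<bar>u\<bar> \<le> l * r" using r by (simp add: field_simps)
        then show ?case by (auto simp: indicator_def abs_le_iff)
      qed
    qed
    then show "AE u in lborel. ((\<lambda>l. indicator (- {- (l * r)..l * r}) u * fejer u) \<longlongrightarrow> 0) at_top" by (intro AE_I2)
  qed auto
  moreover have "\<forall>\<^sub>F l in at_top. (LBINT u. indicator (- {- (l * r)..l * r}) u * fejer u) =
     (LBINT x. indicator (- {-r..r}) x * fej l x)"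
    using eventually_gt_at_top[of 0]
  proof eventually_elim
    case (elim l)
    have "(LBINT u. indicator (- {- (l * r)..l * r}) u * fejer u) =
      l * (LBINT x. indicator (- {- (l * r)..l * r}) (l * x) * fejer (l * x))"
      using lborel_integral_real_affine[of l "\<lambda>u. indicator (- {- (l * r)..l * r}) u * fejer u" 0] elim by simp
    also have "\<dots> = (LBINT x. l * (indicator (- {- (l * r)..l * r}) (l * x) * fejer (l * x)))" by simp
    also have "\<dots> = (LBINT x. indicator (- {-r..r}) x * fej l x)"
    proof (intro Bochner_Integration.integral_cong refl)
      fix x
      have "l * x \<in> {- (l * r)..l * r} \<longleftrightarrow> x \<in> {-r..r}"
        using elim mult_le_cancel_left_pos[of l "-r" x] mult_le_cancel_left_pos[of l x r] by simp
      then show "l * (indicator (- {- (l * r)..l * r}) (l * x) * fejer (l * x)) = indicator (- {-r..r}) x * fej l x"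
        by (simp add: indicator_def fej_def)
    qed
    finally show ?case .
  qed
  ultimately show ?thesis by (simp add: Lim_transform_eventually)
qed

text \<open>The Fourier transform of the indicator of [-r, r]. Its value 2 r at t = 0 is the weight
  with which the point mass of the boundary measure is seen.\<close>

definition window_mult :: "real \<Rightarrow> real \<Rightarrow> real" where
  "window_mult r t = (if t = 0 then 2 * r else 2 * sin (r * t) / t)"

lemma window_mult_measurable[measurable]: "window_mult r \<in> borel_measurable borel"
  unfolding window_mult_def[abs_def] by measurable

lemma LBINT_window_cos:
  assumes r: "r > 0"
  shows "(LBINT v. indicator {w - r..w + r} v * cos (t * v)) = window_mult r t * cos (t * w)"
proof -
  define F where "F v = (if t = 0 then v else sin (t * v) / t)" for v
  have F: "(F has_real_derivative cos (t * v)) (at v)" for v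
    unfolding F_def[abs_def] by (cases "t = 0") (auto intro!: derivative_eq_intros)
  have "(LBINT v. indicator {w - r..w + r} v * cos (t * v)) = F (w + r) - F (w - r)"
    by (rule LBINT_FTC[OF _ F]) (use r in \<open>auto intro!: continuous_intros\<close>)
  also have "\<dots> = window_mult r t * cos (t * w)"
    by (auto simp: F_def window_mult_def distrib_left right_diff_distrib sin_add sin_diff mult.commute[of r] diff_divide_distrib[symmetric])
  finally show ?thesis by simp
qed

lemma window_mult_sin: "t * window_mult r t * sin (t * w) = cos (t * (w - r)) - cos (t * (w + r))"
  by (auto simp: window_mult_def distrib_left right_diff_distrib cos_add cos_diff mult.commute[of r])

lemma window_mult_abs_le: "r > 0 \<Longrightarrow> \<bar>window_mult r t\<bar> \<le> 2 * r"
  using abs_sin_x_le_abs_x[of "r * t"]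
  by (auto simp: window_mult_def abs_mult field_simps)

lemma isCont_window_mult: "isCont (window_mult r) 0"
proof -
  have "((\<lambda>t. sin (r * t)) has_real_derivative r) (at 0)"
    by (auto intro!: derivative_eq_intros)
  then have "((\<lambda>t. sin (r * t) / t) \<longlongrightarrow> r) (at 0)"
    by (simp add: has_field_derivative_iff)
  then have "((\<lambda>t. 2 * (sin (r * t) / t)) \<longlongrightarrow> 2 * r) (at 0)"
    by (rule tendsto_mult_left)
  then have "(window_mult r \<longlongrightarrow> 2 * r) (at 0)"
    by (rule Lim_transform_eventually) (auto simp: window_mult_def eventually_at_filter intro!: always_eventually)
  then show ?thesis by (simp add: isCont_def window_mult_def)
qed

section \<open>The Fejer identity for window increments\<close>

text \<open>Pairing with cos(ty) cos(tv), as a purely real test function requires, produces the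
  kernel at v - y together with its mirror image at v + y. The mirror image is harmless: for large y
  it is centred far to the left, where the increments vanish.\<close>

definition sym_fej :: "real \<Rightarrow> real \<Rightarrow> real \<Rightarrow> real" where
  "sym_fej l y v = (fej l (v - y) + fej l (v + y)) / 2"

lemma sym_fej_measurable[measurable]: "sym_fej l y \<in> borel_measurable borel"
  unfolding sym_fej_def[abs_def] by measurable

lemma sym_fej_nonneg: "l > 0 \<Longrightarrow> sym_fej l y v \<ge> 0"
  by (simp add: sym_fej_def fej_nonneg)

lemma integrable_sym_fej: "l > 0 \<Longrightarrow> integrable lborel (sym_fej l y)"
  unfolding sym_fej_def[abs_def] by (simp add: integrable_fej_shift)

lemma integral_sym_fej: "l > 0 \<Longrightarrow> (LBINT v. sym_fej l y v) = fejer_mass"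
  unfolding sym_fej_def by (simp add: integrable_fej_shift integral_fej_shift)

lemma LBINT_tri_cos_cos:
  assumes l: "l > 0"
  shows "(LBINT t. indicator {-l..l} t * tri (t / l) * (cos (t * y) * cos (t * v))) = sym_fej l y v"
proof -
  have int: "integrable lborel (\<lambda>t. indicator {-l..l} t * (tri (t / l) * cos (t * x)))" for x
    by (intro integrable_continuous_Icc continuous_on_mult continuous_on_compose2[OF continuous_on_tri[of UNIV]] continuous_intros)
      (use l in auto)
  have "(LBINT t. indicator {-l..l} t * tri (t / l) * (cos (t * y) * cos (t * v))) =
    (LBINT t. (indicator {-l..l} t * (tri (t / l) * cos (t * (v - y))) + indicator {-l..l} t * (tri (t / l) * cos (t * (v + y)))) / 2)"
    by (intro Bochner_Integration.integral_cong refl) (simp add: cos_add cos_diff algebra_simps)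
  also have "\<dots> = sym_fej l y v"
    unfolding sym_fej_def using int l by (simp add: LBINT_tri_cos_scaled)
  finally show ?thesis .
qed

lemma integrable_mult_bounded:
  fixes g h :: "real \<Rightarrow> real"
  assumes g: "integrable lborel g" and [measurable]: "h \<in> borel_measurable borel" and B: "\<And>x. \<bar>h x\<bar> \<le> B"
  shows "integrable lborel (\<lambda>x. g x * h x)"
proof (rule Bochner_Integration.integrable_bound[OF integrable_mult_left[OF g, of B]])
  show "(\<lambda>x. g x * h x) \<in> borel_measurable lborel"
    using borel_measurable_integrable[OF g] by measurable
  have "\<bar>h x\<bar> \<le> \<bar>B\<bar>" for x using B[of x] by auto
  then show "AE x in lborel. norm (g x * h x) \<le> norm (g x * B)"
    by (intro AE_I2) (auto simp: abs_mult intro: mult_left_mono)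
qed

lemma fejer_test_bound:
  assumes r: "r > 0"
  shows "\<bar>tri (t / l) * cos (t * y) * window_mult r t\<bar> \<le> 2 * r"
proof -
  have "\<bar>tri (t / l)\<bar> * \<bar>cos (t * y)\<bar> \<le> 1 * 1" using tri_bounds[of "t / l"] by (intro mult_mono) auto
  then have "\<bar>tri (t / l)\<bar> * \<bar>cos (t * y)\<bar> * \<bar>window_mult r t\<bar> \<le> 1 * (2 * r)"
    using window_mult_abs_le[OF r, of t] by (intro mult_mono) auto
  then show ?thesis by (simp add: abs_mult)
qed

lemma fejer_test_measurable: "(\<lambda>t. tri (t / l) * cos (t * y) * window_mult r t) \<in> borel_measurable borel"
  by measurable

context exp_order_one
begin

text \<open>By parts, Dw r \<sigma> x is the increment of \<integral> e^(-\<sigma>w) dS(w) over the window (x - r, x + r].\<close>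

definition Tw :: "real \<Rightarrow> real \<Rightarrow> real" where
  "Tw \<sigma> x = exp (- \<sigma> * x) * E x"

definition Zw :: "real \<Rightarrow> real \<Rightarrow> real \<Rightarrow> real" where
  "Zw r \<sigma> x = (LBINT w. indicator {x - r..x + r} w * Tw \<sigma> w)"

definition Dw :: "real \<Rightarrow> real \<Rightarrow> real \<Rightarrow> real" where
  "Dw r \<sigma> x = Tw \<sigma> (x + r) - Tw \<sigma> (x - r) + \<sigma> * Zw r \<sigma> x"

lemma Tw_measurable[measurable]: "Tw \<sigma> \<in> borel_measurable borel"
  unfolding Tw_def[abs_def] by measurable

lemma Zw_measurable[measurable]: "Zw r \<sigma> \<in> borel_measurable borel"
  unfolding Zw_def[abs_def] by (intro measurable_moving_integral) auto

lemma Dw_measurable[measurable]: "Dw r \<sigma> \<in> borel_measurable borel"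
  unfolding Dw_def[abs_def] by measurable

lemma integrable_Tw: "\<sigma> > 1 \<Longrightarrow> integrable lborel (Tw \<sigma>)"
  using integrable_moment[of \<sigma> 0] by (simp add: Tw_def[abs_def])

lemma integrable_Tw_shift: "\<sigma> > 1 \<Longrightarrow> integrable lborel (\<lambda>x. Tw \<sigma> (x + c))"
  using lborel_integrable_real_affine[OF integrable_Tw, of \<sigma> 1 c] by (simp add: add.commute)

lemma Zw_cos:
  assumes \<sigma>: "\<sigma> > 1" and r: "r > 0"
  shows "integrable lborel (\<lambda>v. Zw r \<sigma> v * cos (t * v))"
    and "(LBINT v. Zw r \<sigma> v * cos (t * v)) = (LBINT x. Tw \<sigma> x * (window_mult r t * cos (t * x)))"
proof -
  let ?h = "indicator {-r..r} :: real \<Rightarrow> real" and ?K = "\<lambda>(x::real, y). cos (t * y)"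
  have h: "integrable lborel ?h" by (intro integrable_real_indicator) (auto simp: emeasure_lborel_Icc_eq)
  have K: "?K \<in> borel_measurable (borel \<Otimes>\<^sub>M borel)" by measurable
  have K1: "\<bar>?K z\<bar> \<le> 1" for z by (auto split: prod.splits)
  note fub = fubini_conv[OF integrable_Tw[OF \<sigma>] h K K1]
  have inner: "(LBINT x. Tw \<sigma> x * ?h (y - x) * cos (t * y)) = Zw r \<sigma> y * cos (t * y)" for y
  proof -
    have "(LBINT x. Tw \<sigma> x * ?h (y - x) * cos (t * y)) = (LBINT x. (indicator {y - r..y + r} x * Tw \<sigma> x) * cos (t * y))"
      by (intro Bochner_Integration.integral_cong refl) (auto simp: indicator_def)
    then show ?thesis by (simp add: Zw_def)
  qed
  have outer: "(LBINT y. ?h (y - x) * cos (t * y)) = window_mult r t * cos (t * x)" for x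
    unfolding LBINT_window_cos[OF r, symmetric]
    by (intro Bochner_Integration.integral_cong refl) (auto simp: indicator_def)
  show "integrable lborel (\<lambda>v. Zw r \<sigma> v * cos (t * v))"
    using fub(2) unfolding prod.case inner .
  show "(LBINT v. Zw r \<sigma> v * cos (t * v)) = (LBINT x. Tw \<sigma> x * (window_mult r t * cos (t * x)))"
    using fub(1) unfolding prod.case inner outer by (rule sym)
qed

lemma integrable_Dw: "\<sigma> > 1 \<Longrightarrow> r > 0 \<Longrightarrow> integrable lborel (Dw r \<sigma>)"
  using Zw_cos(1)[of \<sigma> r 0] integrable_Tw_shift[of \<sigma> r] integrable_Tw_shift[of \<sigma> "-r"]
  unfolding Dw_def[abs_def] by simp

text \<open>The centred window keeps the multiplier real and even in t, so that the identity involves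
  only the real part of the transform.\<close>

lemma Dw_cos:
  assumes \<sigma>: "\<sigma> > 1" and r: "r > 0"
  shows "(LBINT v. Dw r \<sigma> v * cos (t * v)) = window_mult r t * Uh \<sigma> t"
proof -
  note Z = Zw_cos[OF \<sigma> r, of t]
  have ib: "integrable lborel (\<lambda>v. Tw \<sigma> (v + c) * cos (t * (v + d)))" for c d
    by (rule integrable_mult_bounded[OF integrable_Tw_shift[OF \<sigma>], where B=1]) auto
  have ib0: "integrable lborel (\<lambda>v. Tw \<sigma> v * h v)" if "h \<in> borel_measurable borel" "\<And>x. \<bar>h x\<bar> \<le> B" for h B
    by (rule integrable_mult_bounded[OF integrable_Tw[OF \<sigma>] that])
  have shift: "(LBINT v. Tw \<sigma> (v + c) * cos (t * v)) = (LBINT x. Tw \<sigma> x * cos (t * (x - c)))" for c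
    using lborel_integral_real_affine[of 1 "\<lambda>x. Tw \<sigma> x * cos (t * (x - c))" c] by (simp add: add.commute)
  have "(LBINT v. Dw r \<sigma> v * cos (t * v)) =
    (LBINT v. Tw \<sigma> (v + r) * cos (t * v) - Tw \<sigma> (v + (-r)) * cos (t * v) + \<sigma> * (Zw r \<sigma> v * cos (t * v)))"
    by (intro Bochner_Integration.integral_cong refl) (simp add: Dw_def algebra_simps)
  also have "\<dots> = (LBINT v. Tw \<sigma> (v + r) * cos (t * v)) - (LBINT v. Tw \<sigma> (v + (-r)) * cos (t * v)) +
      \<sigma> * (LBINT v. Zw r \<sigma> v * cos (t * v))"
    using ib[of r 0] ib[of "-r" 0] Z(1) by simp
  also have "\<dots> = (LBINT x. Tw \<sigma> x * cos (t * (x - r))) - (LBINT x. Tw \<sigma> x * cos (t * (x + r))) +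
      \<sigma> * (LBINT x. Tw \<sigma> x * (window_mult r t * cos (t * x)))"
    unfolding shift Z(2) by simp
  also have "\<dots> = (LBINT x. Tw \<sigma> x * cos (t * (x - r)) - Tw \<sigma> x * cos (t * (x + r)) +
      \<sigma> * (Tw \<sigma> x * (window_mult r t * cos (t * x))))"
  proof -
    have 1: "integrable lborel (\<lambda>x. Tw \<sigma> x * cos (t * (x - r)))" "integrable lborel (\<lambda>x. Tw \<sigma> x * cos (t * (x + r)))"
      by (rule ib0[where B=1]; simp)+
    have 2: "integrable lborel (\<lambda>x. Tw \<sigma> x * (window_mult r t * cos (t * x)))"
    proof (rule ib0[where B="2 * r"])
      fix x
      have "\<bar>window_mult r t\<bar> * \<bar>cos (t * x)\<bar> \<le> (2 * r) * 1"
        using window_mult_abs_le[OF r] r by (intro mult_mono) auto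
      then show "\<bar>window_mult r t * cos (t * x)\<bar> \<le> 2 * r" by (simp add: abs_mult)
    qed simp
    show ?thesis using 1 2 by simp
  qed
  \<comment> \<open>The two shifted copies of \<open>Tw\<close> combine into the sine term of
    \<open>Uh\<close>, and the moving integral supplies the cosine term; both carry the same
    multiplier.\<close>
  also have "\<dots> = (LBINT x. window_mult r t * (exp (- \<sigma> * x) * E x * (\<sigma> * cos (t * x) + t * sin (t * x))))"
  proof (intro Bochner_Integration.integral_cong refl)
    fix x
    have "Tw \<sigma> x * cos (t * (x - r)) - Tw \<sigma> x * cos (t * (x + r)) + \<sigma> * (Tw \<sigma> x * (window_mult r t * cos (t * x)))
      = Tw \<sigma> x * (t * window_mult r t * sin (t * x)) + \<sigma> * (Tw \<sigma> x * (window_mult r t * cos (t * x)))"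
      unfolding window_mult_sin by (simp add: right_diff_distrib)
    then show "Tw \<sigma> x * cos (t * (x - r)) - Tw \<sigma> x * cos (t * (x + r)) + \<sigma> * (Tw \<sigma> x * (window_mult r t * cos (t * x)))
      = window_mult r t * (exp (- \<sigma> * x) * E x * (\<sigma> * cos (t * x) + t * sin (t * x)))"
      by (simp add: Tw_def algebra_simps)
  qed
  also have "\<dots> = window_mult r t * Uh \<sigma> t" by (simp add: Uh_def)
  finally show ?thesis .
qed

text \<open>The left side depends only on U over [-l, l] and has a limit along the boundary
  sequence; the right side is a Fejer mean of the increments around y. Facts about the boundary are
  carried to S through this equality.\<close>

lemma fejer_identity:
  assumes \<sigma>: "\<sigma> > 1" and r: "r > 0" and l: "l > 0"
  shows "(LBINT t. indicator {-l..l} t * (tri (t / l) * cos (t * y) * window_mult r t * Uh \<sigma> t)) =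
    (LBINT v. Dw r \<sigma> v * sym_fej l y v)"
proof -
  let ?f = "\<lambda>t. indicator {-l..l} t * tri (t / l)" and ?K = "\<lambda>(t, v). cos (t * y) * cos (t * v) :: real"
  have f: "integrable lborel ?f"
    by (intro integrable_continuous_Icc continuous_on_compose2[OF continuous_on_tri[of UNIV]] continuous_intros)
      (use l in auto)
  have K: "?K \<in> borel_measurable (borel \<Otimes>\<^sub>M borel)" by measurable
  have K1: "\<bar>?K z\<bar> \<le> 1" for z
  proof (cases z)
    case (Pair t v)
    have "\<bar>cos (t * y)\<bar> * \<bar>cos (t * v)\<bar> \<le> 1 * 1" by (intro mult_mono) auto
    then show ?thesis using Pair by (simp add: abs_mult)
  qed
  have "(LBINT t. indicator {-l..l} t * (tri (t / l) * cos (t * y) * window_mult r t * Uh \<sigma> t)) =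
     (LBINT t. ?f t * (LBINT v. Dw r \<sigma> v * ?K (t, v)))"
  proof (intro Bochner_Integration.integral_cong refl)
    fix t
    have "(LBINT v. Dw r \<sigma> v * ?K (t, v)) = cos (t * y) * (LBINT v. Dw r \<sigma> v * cos (t * v))"
      unfolding integral_mult_right_zero[symmetric]
      by (intro Bochner_Integration.integral_cong refl) simp
    then show "indicator {-l..l} t * (tri (t / l) * cos (t * y) * window_mult r t * Uh \<sigma> t) =
      ?f t * (LBINT v. Dw r \<sigma> v * ?K (t, v))"
      unfolding Dw_cos[OF \<sigma> r] by simp
  qed
  also have "\<dots> = (LBINT v. Dw r \<sigma> v * (LBINT t. ?f t * ?K (t, v)))"
    by (rule fubini_kernel(1)[OF f integrable_Dw[OF \<sigma> r] K K1])
  also have "\<dots> = (LBINT v. Dw r \<sigma> v * sym_fej l y v)"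
    using LBINT_tri_cos_cos[OF l] by simp
  finally show ?thesis .
qed

end

section \<open>Local bounds uniform in \<sigma>, and the primitive relation between moving integral
  and increments\<close>

lemma integrable_Icc_bounded:
  fixes h :: "real \<Rightarrow> real"
  assumes [measurable]: "h \<in> borel_measurable borel" and B: "\<And>t. a \<le> t \<Longrightarrow> t \<le> b \<Longrightarrow> \<bar>h t\<bar> \<le> B"
  shows "integrable lborel (\<lambda>t. indicator {a..b} t * h t)"
proof -
  have "integrable lborel (\<lambda>t. indicator {a..b} t *\<^sub>R h t)"
  proof (rule integrableI_bounded_set_indicator[where B=B])
    show "AE t in lborel. t \<in> {a..b} \<longrightarrow> norm (h t) \<le> B" using B by (intro AE_I2) auto
  qed (auto simp: emeasure_lborel_Icc_eq)
  then show ?thesis by simp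
qed

lemma LBINT_exp_minus:
  fixes a b \<sigma> :: real
  assumes "a \<le> b" "\<sigma> > 0"
  shows "(LBINT w. indicator {a..b} w * exp (- \<sigma> * w)) = (exp (- \<sigma> * a) - exp (- \<sigma> * b)) / \<sigma>"
proof -
  have "(LBINT w. indicator {a..b} w * exp (- \<sigma> * w)) = - exp (- \<sigma> * b) / \<sigma> - - exp (- \<sigma> * a) / \<sigma>"
    using assms by (intro LBINT_FTC) (auto intro!: derivative_eq_intros continuous_intros)
  then show ?thesis by (simp add: diff_divide_distrib)
qed

context exp_order_one
begin

lemma Tw_neg: "x < 0 \<Longrightarrow> Tw \<sigma> x = 0"
  by (simp add: Tw_def neg)

text \<open>Uniformity in \<sigma>, including \<sigma> = 1, is what allows \<sigma> to tend to 1
  inside integrals over bounded windows.\<close>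

lemma Tw_local_bound: "\<exists>C\<ge>0. \<forall>x\<le>b. \<forall>\<sigma>\<ge>0. \<bar>Tw \<sigma> x\<bar> \<le> C"
proof -
  obtain C where C: "\<And>x. \<bar>E x\<bar> \<le> C * exp (2 * x)" using growth[of 2] by auto
  have C0: "C \<ge> 0" using C[of 0] by simp
  have "\<bar>Tw \<sigma> x\<bar> \<le> C * exp (2 * \<bar>b\<bar>)" if "x \<le> b" "\<sigma> \<ge> 0" for x \<sigma>
  proof (cases "x < 0")
    case False
    have "\<bar>Tw \<sigma> x\<bar> = exp (- \<sigma> * x) * \<bar>E x\<bar>" by (simp add: Tw_def abs_mult)
    also have "\<dots> \<le> 1 * \<bar>E x\<bar>" using False that by (intro mult_right_mono) auto
    also have "\<dots> \<le> C * exp (2 * x)" using C[of x] by simp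
    also have "\<dots> \<le> C * exp (2 * \<bar>b\<bar>)" using that C0 by (intro mult_left_mono) auto
    finally show ?thesis .
  qed (use C0 in \<open>simp add: Tw_neg\<close>)
  then show ?thesis using C0 by (intro exI[of _ "C * exp (2 * \<bar>b\<bar>)"]) auto
qed

lemma integrable_Tw_Icc: "\<sigma> \<ge> 0 \<Longrightarrow> integrable lborel (\<lambda>w. indicator {a..b} w * Tw \<sigma> w)"
  using Tw_local_bound[of b] by (auto intro!: integrable_Icc_bounded)

lemma Zw_abs_le:
  assumes r: "r > 0" and C: "\<And>w. x - r \<le> w \<Longrightarrow> w \<le> x + r \<Longrightarrow> \<bar>Tw \<sigma> w\<bar> \<le> C"
  shows "\<bar>Zw r \<sigma> x\<bar> \<le> 2 * r * C"
proof -
  have C0: "C \<ge> 0" using C[of x] r by auto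
  have "\<bar>Zw r \<sigma> x\<bar> \<le> (LBINT w. \<bar>indicator {x - r..x + r} w * Tw \<sigma> w\<bar>)"
    unfolding Zw_def by (rule integral_abs_bound)
  also have "\<dots> \<le> (LBINT w. indicator {x - r..x + r} w * C)"
    using r C C0 by (intro integral_mono' integrable_mult_left integrable_real_indicator)
      (auto simp: abs_mult indicator_def emeasure_lborel_Icc_eq)
  also have "\<dots> = 2 * r * C" using r by simp
  finally show ?thesis .
qed

lemma Dw_local_bound:
  assumes r: "r > 0"
  shows "\<exists>C\<ge>0. \<forall>x\<le>b. \<forall>\<sigma>. 0 \<le> \<sigma> \<and> \<sigma> \<le> 2 \<longrightarrow> \<bar>Dw r \<sigma> x\<bar> \<le> C"
proof -
  obtain C where C: "C \<ge> 0" "\<And>x \<sigma>. x \<le> b + r \<Longrightarrow> \<sigma> \<ge> 0 \<Longrightarrow> \<bar>Tw \<sigma> x\<bar> \<le> C"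
    using Tw_local_bound[of "b + r"] by blast
  have "\<bar>Dw r \<sigma> x\<bar> \<le> C + C + 2 * (2 * r * C)" if "x \<le> b" "0 \<le> \<sigma>" "\<sigma> \<le> 2" for x \<sigma>
  proof -
    have "\<bar>Zw r \<sigma> x\<bar> \<le> 2 * r * C" using C that r by (intro Zw_abs_le) auto
    then have "\<bar>\<sigma> * Zw r \<sigma> x\<bar> \<le> 2 * (2 * r * C)"
      unfolding abs_mult using that r C by (intro mult_mono) auto
    moreover have "\<bar>Tw \<sigma> (x + r)\<bar> \<le> C" "\<bar>Tw \<sigma> (x - r)\<bar> \<le> C" using C that r by auto
    ultimately show ?thesis unfolding Dw_def by linarith
  qed
  moreover have "0 \<le> C + C + 2 * (2 * r * C)" using C r by simp
  ultimately show ?thesis by blast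
qed

lemma Dw_neg: "r > 0 \<Longrightarrow> x < - r \<Longrightarrow> Dw r \<sigma> x = 0"
proof -
  assume r: "r > 0" "x < - r"
  then have "Zw r \<sigma> x = (\<integral>w. 0 \<partial>(lborel :: real measure))"
    unfolding Zw_def by (intro Bochner_Integration.integral_cong) (auto simp: indicator_def Tw_neg)
  then show ?thesis using r by (simp add: Dw_def Tw_neg)
qed

lemma Zw_neg: "r > 0 \<Longrightarrow> x < - r \<Longrightarrow> Zw r \<sigma> x = 0"
  unfolding Zw_def by (intro integral_eq_zero_AE AE_I2) (auto simp: indicator_def Tw_neg)

text \<open>Since D = Z + Z', this is the integrated form of (e^x Z)' = e^x D.\<close>

lemma exp_Zw_eq:
  assumes r: "r > 0"
  shows "exp x * Zw r 1 x = (LBINT u. indicator {-r..x} u * (exp u * Dw r 1 u))"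
    and "integrable lborel (\<lambda>u. indicator {a..b} u * (exp u * Dw r 1 u))"
proof -
  define B where "B x = (LBINT w. indicator {0..x} w * Tw 1 w)" for x
  have ti: "integrable lborel (\<lambda>w. indicator {a..b} w * Tw 1 w)" for a b by (rule integrable_Tw_Icc) simp
  have ZB: "Zw r 1 x = B (x + r) - B (x - r)" for x
  proof -
    have "Zw r 1 x = (LBINT w. indicator {0..x + r} w * Tw 1 w - indicator {0..x - r} w * Tw 1 w)"
      unfolding Zw_def
    proof (rule integral_cong_AE)
      show "AE w in lborel. indicator {x - r..x + r} w * Tw 1 w = indicator {0..x + r} w * Tw 1 w - indicator {0..x - r} w * Tw 1 w"
        using AE_lborel_singleton[of "x - r"]
        by eventually_elim (use r in \<open>auto simp: indicator_def Tw_neg\<close>)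
    qed measurable
    then show ?thesis using ti by (simp add: B_def)
  qed
  have B_neg: "B x = 0" if "x < 0" for x using that by (simp add: B_def)
  \<comment> \<open>By parts, W(u) is the integral of e^(-w) dS(w) over [0, u], so
    \<open>Dw r 1\<close> is a plain difference of W at the ends of the window.\<close>
  define W where "W u = Tw 1 u + B u" for u
  have W_neg: "W u = 0" if "u < 0" for u using that by (simp add: W_def B_neg Tw_neg)
  have DW: "Dw r 1 u = W (u + r) - W (u - r)" for u
    by (simp add: Dw_def W_def ZB)
  have prim: "exp x * B x = (LBINT u. indicator {0..x} u * (exp u * W u))" for x
    using exp_primitive[OF ti, of 1 x] by (simp add: B_def W_def)
  have [measurable]: "B \<in> borel_measurable borel"
    unfolding B_def[abs_def] by (intro measurable_moving_integral) auto
  have [measurable]: "W \<in> borel_measurable borel" unfolding W_def by measurable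
  have Wi: "integrable lborel (\<lambda>u. indicator {a..b} u * (exp u * W (u + c)))" for a b c
  proof -
    obtain C where C: "C \<ge> 0" "\<And>x. x \<le> b + c \<Longrightarrow> \<bar>Tw 1 x\<bar> \<le> C" using Tw_local_bound[of "b + c"] by force
    have BB: "\<bar>B x\<bar> \<le> \<bar>b + c\<bar> * C" if "x \<le> b + c" for x
    proof -
      have "\<bar>B x\<bar> \<le> (LBINT w. \<bar>indicator {0..x} w * Tw 1 w\<bar>)"
        unfolding B_def by (rule integral_abs_bound)
      also have "\<dots> \<le> (LBINT w. indicator {0..\<bar>b + c\<bar>} w * C)"
        using C that by (intro integral_mono' integrable_mult_left integrable_real_indicator)
          (auto simp: abs_mult indicator_def emeasure_lborel_Icc_eq)
      also have "\<dots> = \<bar>b + c\<bar> * C" by simp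
      finally show ?thesis .
    qed
    show ?thesis
    proof (rule integrable_Icc_bounded[where B="exp b * (C + \<bar>b + c\<bar> * C)"])
      fix t assume t: "a \<le> t" "t \<le> b"
      have "\<bar>W (t + c)\<bar> \<le> C + \<bar>b + c\<bar> * C"
        unfolding W_def using C(2)[of "t + c"] BB[of "t + c"] t
        by (intro order.trans[OF abs_triangle_ineq] add_mono) auto
      then show "\<bar>exp t * W (t + c)\<bar> \<le> exp b * (C + \<bar>b + c\<bar> * C)"
        unfolding abs_mult using t by (intro mult_mono) auto
    qed simp
  qed
  \<comment> \<open>After the translation the natural lower limit is -c. It may be moved to the
    common value -r because W vanishes on the negative axis.\<close>
  have shift: "exp x * B (x + c) = (LBINT u. indicator {-r..x} u * (exp u * W (u + c)))" if "\<bar>c\<bar> \<le> r" for c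
  proof -
    have "exp x * B (x + c) = exp (- c) * (exp (x + c) * B (x + c))"
      by (simp add: exp_add exp_minus field_simps)
    also have "\<dots> = (LBINT u. exp (- c) * (indicator {0..x + c} u * (exp u * W u)))"
      unfolding prim by simp
    also have "\<dots> = (LBINT v. exp (- c) * (indicator {0..x + c} (c + v) * (exp (c + v) * W (c + v))))"
      using lborel_integral_real_affine[of 1 "\<lambda>u. exp (- c) * (indicator {0..x + c} u * (exp u * W u))" c] by simp
    also have "\<dots> = (LBINT u. indicator {-r..x} u * (exp u * W (u + c)))"
    proof (intro Bochner_Integration.integral_cong refl)
      fix v
      have "exp (- c) * exp (c + v) = exp v" by (simp flip: exp_add)
      then have "exp (- c) * (indicator {0..x + c} (c + v) * (exp (c + v) * W (c + v))) =
        indicator {0..x + c} (c + v) * (exp v * W (v + c))" by (simp add: mult_ac add_ac)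
      also have "\<dots> = indicator {-r..x} v * (exp v * W (v + c))"
        using that W_neg[of "v + c"] by (cases "v + c < 0") (auto simp: indicator_def)
      finally show "exp (- c) * (indicator {0..x + c} (c + v) * (exp (c + v) * W (c + v))) =
        indicator {-r..x} v * (exp v * W (v + c))" .
    qed
    finally show ?thesis .
  qed
  have split: "indicator {a..b} u * (exp u * Dw r 1 u) =
      indicator {a..b} u * (exp u * W (u + r)) - indicator {a..b} u * (exp u * W (u + (-r)))" for a b u :: real
    by (simp add: DW right_diff_distrib)
  show "integrable lborel (\<lambda>u. indicator {a..b} u * (exp u * Dw r 1 u))" for a b
    unfolding split by (intro Bochner_Integration.integrable_diff Wi)
  show "exp x * Zw r 1 x = (LBINT u. indicator {-r..x} u * (exp u * Dw r 1 u))"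
    unfolding split ZB using shift[of r] shift[of "-r"] r Wi[of "-r" x r] Wi[of "-r" x "-r"]
    by (simp add: right_diff_distrib)
qed

lemma Tw_tendsto: "s \<longlonglongrightarrow> 1 \<Longrightarrow> (\<lambda>n. Tw (s n) x) \<longlonglongrightarrow> Tw 1 x"
  unfolding Tw_def by (intro tendsto_intros)

lemma Dw_tendsto:
  assumes s: "s \<longlonglongrightarrow> 1" "\<And>n. s n \<ge> 0" and r: "r > 0"
  shows "(\<lambda>n. Dw r (s n) x) \<longlonglongrightarrow> Dw r 1 x"
proof -
  obtain C where C: "C \<ge> 0" "\<And>w \<sigma>. w \<le> x + r \<Longrightarrow> \<sigma> \<ge> 0 \<Longrightarrow> \<bar>Tw \<sigma> w\<bar> \<le> C" using Tw_local_bound[of "x + r"] by blast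
  have "(\<lambda>n. Zw r (s n) x) \<longlonglongrightarrow> Zw r 1 x"
    unfolding Zw_def
  proof (rule integral_dominated_convergence)
    show "integrable lborel (\<lambda>w. indicator {x - r..x + r} w * C)"
      by (intro integrable_mult_left integrable_real_indicator) (auto simp: emeasure_lborel_Icc_eq)
    show "AE w in lborel. (\<lambda>n. indicator {x - r..x + r} w * Tw (s n) w) \<longlonglongrightarrow> indicator {x - r..x + r} w * Tw 1 w"
      by (intro AE_I2 tendsto_mult_left Tw_tendsto s)
    show "AE w in lborel. norm (indicator {x - r..x + r} w * Tw (s n) w) \<le> indicator {x - r..x + r} w * C" for n
      using C s(2) by (intro AE_I2) (auto simp: indicator_def)
  qed simp_all
  then show ?thesis
    unfolding Dw_def by (intro tendsto_intros Tw_tendsto s)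
qed

end

section \<open>Boundedness\<close>

locale tauber = boundary_bounded +
  assumes slow: "\<epsilon> > 0 \<Longrightarrow> \<exists>h>0. \<exists>x0>0. \<forall>x y. x0 \<le> x \<and> x \<le> y \<and> y \<le> x + h \<longrightarrow> E y - E x \<ge> - \<epsilon> * exp x"
begin

text \<open>On the window [a, a + 2r] slow decrease gives E \<ge> L with L = E(a) - e^a. Replacing E
  by L in the positive terms of D telescopes exactly to L e^(-\<sigma>a), and subtracting
  \<open>Tw \<sigma> a\<close> leaves -e^((1-\<sigma>)a) \<ge> -1. The remaining x lie in a
  half-line where D is bounded anyway.\<close>

lemma Dw_lower_bound:
  assumes r: "r > 0" and x0: "\<And>x y. x0 \<le> x \<Longrightarrow> x \<le> y \<Longrightarrow> y \<le> x + 2 * r \<Longrightarrow> E y - E x \<ge> - exp x" "x0 > 0"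
  shows "\<exists>C\<ge>0. \<forall>x \<sigma>. 1 \<le> \<sigma> \<and> \<sigma> \<le> 2 \<longrightarrow> Dw r \<sigma> x \<ge> - C"
proof -
  obtain C where C: "C \<ge> 0" "\<And>x \<sigma>. x \<le> x0 + r \<Longrightarrow> 0 \<le> \<sigma> \<Longrightarrow> \<sigma> \<le> 2 \<Longrightarrow> \<bar>Dw r \<sigma> x\<bar> \<le> C"
    using Dw_local_bound[OF r, of "x0 + r"] by blast
  have "Dw r \<sigma> x \<ge> - (C + 1)" if \<sigma>: "1 \<le> \<sigma>" "\<sigma> \<le> 2" for x \<sigma>
  proof (cases "x \<le> x0 + r")
    case True
    then show ?thesis using C(2)[of x \<sigma>] \<sigma> by (auto simp: abs_le_iff)
  next
    case False
    define a where "a = x - r"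
    have a: "a \<ge> x0" "x + r = a + 2 * r" "x - r = a" using False by (auto simp: a_def)
    let ?L = "E a - exp a"
    have low: "E w \<ge> ?L" if "a \<le> w" "w \<le> a + 2 * r" for w
      using x0(1)[of a w] a that by simp
    have "?L * ((exp (- \<sigma> * a) - exp (- \<sigma> * (a + 2 * r))) / \<sigma>) =
      (LBINT w. indicator {a..a + 2 * r} w * exp (- \<sigma> * w) * ?L)"
      using r \<sigma> LBINT_exp_minus[of a "a + 2 * r" \<sigma>] by simp
    also have "\<dots> \<le> Zw r \<sigma> x"
      unfolding Zw_def a
    proof (rule integral_mono)
      show "integrable lborel (\<lambda>w. indicator {a..a + 2 * r} w * exp (- \<sigma> * w) * ?L)"
        by (intro integrable_mult_left integrable_continuous_Icc continuous_intros)
      show "integrable lborel (\<lambda>w. indicator {a..a + 2 * r} w * Tw \<sigma> w)" using \<sigma> by (intro integrable_Tw_Icc) auto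
      show "indicator {a..a + 2 * r} w * exp (- \<sigma> * w) * ?L \<le> indicator {a..a + 2 * r} w * Tw \<sigma> w" for w
        using low[of w] by (auto simp: indicator_def Tw_def)
    qed
    finally have "?L * (exp (- \<sigma> * a) - exp (- \<sigma> * (a + 2 * r))) \<le> \<sigma> * Zw r \<sigma> x"
      using \<sigma> by (simp add: field_simps)
    moreover have "?L * exp (- \<sigma> * (a + 2 * r)) \<le> Tw \<sigma> (x + r)"
      using low[of "a + 2 * r"] r unfolding a Tw_def by (simp add: mult.commute)
    ultimately have "?L * exp (- \<sigma> * a) \<le> \<sigma> * Zw r \<sigma> x + Tw \<sigma> (x + r)"
      by (simp add: right_diff_distrib)
    then have "Dw r \<sigma> x \<ge> - (exp a * exp (- \<sigma> * a))"
      unfolding Dw_def by (simp add: Tw_def a left_diff_distrib mult.commute)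
    moreover have "exp a * exp (- \<sigma> * a) \<le> 1"
    proof -
      have "exp a * exp (- \<sigma> * a) = exp ((1 - \<sigma>) * a)" by (simp add: algebra_simps flip: exp_add)
      moreover have "(1 - \<sigma>) * a \<le> 0" using \<sigma> a x0(2) by (intro mult_nonpos_nonneg) auto
      ultimately show ?thesis by simp
    qed
    ultimately show ?thesis using C(1) by linarith
  qed
  then show ?thesis using C(1) by (intro exI[of _ "C + 1"]) auto
qed

text \<open>For \<sigma> > 1 the Fejer identity bounds the mean of D by the L^1 norm of U on
  [-1, 1], uniformly in y. At \<sigma> = 1 even integrability is open, so the bound is stated for
  the nonnegative integral and carried over by Fatou's lemma, for which D + C \<ge> 0 is
  essential.\<close>

lemma nn_mass_bounded:
  assumes r: "r > 0" and C: "C \<ge> 0" "\<And>x \<sigma>. 1 \<le> \<sigma> \<Longrightarrow> \<sigma> \<le> 2 \<Longrightarrow> Dw r \<sigma> x \<ge> - C"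
  shows "\<exists>K\<ge>0. \<forall>y. (\<integral>\<^sup>+v. ennreal ((Dw r 1 v + C) * sym_fej 1 y v) \<partial>lborel) \<le> ennreal K"
proof -
  obtain M' where "\<forall>\<^sub>F \<sigma> in at_right 1. (LBINT t. indicator {-1..1} t * \<bar>Uh \<sigma> t\<bar>) \<le> M'"
    using L1_bounded[of 1] by blast
  then obtain b where b: "b > 1" "\<And>\<sigma>. 1 < \<sigma> \<Longrightarrow> \<sigma> < b \<Longrightarrow> (LBINT t. indicator {-1..1} t * \<bar>Uh \<sigma> t\<bar>) \<le> M'"
    unfolding eventually_at_right_field by blast
  define m where "m = min b 2 - 1"
  have m: "0 < m" "1 + m \<le> b" "m \<le> 1" using b(1) by (auto simp: m_def)
  define s where "s n = 1 + m / real (n + 2)" for n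
  have s1: "1 < s n" for n using m by (simp add: s_def)
  have s2: "s n < 1 + m" for n
  proof -
    have "m / real (n + 2) < m / 1" using m(1) by (intro divide_strict_left_mono) auto
    then show ?thesis by (simp add: s_def)
  qed
  have s: "s \<longlonglongrightarrow> 1" unfolding s_def by real_asymp
  define K where "K = 2 * r * M' + C * fejer_mass"
  have bnd: "(\<integral>\<^sup>+v. ennreal ((Dw r (s n) v + C) * sym_fej 1 y v) \<partial>lborel) \<le> ennreal K" for n y
  proof -
    let ?p = "sym_fej 1 y"
    have intD: "integrable lborel (\<lambda>v. Dw r (s n) v * ?p v)"
    proof (rule integrable_mult_bounded[OF integrable_Dw[OF s1 r]])
      show "\<bar>?p v\<bar> \<le> 1" for v
        using fej_le[of 1 "v - y"] fej_le[of 1 "v + y"] sym_fej_nonneg[of 1 y v] by (simp add: sym_fej_def)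
    qed simp
    have int: "integrable lborel (\<lambda>v. (Dw r (s n) v + C) * ?p v)"
      using intD integrable_sym_fej[of 1 y] by (simp add: distrib_right)
    have "(LBINT v. Dw r (s n) v * ?p v) =
        (LBINT t. indicator {-1..1} t * (tri (t / 1) * cos (t * y) * window_mult r t * Uh (s n) t))"
      using fejer_identity[OF s1 r, of 1 y n] by simp
    also have "\<dots> \<le> (LBINT t. 2 * r * (indicator {-1..1} t * \<bar>Uh (s n) t\<bar>))"
    proof (rule integral_mono)
      show "integrable lborel (\<lambda>t. indicator {-1..1} t * (tri (t / 1) * cos (t * y) * window_mult r t * Uh (s n) t))"
        by (rule integrable_weight(1)[OF fejer_test_measurable fejer_test_bound[OF r] s1])
      show "integrable lborel (\<lambda>t. 2 * r * (indicator {-1..1} t * \<bar>Uh (s n) t\<bar>))"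
        by (intro integrable_mult_right integrable_abs_Uh s1)
      fix t
      let ?w = "tri (t / 1) * cos (t * y) * window_mult r t"
      have "?w * Uh (s n) t \<le> \<bar>?w\<bar> * \<bar>Uh (s n) t\<bar>" by (metis abs_ge_self abs_mult)
      also have "\<dots> \<le> 2 * r * \<bar>Uh (s n) t\<bar>" by (intro mult_right_mono fejer_test_bound[OF r]) simp
      finally have "indicator {-1..1} t * (?w * Uh (s n) t) \<le> indicator {-1..1} t * (2 * r * \<bar>Uh (s n) t\<bar>)"
        by (rule mult_left_mono) simp
      then show "indicator {-1..1} t * (?w * Uh (s n) t) \<le> 2 * r * (indicator {-1..1} t * \<bar>Uh (s n) t\<bar>)"
        by (simp only: mult_ac)
    qed
    also have "\<dots> \<le> 2 * r * M'"
    proof -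
      have "(LBINT t. indicator {-1..1} t * \<bar>Uh (s n) t\<bar>) \<le> M'"
        using b(2)[OF s1 less_le_trans[OF s2 m(2)]] .
      then show ?thesis unfolding integral_mult_right_zero using r by (intro mult_left_mono) auto
    qed
    finally have "(LBINT v. Dw r (s n) v * ?p v) \<le> 2 * r * M'" .
    moreover have "(LBINT v. (Dw r (s n) v + C) * ?p v) = (LBINT v. Dw r (s n) v * ?p v) + C * fejer_mass"
      using intD integrable_sym_fej[of 1 y] integral_sym_fej[of 1 y] by (simp add: distrib_right)
    ultimately have "(LBINT v. (Dw r (s n) v + C) * ?p v) \<le> K" by (simp add: K_def)
    moreover have "0 \<le> (Dw r (s n) v + C) * ?p v" for v
      using C(2)[of "s n" v] s1[of n] s2[of n] m(3) by (intro mult_nonneg_nonneg sym_fej_nonneg) auto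
    ultimately show ?thesis
      using nn_integral_eq_integral[OF int] by (simp add: ennreal_leI)
  qed
  have "(\<integral>\<^sup>+v. ennreal ((Dw r 1 v + C) * sym_fej 1 y v) \<partial>lborel) \<le> ennreal \<bar>K\<bar>" for y
  proof -
    have "(\<integral>\<^sup>+v. ennreal ((Dw r 1 v + C) * sym_fej 1 y v) \<partial>lborel) =
      (\<integral>\<^sup>+v. liminf (\<lambda>n. ennreal ((Dw r (s n) v + C) * sym_fej 1 y v)) \<partial>lborel)"
    proof (intro nn_integral_cong)
      fix v
      have "(\<lambda>n. ennreal ((Dw r (s n) v + C) * sym_fej 1 y v)) \<longlonglongrightarrow> ennreal ((Dw r 1 v + C) * sym_fej 1 y v)"
        using less_imp_le[OF less_trans[OF zero_less_one s1]]
        by (intro tendsto_ennrealI tendsto_intros Dw_tendsto s r)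
      then show "ennreal ((Dw r 1 v + C) * sym_fej 1 y v) = liminf (\<lambda>n. ennreal ((Dw r (s n) v + C) * sym_fej 1 y v))"
        by (rule lim_imp_Liminf[OF sequentially_bot, symmetric])
    qed
    also have "\<dots> \<le> liminf (\<lambda>n. \<integral>\<^sup>+v. ennreal ((Dw r (s n) v + C) * sym_fej 1 y v) \<partial>lborel)"
      by (intro nn_integral_liminf) simp
    also have "\<dots> \<le> ennreal \<bar>K\<bar>"
      using bnd by (intro Liminf_le always_eventually allI order.trans[OF bnd] ennreal_leI) auto
    finally show ?thesis .
  qed
  then show ?thesis by (intro exI[of _ "\<bar>K\<bar>"]) auto
qed

text \<open>The kernel is bounded below near y and D + C \<ge> 0, so a bounded Fejer mean bounds the
  mass of D + C on unit intervals. Inserted in e^x Z(x) = integral of e^u D(u), this gives a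
  contracting recursion from x - 1 to x, started where Z vanishes.\<close>

lemma Zw_bounded:
  assumes r: "r > 0" and C: "C \<ge> 0" "\<And>x \<sigma>. 1 \<le> \<sigma> \<Longrightarrow> \<sigma> \<le> 2 \<Longrightarrow> Dw r \<sigma> x \<ge> - C"
  shows "\<exists>B\<ge>0. \<forall>x. \<bar>Zw r 1 x\<bar> \<le> B"
proof -
  obtain K where K: "K \<ge> 0" "\<And>y. (\<integral>\<^sup>+v. ennreal ((Dw r 1 v + C) * sym_fej 1 y v) \<partial>lborel) \<le> ennreal K"
    using nn_mass_bounded[OF assms] by blast
  have DC: "0 \<le> Dw r 1 v + C" for v using C(2)[of 1 v] by simp
  have loc: "integrable lborel (\<lambda>v. indicator {a..b} v * Dw r 1 v)" for a b
  proof -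
    obtain L where "\<forall>x\<le>b. \<forall>\<sigma>. 0 \<le> \<sigma> \<and> \<sigma> \<le> 2 \<longrightarrow> \<bar>Dw r \<sigma> x\<bar> \<le> L"
      using Dw_local_bound[OF r, of b] by blast
    then have "\<bar>Dw r 1 v\<bar> \<le> L" if "v \<le> b" for v using that by simp
    then show ?thesis by (intro integrable_Icc_bounded) auto
  qed
  have mass: "(LBINT v. indicator {y - 1..y} v * (Dw r 1 v + C)) \<le> 4 * K" for y
  proof -
    have int: "integrable lborel (\<lambda>v. indicator {y - 1..y} v * (Dw r 1 v + C))"
      unfolding distrib_left
      by (intro Bochner_Integration.integrable_add loc integrable_mult_left integrable_real_indicator)
        (auto simp: emeasure_lborel_Icc_eq)
    have "ennreal (LBINT v. indicator {y - 1..y} v * (Dw r 1 v + C)) =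
       (\<integral>\<^sup>+v. ennreal (indicator {y - 1..y} v * (Dw r 1 v + C)) \<partial>lborel)"
      using DC by (intro nn_integral_eq_integral[symmetric] int AE_I2) auto
    also have "\<dots> \<le> (\<integral>\<^sup>+v. ennreal 4 * ennreal ((Dw r 1 v + C) * sym_fej 1 y v) \<partial>lborel)"
    proof (intro nn_integral_mono)
      fix v
      show "ennreal (indicator {y - 1..y} v * (Dw r 1 v + C)) \<le> ennreal 4 * ennreal ((Dw r 1 v + C) * sym_fej 1 y v)"
      proof (cases "v \<in> {y - 1..y}")
        case True
        \<comment> \<open>The kernel itself is at least 1/2 at distance up to 1, and symmetrisation
          halves it.\<close>
        then have "1 / 4 \<le> sym_fej 1 y v"
          using fej_lower[of 1 "v - y"] fej_nonneg[of 1 "v + y"] by (auto simp: sym_fej_def)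
        then have "(Dw r 1 v + C) * (1 / 4) \<le> (Dw r 1 v + C) * sym_fej 1 y v"
          by (intro mult_left_mono DC)
        then have "indicator {y - 1..y} v * (Dw r 1 v + C) \<le> 4 * ((Dw r 1 v + C) * sym_fej 1 y v)"
          using True by simp
        then show ?thesis
          by (subst ennreal_mult'[symmetric]) (auto intro: ennreal_leI)
      qed auto
    qed
    also have "\<dots> = ennreal 4 * (\<integral>\<^sup>+v. ennreal ((Dw r 1 v + C) * sym_fej 1 y v) \<partial>lborel)"
      by (rule nn_integral_cmult) measurable
    also have "\<dots> \<le> ennreal 4 * ennreal K" by (intro mult_left_mono K) auto
    also have "\<dots> = ennreal (4 * K)" by (rule ennreal_mult'[symmetric]) simp
    finally show ?thesis using K(1) by (subst (asm) ennreal_le_iff) auto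
  qed
  define B where "B = 4 * K + C"
  have B0: "B \<ge> 0" using K C by (simp add: B_def)
  \<comment> \<open>The integral is cut at x - 1. The old part is damped by e^(x-1) / e^x; the new
    unit piece is bounded above by the mass of D + C and below by D \<ge> -C.\<close>
  have step: "\<bar>Zw r 1 x\<bar> \<le> exp (- 1) * \<bar>Zw r 1 (x - 1)\<bar> + B" if x: "x \<ge> - r" for x
  proof -
    let ?w = "\<lambda>a b u. indicator {a..b} u * (exp u * Dw r 1 u)"
    have "exp x * Zw r 1 x = (LBINT u. ?w (-r) (x - 1) u + ?w (x - 1) x u)"
      unfolding exp_Zw_eq(1)[OF r]
    proof (rule integral_cong_AE)
      show "AE u in lborel. ?w (-r) x u = ?w (-r) (x - 1) u + ?w (x - 1) x u"
        using AE_lborel_singleton[of "x - 1"]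
        by eventually_elim (use Dw_neg[OF r] in \<open>auto simp: indicator_def\<close>)
    qed measurable
    also have "\<dots> = exp (x - 1) * Zw r 1 (x - 1) + (LBINT u. ?w (x - 1) x u)"
      unfolding exp_Zw_eq(1)[OF r] using exp_Zw_eq(2)[OF r] by simp
    finally have eq: "exp x * Zw r 1 x = exp (x - 1) * Zw r 1 (x - 1) + (LBINT u. ?w (x - 1) x u)" .
    have "(LBINT u. ?w (x - 1) x u) \<le> (LBINT u. exp x * (indicator {x - 1..x} u * (Dw r 1 u + C)))"
    proof (rule integral_mono')
      show "integrable lborel (\<lambda>u. exp x * (indicator {x - 1..x} u * (Dw r 1 u + C)))"
        unfolding distrib_left
        by (intro Bochner_Integration.integrable_add loc integrable_mult_left integrable_mult_right integrable_real_indicator)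
         (auto simp: emeasure_lborel_Icc_eq)
      show "?w (x - 1) x u \<le> exp x * (indicator {x - 1..x} u * (Dw r 1 u + C))" for u
      proof (cases "u \<in> {x - 1..x}")
        case True
        have "exp u * Dw r 1 u \<le> exp u * (Dw r 1 u + C)" using C by simp
        also have "\<dots> \<le> exp x * (Dw r 1 u + C)" using True DC by (intro mult_right_mono) auto
        finally show ?thesis using True by simp
      qed simp
      show "0 \<le> exp x * (indicator {x - 1..x} u * (Dw r 1 u + C))" for u using DC by simp
    qed
    also have "\<dots> \<le> exp x * (4 * K)" using mass[of x] by simp
    finally have up: "(LBINT u. ?w (x - 1) x u) \<le> exp x * (4 * K)" .
    have "(LBINT u. - ?w (x - 1) x u) \<le> (LBINT u. indicator {x - 1..x} u * (exp x * C))"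
    proof (rule integral_mono')
      show "integrable lborel (\<lambda>u. indicator {x - 1..x} u * (exp x * C))"
        by (intro integrable_mult_left integrable_real_indicator) (auto simp: emeasure_lborel_Icc_eq)
      show "- ?w (x - 1) x u \<le> indicator {x - 1..x} u * (exp x * C)" for u
      proof (cases "u \<in> {x - 1..x}")
        case True
        have "exp u * (- Dw r 1 u) \<le> exp u * C" using DC[of u] by (intro mult_left_mono) auto
        also have "\<dots> \<le> exp x * C" using True C by (intro mult_right_mono) auto
        finally show ?thesis using True by simp
      qed simp
      show "0 \<le> indicator {x - 1..x} u * (exp x * C)" for u using C by simp
    qed
    also have "\<dots> = exp x * C" by simp
    finally have lo: "- (LBINT u. ?w (x - 1) x u) \<le> exp x * C" by simp
    have nn: "0 \<le> exp x * C" "0 \<le> exp x * (4 * K)" using C K by auto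
    have "\<bar>LBINT u. ?w (x - 1) x u\<bar> \<le> exp x * B"
      using up lo nn unfolding B_def distrib_left by (intro abs_leI) linarith+
    then have "\<bar>exp x * Zw r 1 x\<bar> \<le> \<bar>exp (x - 1) * Zw r 1 (x - 1)\<bar> + exp x * B"
      unfolding eq by (intro order.trans[OF abs_triangle_ineq]) simp
    also have "exp (x - 1) = exp x * exp (- 1)" by (simp flip: exp_add)
    finally have "exp x * \<bar>Zw r 1 x\<bar> \<le> exp x * (exp (- 1) * \<bar>Zw r 1 (x - 1)\<bar> + B)"
      by (simp add: abs_mult distrib_left mult.assoc)
    then show ?thesis by simp
  qed
  \<comment> \<open>With contraction factor 1/2 the value 2 B is the fixed point of z -> z/2 + B, so
    it is preserved by the induction over unit steps.\<close>
  have e: "exp (- 1 :: real) \<le> 1 / 2"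
    using exp_ge_add_one_self[of 1] by (simp add: exp_minus field_simps)
  have "\<forall>x. x < - r + real n \<longrightarrow> \<bar>Zw r 1 x\<bar> \<le> 2 * B" for n
  proof (induction n)
    case 0
    show ?case using Zw_neg[OF r] B0 by auto
  next
    case (Suc n)
    show ?case
    proof (intro allI impI)
      fix x assume x: "x < - r + real (Suc n)"
      show "\<bar>Zw r 1 x\<bar> \<le> 2 * B"
      proof (cases "x < - r")
        case True
        then show ?thesis using Zw_neg[OF r] B0 by auto
      next
        case False
        have "\<bar>Zw r 1 (x - 1)\<bar> \<le> 2 * B" using Suc x by simp
        then have "exp (- 1) * \<bar>Zw r 1 (x - 1)\<bar> \<le> 1 / 2 * (2 * B)"
          using e by (intro mult_mono) auto
        then show ?thesis using step[of x] False by simp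
      qed
    qed
  qed
  moreover have "\<exists>n. x < - r + real n" for x
    using reals_Archimedean2[of "x + r"] by (auto simp: algebra_simps)
  ultimately have "\<bar>Zw r 1 x\<bar> \<le> 2 * B" for x by blast
  then show ?thesis using B0 by (intro exI[of _ "2 * B"]) auto
qed

text \<open>Slow decrease cannot exclude sudden growth, but a large value persists to the right and
  a very negative one extends to the left. Either way it would show up in a moving integral Z, which
  is bounded.\<close>

lemma Tw_bounded: "\<exists>B\<ge>0. \<forall>x. \<bar>Tw 1 x\<bar> \<le> B"
proof -
  obtain h x0 where h: "h > 0" "x0 > 0" "\<And>x y. x0 \<le> x \<Longrightarrow> x \<le> y \<Longrightarrow> y \<le> x + h \<Longrightarrow> E y - E x \<ge> - exp x"
    using slow[of 1] by auto
  define r where "r = h / 2"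
  have r: "r > 0" and sl: "\<And>x y. x0 \<le> x \<Longrightarrow> x \<le> y \<Longrightarrow> y \<le> x + 2 * r \<Longrightarrow> E y - E x \<ge> - exp x"
    using h by (auto simp: r_def)
  obtain C where C: "C \<ge> 0" "\<And>x \<sigma>. 1 \<le> \<sigma> \<Longrightarrow> \<sigma> \<le> 2 \<Longrightarrow> Dw r \<sigma> x \<ge> - C"
    using Dw_lower_bound[OF r sl h(2)] by blast
  obtain K where K: "K \<ge> 0" "\<And>x. \<bar>Zw r 1 x\<bar> \<le> K" using Zw_bounded[OF r C] by blast
  obtain L where L: "L \<ge> 0" "\<And>x. x \<le> x0 + 2 * r \<Longrightarrow> \<bar>Tw 1 x\<bar> \<le> L" using Tw_local_bound[of "x0 + 2 * r"] by force
  have q: "1 - exp (- 2 * r) > 0" "exp (2 * r) - 1 > 0" using r by auto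
  have ti: "integrable lborel (\<lambda>w. indicator {a..b} w * Tw 1 w)" for a b by (rule integrable_Tw_Icc) simp
  \<comment> \<open>E stays above E(x) - e^x on [x, x + 2r], the window centred at x + r.\<close>
  have up: "Tw 1 x \<le> 1 + K / (1 - exp (- 2 * r))" if x: "x \<ge> x0" for x
  proof -
    have "(E x - exp x) * (exp (- 1 * x) - exp (- 1 * (x + 2 * r))) =
      (LBINT w. indicator {x..x + 2 * r} w * exp (- 1 * w) * (E x - exp x))"
      using r LBINT_exp_minus[of x "x + 2 * r" 1] by simp
    also have "\<dots> \<le> (LBINT w. indicator {x..x + 2 * r} w * Tw 1 w)"
    proof (rule integral_mono)
      show "integrable lborel (\<lambda>w. indicator {x..x + 2 * r} w * exp (- 1 * w) * (E x - exp x))"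
        by (intro integrable_mult_left integrable_continuous_Icc continuous_intros)
      show "indicator {x..x + 2 * r} w * exp (- 1 * w) * (E x - exp x) \<le> indicator {x..x + 2 * r} w * Tw 1 w" for w
        using sl[of x w] x by (auto simp: indicator_def Tw_def)
    qed (rule ti)
    also have "\<dots> = Zw r 1 (x + r)" unfolding Zw_def by (simp add: add.assoc)
    also have "\<dots> \<le> K" using K(2)[of "x + r"] by simp
    also have "(E x - exp x) * (exp (- 1 * x) - exp (- 1 * (x + 2 * r))) = (Tw 1 x - 1) * (1 - exp (- 2 * r))"
    proof -
      have "exp (- 1 * (x + 2 * r)) = exp (- 1 * x) * exp (- 2 * r)" by (simp flip: exp_add)
      moreover have "(E x - exp x) * (exp (- 1 * x) - exp (- 1 * x) * c) =
        (exp (- 1 * x) * E x - exp x * exp (- 1 * x)) * (1 - c)" for c by (simp add: algebra_simps)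
      moreover have "exp x * exp (- 1 * x) = 1" by (simp flip: exp_add)
      ultimately show ?thesis unfolding Tw_def by metis
    qed
    finally show ?thesis using q(1) by (simp add: field_simps)
  qed
  \<comment> \<open>Read backwards, slow decrease gives E(w) \<le> E(x) + e^w on [x - 2r, x]; the
    last term, weighted by e^(-w), integrates to 2 r.\<close>
  have lo: "Tw 1 x \<ge> - ((K + 2 * r) / (exp (2 * r) - 1))" if x: "x \<ge> x0 + 2 * r" for x
  proof -
    have "- K \<le> Zw r 1 (x - r)" using K(2)[of "x - r"] by (auto simp: abs_le_iff)
    also have "\<dots> = (LBINT w. indicator {x - 2 * r..x} w * Tw 1 w)" unfolding Zw_def by (simp add: algebra_simps)
    also have "\<dots> \<le> (LBINT w. indicator {x - 2 * r..x} w * exp (- 1 * w) * E x + indicator {x - 2 * r..x} w * 1)"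
    proof (rule integral_mono)
      show "integrable lborel (\<lambda>w. indicator {x - 2 * r..x} w * exp (- 1 * w) * E x + indicator {x - 2 * r..x} w * 1)"
        by (intro Bochner_Integration.integrable_add integrable_mult_left integrable_continuous_Icc continuous_intros)
      fix w
      show "indicator {x - 2 * r..x} w * Tw 1 w \<le> indicator {x - 2 * r..x} w * exp (- 1 * w) * E x + indicator {x - 2 * r..x} w * 1"
      proof (cases "w \<in> {x - 2 * r..x}")
        case True
        then have "E w \<le> E x + exp w" using sl[of w x] x by auto
        then have "exp (- w) * E w \<le> exp (- w) * (E x + exp w)" by (intro mult_left_mono) auto
        also have "\<dots> = exp (- w) * E x + 1" by (simp add: distrib_left flip: exp_add)
        finally show ?thesis using True by (simp add: Tw_def)
      qed simp
    qed (rule ti)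
    also have "\<dots> = E x * (exp (- 1 * (x - 2 * r)) - exp (- 1 * x)) + 2 * r"
    proof -
      have 1: "integrable lborel (\<lambda>w. indicator {x - 2 * r..x} w * exp (- 1 * w) * E x)"
        by (intro integrable_mult_left integrable_continuous_Icc continuous_intros)
      have 2: "integrable lborel (\<lambda>w. indicator {x - 2 * r..x} w * (1::real))"
        by (intro integrable_continuous_Icc continuous_intros)
      show ?thesis
        unfolding Bochner_Integration.integral_add[OF 1 2]
        using LBINT_exp_minus[of "x - 2 * r" x 1] r by simp
    qed
    also have "E x * (exp (- 1 * (x - 2 * r)) - exp (- 1 * x)) = Tw 1 x * (exp (2 * r) - 1)"
    proof -
      have "exp (- 1 * (x - 2 * r)) = exp (- 1 * x) * exp (2 * r)" by (simp flip: exp_add)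
      then show ?thesis unfolding Tw_def by (simp add: algebra_simps)
    qed
    finally show ?thesis using q(2) by (simp add: field_simps)
  qed
  define B where "B = L + (1 + K / (1 - exp (- 2 * r))) + (K + 2 * r) / (exp (2 * r) - 1)"
  have nn: "0 \<le> K / (1 - exp (- 2 * r))" "0 \<le> (K + 2 * r) / (exp (2 * r) - 1)" using K r q by auto
  have "\<bar>Tw 1 x\<bar> \<le> B" for x
  proof (cases "x \<le> x0 + 2 * r")
    case True
    then show ?thesis using L(2)[of x] nn by (simp add: B_def)
  next
    case False
    then have "Tw 1 x \<le> 1 + K / (1 - exp (- 2 * r))" "- Tw 1 x \<le> (K + 2 * r) / (exp (2 * r) - 1)"
      using up[of x] lo[of x] r by auto
    then show ?thesis using L(1) nn unfolding B_def by (intro abs_leI) linarith+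
  qed
  moreover have "B \<ge> 0" using L(1) nn by (simp add: B_def)
  ultimately show ?thesis by blast
qed

end

section \<open>Convergence\<close>

context exp_order_one
begin

lemma Tw_bound_ge1:
  assumes B: "\<And>x. \<bar>Tw 1 x\<bar> \<le> B" and \<sigma>: "\<sigma> \<ge> 1"
  shows "\<bar>Tw \<sigma> x\<bar> \<le> B"
proof (cases "x < 0")
  case True
  then show ?thesis using B[of x] by (simp add: Tw_neg)
next
  case False
  have "exp (- \<sigma> * x) \<le> exp (- 1 * x)" using False \<sigma> mult_right_mono[of 1 \<sigma> x] by simp
  then have "\<bar>Tw \<sigma> x\<bar> \<le> \<bar>Tw 1 x\<bar>" unfolding Tw_def abs_mult by (intro mult_right_mono) auto
  also have "\<dots> \<le> B" by (rule B)
  finally show ?thesis .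
qed

lemma Dw_bound_ge1:
  assumes B: "\<And>x. \<bar>Tw 1 x\<bar> \<le> B" and r: "r > 0" and \<sigma>: "1 \<le> \<sigma>" "\<sigma> \<le> 2"
  shows "\<bar>Dw r \<sigma> x\<bar> \<le> 2 * B + 4 * r * B"
proof -
  have B0: "B \<ge> 0" using B[of 0] by simp
  note T = Tw_bound_ge1[OF B \<sigma>(1)]
  have "\<bar>Zw r \<sigma> x\<bar> \<le> 2 * r * B" by (intro Zw_abs_le r T)
  then have "\<bar>\<sigma> * Zw r \<sigma> x\<bar> \<le> 2 * (2 * r * B)"
    unfolding abs_mult using \<sigma> r B0 by (intro mult_mono) auto
  then show ?thesis unfolding Dw_def using T[of "x + r"] T[of "x - r"] by linarith
qed

text \<open>Solving Z + Z' = D exhibits Z as D averaged over the past with the exponential density.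
  This average commutes with Fejer means, so their limits pass from D to Z.\<close>

lemma Zw_eq_exp_average:
  assumes r: "r > 0"
  shows "Zw r 1 x = (LBINT v. indicator {0..} v * exp (- 1 * v) * Dw r 1 (x - v))"
proof -
  have "exp x * Zw r 1 x = (LBINT v. indicator {-r..x} (x - v) * (exp (x - v) * Dw r 1 (x - v)))"
    unfolding exp_Zw_eq(1)[OF r]
    using lborel_integral_real_affine[of "-1" "\<lambda>u. indicator {-r..x} u * (exp u * Dw r 1 u)" x] by simp
  also have "\<dots> = (LBINT v. exp x * (indicator {0..} v * exp (- 1 * v) * Dw r 1 (x - v)))"
  proof (intro Bochner_Integration.integral_cong refl)
    fix v
    have "exp (x - v) = exp x * exp (- 1 * v)" by (simp add: exp_diff exp_minus divide_inverse)
    moreover have "indicator {-r..x} (x - v) * Dw r 1 (x - v) = indicator {0..} v * Dw r 1 (x - v)"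
      using Dw_neg[OF r, of "x - v" 1] by (cases "x - v < - r") (auto simp: indicator_def)
    ultimately show "indicator {-r..x} (x - v) * (exp (x - v) * Dw r 1 (x - v)) =
      exp x * (indicator {0..} v * exp (- 1 * v) * Dw r 1 (x - v))" by (simp add: mult_ac)
  qed
  finally show ?thesis by simp
qed

text \<open>The substitution u = (\<sigma> - 1) x turns (\<sigma> - 1) U(\<sigma>) into \<sigma>
  times the integral of e^(-u) T(u / (\<sigma> - 1)), where the argument of T tends to infinity for
  every u > 0.\<close>

lemma abel_limit:
  assumes B: "\<And>x. \<bar>Tw 1 x\<bar> \<le> B" and lim: "(Tw 1 \<longlongrightarrow> a) at_top"
  shows "((\<lambda>\<sigma>. (\<sigma> - 1) * Uh \<sigma> 0) \<longlongrightarrow> a) (at_right 1)"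
proof -
  let ?e = "\<lambda>u::real. indicator {0..} u * exp (- 1 * u)"
  have "((\<lambda>s. LBINT u. ?e u * Tw 1 (s * u)) \<longlongrightarrow> (LBINT u. ?e u * a)) at_top"
  proof (rule integral_dominated_convergence_at_top)
    show "integrable lborel (\<lambda>u. ?e u * B)" using exp_decay_integral(1)[of 1] by (intro integrable_mult_left) simp
    show "\<forall>\<^sub>F s in at_top. AE u in lborel. norm (?e u * Tw 1 (s * u)) \<le> ?e u * B"
      using B by (intro always_eventually allI AE_I2) (auto simp: abs_mult indicator_def)
    have pt: "((\<lambda>s. ?e u * Tw 1 (s * u)) \<longlongrightarrow> ?e u * a) at_top" if "u \<noteq> 0" for u
    proof (cases "u > 0")
      case True
      have "filterlim (\<lambda>s. s * u) at_top at_top"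
        using True by (intro filterlim_at_top_mult_tendsto_pos[OF tendsto_const]) (auto simp: filterlim_ident)
      from filterlim_compose[OF lim this] show ?thesis by (intro tendsto_mult_left)
    next
      case False
      then show ?thesis using that by (simp add: indicator_def)
    qed
    show "AE u in lborel. ((\<lambda>s. ?e u * Tw 1 (s * u)) \<longlongrightarrow> ?e u * a) at_top"
      using AE_lborel_singleton[of "0::real"] by eventually_elim (rule pt)
  qed simp_all
  then have lim1: "((\<lambda>s. LBINT u. ?e u * Tw 1 (s * u)) \<longlongrightarrow> a) at_top"
    using exp_decay_integral(2)[of 1] by simp
  have "filterlim (\<lambda>\<sigma>::real. 1 / (\<sigma> - 1)) at_top (at_right 1)" by real_asymp
  from filterlim_compose[OF lim1 this]
  have "((\<lambda>\<sigma>. \<sigma> * (LBINT u. ?e u * Tw 1 (1 / (\<sigma> - 1) * u))) \<longlongrightarrow> 1 * a) (at_right 1)"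
    by (intro tendsto_mult tendsto_ident_at)
  moreover have "\<forall>\<^sub>F \<sigma> in at_right 1. \<sigma> * (LBINT u. ?e u * Tw 1 (1 / (\<sigma> - 1) * u)) = (\<sigma> - 1) * Uh \<sigma> 0"
    using eventually_at_right_less[of 1]
  proof eventually_elim
    case (elim \<sigma>)
    have "(LBINT u. ?e u * Tw 1 (1 / (\<sigma> - 1) * u)) =
      (\<sigma> - 1) * (LBINT x. ?e ((\<sigma> - 1) * x) * Tw 1 x)"
      using lborel_integral_real_affine[of "\<sigma> - 1" "\<lambda>u. ?e u * Tw 1 (1 / (\<sigma> - 1) * u)" 0] elim by simp
    also have "(LBINT x. ?e ((\<sigma> - 1) * x) * Tw 1 x) = (LBINT x. exp (- \<sigma> * x) * E x)"
    proof (intro Bochner_Integration.integral_cong refl)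
      fix x
      show "?e ((\<sigma> - 1) * x) * Tw 1 x = exp (- \<sigma> * x) * E x"
      proof (cases "x < 0")
        case False
        then have "(\<sigma> - 1) * x \<in> {0..}" using elim by simp
        moreover have "exp (- 1 * ((\<sigma> - 1) * x)) * exp (- 1 * x) = exp (- \<sigma> * x)"
          by (simp add: algebra_simps flip: exp_add)
        ultimately show ?thesis by (simp add: Tw_def flip: mult.assoc)
      qed (simp add: Tw_neg neg)
    qed
    finally have "(LBINT u. ?e u * Tw 1 (1 / (\<sigma> - 1) * u)) = (\<sigma> - 1) * (LBINT x. exp (- \<sigma> * x) * E x)" .
    moreover have "Uh \<sigma> 0 = \<sigma> * (LBINT x. exp (- \<sigma> * x) * E x)"
      unfolding Uh_def by (simp add: mult.commute)
    ultimately show ?case by simp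
  qed
  ultimately show ?thesis by (simp add: Lim_transform_eventually)
qed

end

section \<open>Fejer means at \<sigma> = 1 and the passage to pointwise convergence\<close>

context tauber
begin

text \<open>The boundary sequence, and with it c, is fixed at the outset; the window r and the
  dilation l are chosen afterwards, depending on the tolerance. This works because the limits of the
  Fejer means do not depend on l and are linear in r.\<close>

lemma Tw_converges: "\<exists>a. (Tw 1 \<longlongrightarrow> a) at_top"
proof -
  obtain B where B0: "B \<ge> 0" and B: "\<And>x. \<bar>Tw 1 x\<bar> \<le> B" using Tw_bounded by blast
  obtain \<sigma> c where \<sigma>: "\<And>n. 1 < \<sigma> n" "\<And>n. \<sigma> n \<le> 2" "\<sigma> \<longlonglongrightarrow> 1"
    and bm: "\<And>\<Lambda> \<psi> B. \<Lambda> > 0 \<Longrightarrow> \<psi> \<in> borel_measurable borel \<Longrightarrow> (\<And>t. \<bar>\<psi> t\<bar> \<le> B) \<Longrightarrow> isCont \<psi> 0 \<Longrightarrow>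
       (\<lambda>n. LBINT t. indicator {-\<Lambda>..\<Lambda>} t * (\<psi> t * Uh (\<sigma> n) t)) \<longlonglongrightarrow>
         (LBINT t. indicator {-\<Lambda>..\<Lambda>} t * (\<psi> t * f t)) + c * \<psi> 0"
  proof (rule boundary_measure, goal_cases)
    case (1 \<sigma> c)
    show ?case by (rule 1(1)[of \<sigma> c]) (rule 1(2), rule 1(3), rule 1(4), rule 1(5))
  qed
  \<comment> \<open>Boundedness of T dominates the increments uniformly in \<sigma>, so the Fejer
    identity passes to \<sigma> = 1 as an equality.\<close>
  have identity: "(LBINT v. Dw r 1 v * sym_fej l y v) =
      (LBINT t. indicator {-l..l} t * (tri (t / l) * cos (t * y) * window_mult r t * f t)) + c * (2 * r)"
    if r: "r > 0" and l: "l > 0" for r l y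
  proof (rule LIMSEQ_unique)
    let ?B = "2 * B + 4 * r * B"
    let ?w = "\<lambda>t. tri (t / l) * cos (t * y) * window_mult r t"
    have "(\<lambda>n. LBINT v. Dw r (\<sigma> n) v * sym_fej l y v) \<longlonglongrightarrow> (LBINT v. Dw r 1 v * sym_fej l y v)"
    proof (rule integral_dominated_convergence)
      show "integrable lborel (\<lambda>v. ?B * sym_fej l y v)" using integrable_sym_fej[OF l] by simp
      show "AE v in lborel. (\<lambda>n. Dw r (\<sigma> n) v * sym_fej l y v) \<longlonglongrightarrow> Dw r 1 v * sym_fej l y v"
        using less_imp_le[OF less_trans[OF zero_less_one \<sigma>(1)]]
        by (intro AE_I2 tendsto_mult_right Dw_tendsto \<sigma> r)
      show "AE v in lborel. norm (Dw r (\<sigma> n) v * sym_fej l y v) \<le> ?B * sym_fej l y v" for n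
      proof (intro AE_I2)
        fix v
        have "\<bar>Dw r (\<sigma> n) v\<bar> \<le> ?B" using Dw_bound_ge1[OF B r less_imp_le[OF \<sigma>(1)] \<sigma>(2)] .
        then have "\<bar>Dw r (\<sigma> n) v\<bar> * sym_fej l y v \<le> ?B * sym_fej l y v"
          by (intro mult_right_mono sym_fej_nonneg l)
        then show "norm (Dw r (\<sigma> n) v * sym_fej l y v) \<le> ?B * sym_fej l y v"
          using sym_fej_nonneg[OF l] by (simp add: abs_mult)
      qed
    qed simp_all
    then show "(\<lambda>n. LBINT t. indicator {-l..l} t * (?w t * Uh (\<sigma> n) t)) \<longlonglongrightarrow> (LBINT v. Dw r 1 v * sym_fej l y v)"
      using fejer_identity[OF \<sigma>(1) r l] by simp
    have wc: "isCont ?w 0"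
      by (intro continuous_intros isCont_window_mult isCont_o2[OF _ continuous_on_interior[OF continuous_on_tri[of UNIV]]])
        (use l in auto)
    have w0: "?w 0 = 2 * r" by (simp add: tri_def window_mult_def)
    show "(\<lambda>n. LBINT t. indicator {-l..l} t * (?w t * Uh (\<sigma> n) t)) \<longlonglongrightarrow>
      (LBINT t. indicator {-l..l} t * (?w t * f t)) + c * (2 * r)"
      using bm[OF l fejer_test_measurable fejer_test_bound[OF r] wc] unfolding w0 .
  qed
  have sym_lim: "((\<lambda>y. LBINT v. Dw r 1 v * sym_fej l y v) \<longlongrightarrow> c * (2 * r)) at_top" if r: "r > 0" and l: "l > 0" for r l
  proof -
    \<comment> \<open>The factor \<open>cos (t * 0)\<close> is 1 and keeps the shape of the test
      functions, so that their bound applies with y = 0. The oscillating cosine is left to the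
      Riemann-Lebesgue lemma, after which only the point mass remains.\<close>
    let ?g = "\<lambda>t. indicator {-l..l} t * ((tri (t / l) * cos (t * 0) * window_mult r t) * f t)"
    have "((\<lambda>y. LBINT t. ?g t * cos (y * t)) \<longlongrightarrow> 0) at_top"
      by (intro riemann_lebesgue_cos integrable_weight(2)[OF fejer_test_measurable fejer_test_bound[OF r]])
    moreover have "(LBINT t. ?g t * cos (y * t)) =
      (LBINT t. indicator {-l..l} t * (tri (t / l) * cos (t * y) * window_mult r t * f t))" for y
      by (intro Bochner_Integration.integral_cong refl) (simp add: mult_ac)
    ultimately have "((\<lambda>y. (LBINT t. indicator {-l..l} t * (tri (t / l) * cos (t * y) * window_mult r t * f t)) + c * (2 * r))
       \<longlongrightarrow> 0 + c * (2 * r)) at_top"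
      by (intro tendsto_add tendsto_const) simp
    then show ?thesis unfolding identity[OF r l] by simp
  qed
  have conv_lim: "((\<lambda>y. LBINT v. Dw r 1 v * fej l (v - y)) \<longlongrightarrow> 4 * r * c) at_top"
    and conv_bound: "\<bar>LBINT v. Dw r 1 v * fej l (v - y)\<bar> \<le> (2 * B + 4 * r * B) * fejer_mass"
    if r: "r > 0" and l: "l > 0" for r l y
  proof -
    let ?B = "2 * B + 4 * r * B"
    have Bn: "?B \<ge> 0" using B0 r by simp
    have D: "\<bar>Dw r 1 v\<bar> \<le> ?B" for v using Dw_bound_ge1[OF B r, of 1] by simp
    have int: "integrable lborel (\<lambda>v. Dw r 1 v * fej l (v - y))" "integrable lborel (\<lambda>v. Dw r 1 v * fej l (v + y))" for y
      using integrable_mult_bounded[OF integrable_fej_shift(1)[OF l] Dw_measurable[of r 1] D]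
        integrable_mult_bounded[OF integrable_fej_shift(2)[OF l] Dw_measurable[of r 1] D] by (simp_all add: mult.commute)
    show "\<bar>LBINT v. Dw r 1 v * fej l (v - y)\<bar> \<le> ?B * fejer_mass"
    proof -
      have "\<bar>LBINT v. Dw r 1 v * fej l (v - y)\<bar> \<le> (LBINT v. ?B * fej l (v - y))"
        using D fej_nonneg[OF l] integrable_fej_shift[OF l]
        by (intro Bochner_Integration.integral_abs_bound_integral int integrable_mult_right)
          (auto simp: abs_mult intro!: mult_right_mono)
      then show ?thesis using integral_fej_shift[OF l] by simp
    qed
    \<comment> \<open>The mirrored kernel is centred at -y, while D vanishes left of -r; only kernel
      mass beyond y - r is met.\<close>
    have refl: "((\<lambda>y. LBINT v. Dw r 1 v * fej l (v + y)) \<longlongrightarrow> 0) at_top"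
    proof (rule Lim_null_comparison)
      have "((\<lambda>y. LBINT u. indicator {y - r..} u * fej l u) \<longlongrightarrow> (\<integral>u. 0 \<partial>(lborel :: real measure))) at_top"
      proof (rule integral_dominated_convergence_at_top)
        show "integrable lborel (fej l)" by (rule integrable_fej[OF l])
        show "\<forall>\<^sub>F y in at_top. AE u in lborel. norm (indicator {y - r..} u * fej l u) \<le> fej l u"
          using fej_nonneg[OF l] by (intro always_eventually allI AE_I2) (auto simp: indicator_def)
        have "((\<lambda>y. indicator {y - r..} u * fej l u) \<longlongrightarrow> 0) at_top" for u
          by (intro tendsto_eventually eventually_mono[OF eventually_gt_at_top[of "u + r"]]) auto
        then show "AE u in lborel. ((\<lambda>y. indicator {y - r..} u * fej l u) \<longlongrightarrow> 0) at_top" by (intro AE_I2)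
      qed simp_all
      then show "((\<lambda>y. ?B * (LBINT u. indicator {y - r..} u * fej l u)) \<longlongrightarrow> 0) at_top"
        by (auto intro!: tendsto_eq_intros)
      have "\<bar>LBINT v. Dw r 1 v * fej l (v + y)\<bar> \<le> ?B * (LBINT u. indicator {y - r..} u * fej l u)" for y
      proof -
        have i: "integrable lborel (\<lambda>u. indicator {y - r..} u * fej l u)"
          using integrable_mult_indicator[OF _ integrable_fej[OF l], of "{y - r..}"] by simp
        have sh: "(LBINT u. indicator {y - r..} u * fej l u) = (LBINT v. indicator {y - r..} (v + y) * fej l (v + y))"
          using lborel_integral_real_affine[of 1 "\<lambda>u. indicator {y - r..} u * fej l u" y] by (simp add: add.commute)
        have ish: "integrable lborel (\<lambda>v. indicator {y - r..} (v + y) * fej l (v + y))"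
          using lborel_integrable_real_affine[OF i, of 1 y] by (simp add: add.commute)
        have "\<bar>LBINT v. Dw r 1 v * fej l (v + y)\<bar> \<le> (LBINT v. ?B * (indicator {y - r..} (v + y) * fej l (v + y)))"
        proof (intro Bochner_Integration.integral_abs_bound_integral int integrable_mult_right ish)
          fix v
          show "\<bar>Dw r 1 v * fej l (v + y)\<bar> \<le> ?B * (indicator {y - r..} (v + y) * fej l (v + y))"
          proof (cases "v < - r")
            case True
            then show ?thesis using Dw_neg[OF r True] Bn fej_nonneg[OF l] by (simp add: indicator_def)
          next
            case False
            then have "v + y \<in> {y - r..}" by simp
            moreover have "\<bar>Dw r 1 v\<bar> * fej l (v + y) \<le> ?B * fej l (v + y)"
              by (intro mult_right_mono D fej_nonneg l)
            ultimately show ?thesis using fej_nonneg[OF l] by (simp add: abs_mult)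
          qed
        qed
        then show ?thesis unfolding sh by simp
      qed
      then show "\<forall>\<^sub>F y in at_top. norm (LBINT v. Dw r 1 v * fej l (v + y)) \<le> ?B * (LBINT u. indicator {y - r..} u * fej l u)"
        by (intro always_eventually allI) simp
    qed
    have "(LBINT v. Dw r 1 v * fej l (v - y)) = 2 * (LBINT v. Dw r 1 v * sym_fej l y v) - (LBINT v. Dw r 1 v * fej l (v + y))" for y
    proof -
      have "(LBINT v. Dw r 1 v * sym_fej l y v) = (LBINT v. (Dw r 1 v * fej l (v - y) + Dw r 1 v * fej l (v + y)) / 2)"
        unfolding sym_fej_def by (simp add: distrib_left add_divide_distrib)
      also have "\<dots> = ((LBINT v. Dw r 1 v * fej l (v - y)) + (LBINT v. Dw r 1 v * fej l (v + y))) / 2"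
        using int[of y] by simp
      finally show ?thesis by simp
    qed
    moreover have "((\<lambda>y. 2 * (LBINT v. Dw r 1 v * sym_fej l y v) - (LBINT v. Dw r 1 v * fej l (v + y)))
       \<longlongrightarrow> 2 * (c * (2 * r)) - 0) at_top"
      by (intro tendsto_diff tendsto_mult_left sym_lim refl r l)
    ultimately show "((\<lambda>y. LBINT v. Dw r 1 v * fej l (v - y)) \<longlongrightarrow> 4 * r * c) at_top"
      by (simp add: mult_ac)
  qed
  \<comment> \<open>Fubini moves the exponential average outside; for each delay v the inner mean is
    that of D at y - v, with the same limit. The exponential density has mass 1, so the limit is
    unchanged.\<close>
  have Z_lim: "((\<lambda>y. LBINT x. fej l (x - y) * Zw r 1 x) \<longlongrightarrow> 4 * r * c) at_top" if r: "r > 0" and l: "l > 0" for r l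
  proof -
    let ?B = "2 * B + 4 * r * B" and ?e = "\<lambda>v::real. indicator {0..} v * exp (- 1 * v)"
    let ?w = "\<lambda>y. LBINT v. Dw r 1 v * fej l (v - y)"
    have ei: "integrable lborel ?e" using exp_decay_integral(1)[of 1] by simp
    have "(LBINT x. fej l (x - y) * Zw r 1 x) = (LBINT v. ?e v * ?w (y - v))" for y
    proof -
      have K: "(\<lambda>(x, v). Dw r 1 (x - v)) \<in> borel_measurable (borel \<Otimes>\<^sub>M borel)" by measurable
      have K1: "\<bar>(\<lambda>(x, v). Dw r 1 (x - v)) z\<bar> \<le> ?B" for z
        using Dw_bound_ge1[OF B r, of 1] by (cases z) simp
      have "(LBINT x. fej l (x - y) * Zw r 1 x) =
         (LBINT x. fej l (x - y) * (LBINT v. ?e v * (\<lambda>(x, v). Dw r 1 (x - v)) (x, v)))"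
        unfolding Zw_eq_exp_average[OF r] by simp
      also have "\<dots> = (LBINT v. ?e v * (LBINT x. fej l (x - y) * (\<lambda>(x, v). Dw r 1 (x - v)) (x, v)))"
        by (rule fubini_kernel(1)[OF integrable_fej_shift(1)[OF l] ei K K1])
      also have "\<dots> = (LBINT v. ?e v * ?w (y - v))"
      proof -
        have "(LBINT x. fej l (x - y) * (\<lambda>(x, v). Dw r 1 (x - v)) (x, v)) = ?w (y - v)" for v
          using lborel_integral_real_affine[of 1 "\<lambda>x. fej l (x - y) * Dw r 1 (x - v)" v]
          by (simp add: algebra_simps)
        then show ?thesis by (simp only:)
      qed
      finally show ?thesis .
    qed
    moreover have "((\<lambda>y. LBINT v. ?e v * ?w (y - v)) \<longlongrightarrow> (LBINT v. ?e v * (4 * r * c))) at_top"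
    proof (rule integral_dominated_convergence_at_top)
      show "integrable lborel (\<lambda>v. ?e v * (?B * fejer_mass))" by (intro integrable_mult_left ei)
      show "\<forall>\<^sub>F y in at_top. AE v in lborel. norm (?e v * ?w (y - v)) \<le> ?e v * (?B * fejer_mass)"
        using conv_bound[OF r l] by (intro always_eventually allI AE_I2) (auto simp: abs_mult indicator_def)
      have "((\<lambda>y. ?w (y - v)) \<longlongrightarrow> 4 * r * c) at_top" for v
      proof (rule filterlim_compose[OF conv_lim[OF r l]])
        show "filterlim (\<lambda>y. y - v) at_top at_top"
          using filterlim_tendsto_add_at_top[OF tendsto_const[of "-v"] filterlim_ident] by simp
      qed
      then show "AE v in lborel. ((\<lambda>y. ?e v * ?w (y - v)) \<longlongrightarrow> ?e v * (4 * r * c)) at_top"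
        by (intro AE_I2 tendsto_mult_left)
      show "(\<lambda>v. ?e v * ?w (y - v)) \<in> borel_measurable lborel" for y
      proof -
        have [measurable]: "?w \<in> borel_measurable borel" by measurable
        show ?thesis by measurable
      qed
    qed simp_all
    ultimately show ?thesis using exp_decay_integral(2)[of 1] by simp
  qed
  let ?\<kappa> = fejer_mass
  \<comment> \<open>If T tends to a, then Z tends to 2 r a and its Fejer means to 2 r a times the
    kernel mass; equating this with 4 r c determines a.\<close>
  define a where "a = 2 * c / ?\<kappa>"
  have \<kappa>: "?\<kappa> > 0" by (rule fejer_mass_pos)
  have "(Tw 1 \<longlongrightarrow> a) at_top"
  proof (rule tendstoI)
    fix e :: real assume e: "e > 0"
    \<comment> \<open>The error budget: 2\<epsilon> from slow decrease of T, one \<epsilon> from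
      convergence of the Fejer means, and 2 B \<epsilon> / \<kappa> from the kernel tails. A fourth
      \<epsilon> makes the inequality strict.\<close>
    define \<epsilon> where "\<epsilon> = e / (4 + 2 * B / ?\<kappa>)"
    have den: "4 + 2 * B / ?\<kappa> > 0" using B0 \<kappa> by (simp add: add_pos_nonneg)
    have \<epsilon>: "\<epsilon> > 0" using e den by (simp add: \<epsilon>_def)
    have \<epsilon>_eq: "4 * \<epsilon> + 2 * B / ?\<kappa> * \<epsilon> = e"
    proof -
      have "(4 + 2 * B / ?\<kappa>) * \<epsilon> = e" unfolding \<epsilon>_def using less_imp_neq[OF den] by simp
      then show ?thesis by (simp only: distrib_right)
    qed
    obtain h x0 where h: "h > 0" "x0 > 0" "\<And>x y. x0 \<le> x \<Longrightarrow> x \<le> y \<Longrightarrow> y \<le> x + h \<Longrightarrow> E y - E x \<ge> - \<epsilon> * exp x"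
      using slow[OF \<epsilon>] by blast
    \<comment> \<open>Comparisons will run over distances up to 4 r. These must stay within the
      range h of slow decrease and change the weight e^(-x) so little that a T bounded by B moves by
      at most \<epsilon>.\<close>
    define r where "r = min (h / 4) (\<epsilon> / (B + 1) / 4)"
    have r: "r > 0" "4 * r \<le> h" using h \<epsilon> B0 by (auto simp: r_def)
    have rB: "B * (4 * r) \<le> \<epsilon>"
    proof -
      have "r \<le> \<epsilon> / (B + 1) / 4" unfolding r_def by (rule min.cobounded2)
      then have "4 * r \<le> \<epsilon> / (B + 1)" by (simp only: le_divide_eq_numeral1 mult.commute)
      then have "B * (4 * r) \<le> B * (\<epsilon> / (B + 1))" using B0 by (intro mult_left_mono)
      also have "\<dots> \<le> \<epsilon>" using B0 \<epsilon> by (simp add: field_simps)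
      finally show ?thesis .
    qed
    \<comment> \<open>Slow decrease for T: one \<epsilon> is the loss of E, damped by e^(x-y) \<le>
      1; the other comes from replacing e^(-y) by e^(-x).\<close>
    have Ts: "Tw 1 y \<ge> Tw 1 x - 2 * \<epsilon>" if xy: "x0 \<le> x" "x \<le> y" "y \<le> x + 4 * r" for x y
    proof -
      have "exp (- y) * (E y - E x) \<ge> exp (- y) * (- \<epsilon> * exp x)"
        using h(3)[of x y] xy r by (intro mult_left_mono) auto
      moreover have "exp (- y) * (\<epsilon> * exp x) \<le> \<epsilon>"
      proof -
        have "exp (- y) * exp x \<le> 1" using xy by (simp flip: exp_add)
        then have "\<epsilon> * (exp (- y) * exp x) \<le> \<epsilon> * 1" using \<epsilon> by (intro mult_left_mono) auto
        then show ?thesis by (simp add: mult_ac)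
      qed
      moreover have "exp (- y) * E x = exp (x - y) * Tw 1 x" by (simp add: Tw_def flip: exp_add mult.assoc)
      moreover have "exp (x - y) * Tw 1 x \<ge> Tw 1 x - \<epsilon>"
      proof -
        have "0 \<le> 1 - exp (x - y)" using xy by simp
        moreover have "1 - z \<le> 4 * r" if "1 + (x - y) \<le> z" for z using that xy by simp
        from this[OF exp_ge_add_one_self] have "1 - exp (x - y) \<le> 4 * r" .
        ultimately have "(1 - exp (x - y)) * \<bar>Tw 1 x\<bar> \<le> (4 * r) * B"
          using B[of x] r by (intro mult_mono) auto
        moreover have "(1 - exp (x - y)) * Tw 1 x \<le> (1 - exp (x - y)) * \<bar>Tw 1 x\<bar>"
          using xy by (intro mult_left_mono) auto
        ultimately have "(1 - exp (x - y)) * Tw 1 x \<le> (4 * r) * B" by (rule order.trans[rotated])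
        then show ?thesis using rB by (simp add: algebra_simps)
      qed
      ultimately show ?thesis by (simp add: Tw_def right_diff_distrib)
    qed
    \<comment> \<open>Only now is l chosen, large enough for the kernel to concentrate within the
      window radius r.\<close>
    have "\<forall>\<^sub>F l in at_top. (LBINT x. indicator (- {-r..r}) x * fej l x) < \<epsilon>"
      using fej_tail[OF r(1)] \<epsilon> by (rule order_tendstoD(2))
    then have "\<forall>\<^sub>F l in at_top. (LBINT x. indicator (- {-r..r}) x * fej l x) < \<epsilon> \<and> l > 0"
      using eventually_gt_at_top[of 0] by eventually_elim auto
    then obtain l where l: "l > 0" "(LBINT x. indicator (- {-r..r}) x * fej l x) < \<epsilon>"
      using eventually_happens'[OF trivial_limit_at_top_linorder] by blast
    define Q where "Q y = (LBINT x. fej l (x - y) * Zw r 1 x)" for y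
    have Zb: "\<bar>Zw r 1 x\<bar> \<le> 2 * r * B" for x by (intro Zw_abs_le r B)
    have Qi: "integrable lborel (\<lambda>x. fej l (x - y) * Zw r 1 x)" for y
      by (rule integrable_mult_bounded[OF integrable_fej_shift(1)[OF l(1)] _ Zb]) simp
    let ?o = "\<lambda>y x. indicator (- {-r..r}) (x - y) * fej l (x - y)"
    have oi0: "integrable lborel (\<lambda>x. indicator (- {-r..r}) x * fej l x)"
      using integrable_mult_indicator[OF _ integrable_fej[OF l(1)], of "- {-r..r}"] by simp
    have oi: "integrable lborel (?o y)" for y
      using lborel_integrable_real_affine[OF oi0, of 1 "-y"] by (simp add: add.commute)
    have oI: "(LBINT x. ?o y x) \<le> \<epsilon>" for y
      using lborel_integral_real_affine[of 1 "\<lambda>x. indicator (- {-r..r}) x * fej l x" "-y"] l(2) by (simp add: add.commute)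
    have ti: "integrable lborel (\<lambda>w. indicator {a..b} w * Tw 1 w)" for a b by (rule integrable_Tw_Icc) simp
    have ci: "integrable lborel (\<lambda>w. indicator {a..b} w * k)" for a b k :: real
      by (intro integrable_continuous_Icc continuous_intros)
    have main_int: "(LBINT x. fej l (x - y) * k + ?o y x * m) = ?\<kappa> * k + (LBINT x. ?o y x) * m"
      "integrable lborel (\<lambda>x. fej l (x - y) * k + ?o y x * m)" for y k m
      using oi[of y] integrable_fej_shift(1)[OF l(1), of y] integral_fej_shift(1)[OF l(1), of y] by simp_all
    \<comment> \<open>Centring the kernel at x + 2r puts its core in [x + r, x + 3r], and windows
      around core points in [x, x + 4r], where T is at least T(x) - 2\<epsilon>.\<close>
    have up: "Tw 1 x \<le> 2 * \<epsilon> + Q (x + 2 * r) / (2 * r * ?\<kappa>) + 2 * B / ?\<kappa> * \<epsilon>" if x: "x \<ge> x0" for x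
    proof -
      let ?k = "2 * r * (Tw 1 x - 2 * \<epsilon>)"
      have "?\<kappa> * ?k + (LBINT v. ?o (x + 2 * r) v) * (- (4 * r * B)) \<le> Q (x + 2 * r)"
        unfolding main_int(1)[symmetric] Q_def
      proof (rule integral_mono[OF main_int(2) Qi])
        fix v
        let ?y = "x + 2 * r"
        have f0: "fej l (v - ?y) \<ge> 0" by (rule fej_nonneg[OF l(1)])
        show "fej l (v - ?y) * ?k + ?o ?y v * (- (4 * r * B)) \<le> fej l (v - ?y) * Zw r 1 v"
        proof (cases "v - ?y \<in> {-r..r}")
          case True
          have "?k = (LBINT w. indicator {v - r..v + r} w * (Tw 1 x - 2 * \<epsilon>))" using r by simp
          also have "\<dots> \<le> Zw r 1 v"
            unfolding Zw_def
          proof (rule integral_mono[OF ci ti])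
            fix w
            show "indicator {v - r..v + r} w * (Tw 1 x - 2 * \<epsilon>) \<le> indicator {v - r..v + r} w * Tw 1 w"
              using Ts[of x w] x True by (auto simp: indicator_def)
          qed
          finally have "fej l (v - ?y) * ?k \<le> fej l (v - ?y) * Zw r 1 v" using f0 by (intro mult_left_mono)
          then show ?thesis using True by simp
        next
          case False
          \<comment> \<open>Outside the core only boundedness is available: both sides of the
            comparison are controlled by 2 r B, so the deficit is at most 4 r B, weighted by the
            small tail mass.\<close>
          have "2 * r * (Tw 1 x - 2 * \<epsilon>) \<le> 2 * r * B" using B[of x] \<epsilon> r by (intro mult_left_mono) (auto simp: abs_le_iff)
          then have "?k - 4 * r * B \<le> Zw r 1 v" using Zb[of v] by (auto simp: abs_le_iff)
          then have "fej l (v - ?y) * (?k - 4 * r * B) \<le> fej l (v - ?y) * Zw r 1 v" using f0 by (intro mult_left_mono)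
          then show ?thesis using False by (simp add: algebra_simps)
        qed
      qed
      moreover have "(LBINT v. ?o (x + 2 * r) v) * (4 * r * B) \<le> \<epsilon> * (4 * r * B)"
        using r B0 by (intro mult_right_mono oI) auto
      ultimately have "?\<kappa> * ?k \<le> Q (x + 2 * r) + \<epsilon> * (4 * r * B)" by simp
      then show ?thesis using \<kappa> r by (simp add: field_simps)
    qed
    \<comment> \<open>The mirrored comparison: the kernel sits at x - 2r and the windows of its core
      fill [x - 4r, x], where T is at most T(x) + 2\<epsilon>.\<close>
    have lo: "Tw 1 x \<ge> - 2 * \<epsilon> + Q (x - 2 * r) / (2 * r * ?\<kappa>) - 2 * B / ?\<kappa> * \<epsilon>" if x: "x \<ge> x0 + 4 * r" for x
    proof -
      let ?k = "2 * r * (Tw 1 x + 2 * \<epsilon>)"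
      have "Q (x - 2 * r) \<le> ?\<kappa> * ?k + (LBINT v. ?o (x - 2 * r) v) * (4 * r * B)"
        unfolding main_int(1)[symmetric] Q_def
      proof (rule integral_mono[OF Qi main_int(2)])
        fix v
        let ?y = "x - 2 * r"
        have f0: "fej l (v - ?y) \<ge> 0" by (rule fej_nonneg[OF l(1)])
        show "fej l (v - ?y) * Zw r 1 v \<le> fej l (v - ?y) * ?k + ?o ?y v * (4 * r * B)"
        proof (cases "v - ?y \<in> {-r..r}")
          case True
          have "Zw r 1 v \<le> (LBINT w. indicator {v - r..v + r} w * (Tw 1 x + 2 * \<epsilon>))"
            unfolding Zw_def
          proof (rule integral_mono[OF ti ci])
            fix w
            show "indicator {v - r..v + r} w * Tw 1 w \<le> indicator {v - r..v + r} w * (Tw 1 x + 2 * \<epsilon>)"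
              using Ts[of w x] x True by (auto simp: indicator_def)
          qed
          also have "\<dots> = ?k" using r by simp
          finally have "fej l (v - ?y) * Zw r 1 v \<le> fej l (v - ?y) * ?k" using f0 by (intro mult_left_mono)
          then show ?thesis using True by simp
        next
          case False
          have "2 * r * (- (Tw 1 x + 2 * \<epsilon>)) \<le> 2 * r * B" using B[of x] \<epsilon> r by (intro mult_left_mono) (auto simp: abs_le_iff)
          moreover have "2 * r * (- (Tw 1 x + 2 * \<epsilon>)) = - ?k" "4 * r * B = 2 * r * B + 2 * r * B" by (auto simp: algebra_simps)
          moreover have "Zw r 1 v \<le> 2 * r * B" using Zb[of v] by (simp add: abs_le_iff)
          ultimately have "Zw r 1 v \<le> ?k + 4 * r * B" by linarith
          then have "fej l (v - ?y) * Zw r 1 v \<le> fej l (v - ?y) * (?k + 4 * r * B)" using f0 by (intro mult_left_mono)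
          then show ?thesis using False by (simp add: algebra_simps)
        qed
      qed
      moreover have "(LBINT v. ?o (x - 2 * r) v) * (4 * r * B) \<le> \<epsilon> * (4 * r * B)"
        using r B0 by (intro mult_right_mono oI) auto
      ultimately have "Q (x - 2 * r) \<le> ?\<kappa> * ?k + \<epsilon> * (4 * r * B)" by simp
      then have "Q (x - 2 * r) / (2 * r * ?\<kappa>) \<le> (?\<kappa> * ?k + \<epsilon> * (4 * r * B)) / (2 * r * ?\<kappa>)"
        using \<kappa> r by (intro divide_right_mono) auto
      also have "\<dots> = Tw 1 x + 2 * \<epsilon> + 2 * B / ?\<kappa> * \<epsilon>"
        using \<kappa> r by (simp add: field_simps)
      finally show ?thesis by simp
    qed
    have "((\<lambda>y. Q y / (2 * r * ?\<kappa>)) \<longlongrightarrow> 4 * r * c / (2 * r * ?\<kappa>)) at_top"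
      unfolding Q_def using \<kappa> r by (intro tendsto_divide tendsto_const Z_lim l) auto
    also have "4 * r * c / (2 * r * ?\<kappa>) = a" using r by (simp add: a_def)
    finally have Ql: "((\<lambda>y. Q y / (2 * r * ?\<kappa>)) \<longlongrightarrow> a) at_top" .
    have "((\<lambda>x. Q (x + k) / (2 * r * ?\<kappa>)) \<longlongrightarrow> a) at_top" for k
      by (rule filterlim_compose[OF Ql])
        (use filterlim_tendsto_add_at_top[OF tendsto_const[of k] filterlim_ident] in \<open>simp add: add.commute\<close>)
    then have ev: "\<forall>\<^sub>F x in at_top. dist (Q (x + k) / (2 * r * ?\<kappa>)) a < \<epsilon>" for k
      using \<epsilon> by (rule tendstoD)
    show "\<forall>\<^sub>F x in at_top. dist (Tw 1 x) a < e"
      using ev[of "2 * r"] ev[of "- (2 * r)"] eventually_ge_at_top[of "x0 + 4 * r"]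
    proof eventually_elim
      case (elim x)
      have "Tw 1 x - a \<le> 3 * \<epsilon> + 2 * B / ?\<kappa> * \<epsilon>"
        using up[of x] elim(1,3) r unfolding dist_real_def by auto
      moreover have "a - Tw 1 x \<le> 3 * \<epsilon> + 2 * B / ?\<kappa> * \<epsilon>"
        using lo[of x] elim(2,3) unfolding dist_real_def by auto
      moreover have "3 * \<epsilon> + 2 * B / ?\<kappa> * \<epsilon> < e" using \<epsilon>_eq \<epsilon> by linarith
      ultimately show ?case unfolding dist_real_def by linarith
    qed
  qed
  then show ?thesis by blast
qed

end

section \<open>Reduction of the three boundary conditions to a local L^1 bound, and the asymptotic
  relation\<close>

theorem theorem1p3:
  fixes S :: "real \<Rightarrow> real" and U :: "complex \<Rightarrow> real" and lam :: real
  assumes bv: "local_bv_nonneg S"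
    and rc: "\<forall>x\<ge>0. continuous (at_right x) S"
    and slow: "log_linearly_slowly_decreasing S"
    and conv: "\<forall>s. Re s > 1 \<longrightarrow> laplace_converges S s"
    and U_def: "\<forall>s. Re s > 1 \<longrightarrow> U s = Re (laplace_dS S s)"
    and boundary: "\<exists>f :: real \<Rightarrow> real.
        (\<forall>a b. a \<le> b \<and> {a..b} \<subseteq> - {0} \<longrightarrow> set_integrable lborel {a..b} f) \<and>
        (\<forall>a b. a \<le> b \<and> {a..b} \<subseteq> - {0} \<longrightarrow>
           ((\<lambda>\<sigma>. LINT t:{a..b}|lborel. \<bar>U (Complex \<sigma> t) - f t\<bar>) \<longlongrightarrow> 0) (at_right 1))"
    and lam: "lam > 0"
    and B: "(\<exists>c\<ge>0. \<forall>t\<in>{-lam<..<lam}. \<forall>\<sigma>\<in>{1<..2}. U (Complex \<sigma> t) \<ge> - c)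
          \<or> (\<exists>M. \<forall>\<sigma>\<in>{1<..<2}. (LINT t:{-lam<..<lam}|lborel. \<bar>U (Complex \<sigma> t)\<bar>) \<le> M)
          \<or> (\<exists>(g :: real \<Rightarrow> real) (k :: nat).
               set_integrable lborel {-lam<..<lam} g \<and>
               (\<forall>\<sigma>\<in>{1<..2}. AE t in lborel. t \<in> {-lam<..<lam} \<longrightarrow> U (Complex \<sigma> t) \<ge> g t) \<and>
               (\<exists>C. \<forall>t\<in>{-lam<..<lam}. \<forall>\<sigma>\<in>{1<..2}. \<bar>U (Complex \<sigma> t)\<bar> \<le> C / (\<sigma> - 1) ^ k))"
  shows "\<exists>a. ((\<lambda>\<sigma>. (\<sigma> - 1) * U (Complex \<sigma> 0)) \<longlongrightarrow> a) (at_right 1) \<and>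
             ((\<lambda>x. S x / exp x) \<longlongrightarrow> a) at_top"
proof -
  interpret exp_order_one "ext0 S" by (rule exp_order_one_ext0[OF bv rc conv])
  have U: "U (Complex \<sigma> t) = Uh \<sigma> t" if "\<sigma> > 1" for \<sigma> t
    using U_def laplace_dS_eq[OF bv rc conv, of "Complex \<sigma> t"] Re_Lap[OF that, of t] that by simp
  from boundary obtain f :: "real \<Rightarrow> real" where
    f': "\<forall>a b. a \<le> b \<and> {a..b} \<subseteq> - {0} \<longrightarrow> set_integrable lborel {a..b} f"
    and fb': "\<forall>a b. a \<le> b \<and> {a..b} \<subseteq> - {0} \<longrightarrow>
           ((\<lambda>\<sigma>. LINT t:{a..b}|lborel. \<bar>U (Complex \<sigma> t) - f t\<bar>) \<longlongrightarrow> 0) (at_right 1)"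
    by (elim exE conjE)
  note f = f'[rule_format, OF conjI] and fb = fb'[rule_format, OF conjI]
  \<comment> \<open>The boundary function is given off 0 only; its value at 0 is set by convention,
    which no admissible interval notices.\<close>
  define f0 where "f0 t = (if t = 0 then 0 else f t)" for t
  interpret boundary_L1 "ext0 S" f0
  proof
    fix a b :: real assume ab: "a \<le> b" "{a..b} \<subseteq> - {0}"
    have eq: "f0 t = f t" if "t \<in> {a..b}" for t
      using ab(2) that by (auto simp: f0_def)
    have "(\<lambda>t. indicator {a..b} t * f0 t) = (\<lambda>t. indicator {a..b} t *\<^sub>R f t)"
      using eq by (auto simp: indicator_def)
    then show "integrable lborel (\<lambda>t. indicator {a..b} t * f0 t)"
      using f[OF ab] by (simp add: set_integrable_def)
    have "\<forall>\<^sub>F \<sigma> in at_right 1. (LINT t:{a..b}|lborel. \<bar>U (Complex \<sigma> t) - f t\<bar>) =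
       (LBINT t. indicator {a..b} t * \<bar>Uh \<sigma> t - f0 t\<bar>)"
      using eventually_at_right_less[of 1]
    proof eventually_elim
      case (elim \<sigma>)
      show ?case
        unfolding set_lebesgue_integral_def U[OF elim]
        using eq by (intro Bochner_Integration.integral_cong refl) (auto simp: indicator_def)
    qed
    with fb[OF ab] show "((\<lambda>\<sigma>. LBINT t. indicator {a..b} t * \<bar>Uh \<sigma> t - f0 t\<bar>) \<longlongrightarrow> 0) (at_right 1)"
      by (rule Lim_transform_eventually)
  qed
  \<comment> \<open>The common form of all three conditions. A lower bound, constant or integrable,
    is turned into it by the convexity argument.\<close>
  have "\<exists>\<mu>>0. \<exists>M. \<forall>\<^sub>F \<sigma> in at_right 1. (LBINT t. indicator {-\<mu>..\<mu>} t * \<bar>Uh \<sigma> t\<bar>) \<le> M"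
    using B
  proof (elim disjE)
    assume "\<exists>c\<ge>0. \<forall>t\<in>{-lam<..<lam}. \<forall>\<sigma>\<in>{1<..2}. U (Complex \<sigma> t) \<ge> - c"
    then obtain c where c: "\<And>t \<sigma>. t \<in> {-lam<..<lam} \<Longrightarrow> \<sigma> \<in> {1<..2} \<Longrightarrow> U (Complex \<sigma> t) \<ge> - c" by blast
    show ?thesis
    proof (rule L1_bounded_of_minorant[OF lam])
      show "integrable lborel (\<lambda>t. indicator {-lam<..<lam} t * (- c))"
        using lam by (intro integrable_mult_left integrable_real_indicator) auto
      show "AE t in lborel. t \<in> {-lam<..<lam} \<longrightarrow> - c \<le> Uh \<sigma> t" if "1 < \<sigma>" "\<sigma> \<le> 2" for \<sigma>
        using c[of _ \<sigma>] that by (intro AE_I2) (auto simp: U)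
    qed
  next
    assume "\<exists>(g :: real \<Rightarrow> real) (k :: nat).
               set_integrable lborel {-lam<..<lam} g \<and>
               (\<forall>\<sigma>\<in>{1<..2}. AE t in lborel. t \<in> {-lam<..<lam} \<longrightarrow> U (Complex \<sigma> t) \<ge> g t) \<and>
               (\<exists>C. \<forall>t\<in>{-lam<..<lam}. \<forall>\<sigma>\<in>{1<..2}. \<bar>U (Complex \<sigma> t)\<bar> \<le> C / (\<sigma> - 1) ^ k)"
    then obtain g where g: "set_integrable lborel {-lam<..<lam} g"
      "\<And>\<sigma>. \<sigma> \<in> {1<..2} \<Longrightarrow> AE t in lborel. t \<in> {-lam<..<lam} \<longrightarrow> U (Complex \<sigma> t) \<ge> g t" by blast
    show ?thesis
    proof (rule L1_bounded_of_minorant[OF lam])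
      show "integrable lborel (\<lambda>t. indicator {-lam<..<lam} t * g t)"
        using g(1) by (simp add: set_integrable_def)
      show "AE t in lborel. t \<in> {-lam<..<lam} \<longrightarrow> g t \<le> Uh \<sigma> t" if "1 < \<sigma>" "\<sigma> \<le> 2" for \<sigma>
        using g(2)[of \<sigma>] that by (simp add: U)
    qed
  next
    assume "\<exists>M. \<forall>\<sigma>\<in>{1<..<2}. (LINT t:{-lam<..<lam}|lborel. \<bar>U (Complex \<sigma> t)\<bar>) \<le> M"
    then obtain M where M: "\<And>\<sigma>. \<sigma> \<in> {1<..<2} \<Longrightarrow> (LINT t:{-lam<..<lam}|lborel. \<bar>U (Complex \<sigma> t)\<bar>) \<le> M" by blast
    \<comment> \<open>Halving passes from the open interval of the hypothesis to a closed one inside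
      it.\<close>
    have le: "(LBINT t. indicator {-(lam/2)..lam/2} t * \<bar>Uh \<sigma> t\<bar>) \<le> M" if \<sigma>: "\<sigma> \<in> {1<..<2}" for \<sigma>
    proof -
      have "(LBINT t. indicator {-(lam/2)..lam/2} t * \<bar>Uh \<sigma> t\<bar>) \<le>
        (LBINT t. indicator {-lam<..<lam} t * \<bar>Uh \<sigma> t\<bar>)"
      proof (rule integral_mono')
        have "integrable lborel (\<lambda>t. indicator {-lam..lam} t * \<bar>Uh \<sigma> t\<bar>)"
          using \<sigma> by (intro integrable_abs_Uh) simp
        then show "integrable lborel (\<lambda>t. indicator {-lam<..<lam} t * \<bar>Uh \<sigma> t\<bar>)"
          by (rule Bochner_Integration.integrable_bound) (use \<sigma> in \<open>auto simp: indicator_def\<close>)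
      qed (use lam in \<open>auto simp: indicator_def\<close>)
      also have "\<dots> = (LINT t:{-lam<..<lam}|lborel. \<bar>U (Complex \<sigma> t)\<bar>)"
        unfolding set_lebesgue_integral_def using \<sigma> by (simp add: U)
      also have "\<dots> \<le> M" by (rule M[OF \<sigma>])
      finally show ?thesis .
    qed
    have "\<forall>\<^sub>F \<sigma> in at_right (1::real). \<sigma> \<in> {1<..<2}"
      by (rule eventually_at_right_real) simp
    then have "\<forall>\<^sub>F \<sigma> in at_right 1. (LBINT t. indicator {-(lam/2)..lam/2} t * \<bar>Uh \<sigma> t\<bar>) \<le> M"
      by eventually_elim (rule le)
    then show ?thesis using lam by (intro exI[of _ "lam / 2"]) auto
  qed
  then obtain \<mu> M where \<mu>: "\<mu> > 0" and M: "\<forall>\<^sub>F \<sigma> in at_right 1. (LBINT t. indicator {-\<mu>..\<mu>} t * \<bar>Uh \<sigma> t\<bar>) \<le> M"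
    by blast
  interpret tauber "ext0 S" f0 \<mu> M
  proof
    show "\<mu> > 0" by fact
    show "f0 0 = 0" by (simp add: f0_def)
    show "\<forall>\<^sub>F \<sigma> in at_right 1. (LBINT t. indicator {-\<mu>..\<mu>} t * \<bar>Uh \<sigma> t\<bar>) \<le> M" by fact
    fix \<epsilon> :: real assume "\<epsilon> > 0"
    then obtain h x0 where h: "h > 0" "x0 > 0"
      "\<And>x y. x0 \<le> x \<Longrightarrow> x \<le> y \<Longrightarrow> y \<le> x + h \<Longrightarrow> (S y - S x) / exp x \<ge> - \<epsilon>"
      using slow unfolding log_linearly_slowly_decreasing_def by metis
    have "ext0 S y - ext0 S x \<ge> - \<epsilon> * exp x" if "x0 \<le> x" "x \<le> y" "y \<le> x + h" for x y
      using h(3)[OF that] h(2) that by (simp add: ext0_def pos_le_divide_eq)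
    then show "\<exists>h>0. \<exists>x0>0. \<forall>x y. x0 \<le> x \<and> x \<le> y \<and> y \<le> x + h \<longrightarrow> - \<epsilon> * exp x \<le> ext0 S y - ext0 S x"
      using h by blast
  qed
  obtain a where a: "(Tw 1 \<longlongrightarrow> a) at_top" using Tw_converges by blast
  obtain B where "\<And>x. \<bar>Tw 1 x\<bar> \<le> B" using Tw_bounded by blast
  then have "((\<lambda>\<sigma>. (\<sigma> - 1) * Uh \<sigma> 0) \<longlongrightarrow> a) (at_right 1)" using a by (rule abel_limit)
  moreover have "\<forall>\<^sub>F \<sigma> in at_right 1. (\<sigma> - 1) * Uh \<sigma> 0 = (\<sigma> - 1) * U (Complex \<sigma> 0)"
    using eventually_at_right_less[of 1] by eventually_elim (simp add: U)
  ultimately have "((\<lambda>\<sigma>. (\<sigma> - 1) * U (Complex \<sigma> 0)) \<longlongrightarrow> a) (at_right 1)"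
    by (rule Lim_transform_eventually)
  moreover have "((\<lambda>x. S x / exp x) \<longlongrightarrow> a) at_top"
  proof (rule Lim_transform_eventually[OF a])
    show "\<forall>\<^sub>F x in at_top. Tw 1 x = S x / exp x"
      using eventually_ge_at_top[of 0]
      by eventually_elim (simp add: Tw_def ext0_def exp_minus divide_inverse mult.commute)
  qed
  ultimately show ?thesis by blast
qed

end
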